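(* Let $a\in M^\infty_{v_s\otimes1}(\mathbb{R}^{2d})$ for some $s>0$ and let $\varphi_1,\varphi_2\in\mathcal{S}(\mathbb{R}^d)$ be nonzero. Assume $\sigma_P(A_a^{\varphi_1,\varphi_2})\setminus\{0\}\neq\emptyset$. If $\lambda\in\sigma_P(A_a^{\varphi_1,\varphi_2})\setminus\{0\}$, then every eigenfunction $f\in L^2(\mathbb{R}^d)$ of $A_a^{\varphi_1,\varphi_2}$ with eigenvalue $\lambda$ belongs to $\mathcal{S}(\mathbb{R}^d)$.
   Context: $T_xf(t)=f(t-x)$, $M_\omega f(t)=e^{2\pi it\cdot\omega}f(t)$, $V_\varphi f(x,\omega)=\langle f,M_\omega T_x\varphi\rangle=\int f(y)\overline{\varphi(y-x)}e^{-2\pi iy\cdot\omega}dy$. The localization operator is $A_a^{\varphi_1,\varphi_2}f=\int_{\mathbb{R}^{2d}}a(x,\omega)V_{\varphi_1}f(x,\omega)M_\omega T_x\varphi_2\,dx\,d\omega$ (weakly); under these hypotheses it is compact on $L^2(\mathbb{R}^d)$. $\sigma_P(T)$ is the set of eigenvalues of $T$ on $L^2$. $v_s(z)=(1+|z|^2)^{s/2}$. $M^\infty_{v_s\otimes1}(\mathbb{R}^{2d})$ is the space of $F\in\mathcal{S}'(\mathbb{R}^{2d})$ with $\sup_{z,\zeta\in\mathbb{R}^{2d}}|V_\phi F(z,\zeta)|v_s(z)<\infty$ for a fixed nonzero window $\phi\in\mathcal{S}(\mathbb{R}^{2d})$. *)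

theory Defs
  imports "HOL-Analysis.Analysis"
begin

fun iter_dd :: "'a::euclidean_space list \<Rightarrow> ('a \<Rightarrow> complex) \<Rightarrow> 'a \<Rightarrow> complex" where
  "iter_dd [] f = f"
| "iter_dd (v # vs) f = (\<lambda>x. frechet_derivative (iter_dd vs f) (at x) v)"

definition schwartz :: "('a::euclidean_space \<Rightarrow> complex) set" where
  "schwartz = {f. (\<forall>vs. set vs \<subseteq> Basis \<longrightarrow>
                    (\<forall>x. iter_dd vs f differentiable (at x)) \<and>
                    (\<forall>N::nat. \<exists>C. \<forall>x. (1 + norm x ^ 2) ^ N * norm (iter_dd vs f x) \<le> C))}"

definition schwartz_seminorm :: "nat \<Rightarrow> ('a::euclidean_space \<Rightarrow> complex) \<Rightarrow> real" where
  "schwartz_seminorm N f =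
     (SUP vs \<in> {vs. set vs \<subseteq> (Basis::'a set) \<and> length vs \<le> N}.
        SUP x. (1 + norm x ^ 2) ^ N * norm (iter_dd vs f x))"

text \<open>Tempered distributions, represented by their (bilinear) action on Schwartz
  functions: linear and continuous w.r.t. the Schwartz seminorms.
  The sesquilinear pairing is  <u, g> = u (conj o g).\<close>
definition tempered_distribution :: "(('a::euclidean_space \<Rightarrow> complex) \<Rightarrow> complex) \<Rightarrow> bool" where
  "tempered_distribution u \<longleftrightarrow>
     (\<forall>f\<in>schwartz. \<forall>g\<in>schwartz. \<forall>c::complex.
        u (\<lambda>x. f x + g x) = u f + u g \<and> u (\<lambda>x. c * f x) = c * u f) \<and>
     (\<exists>C N. \<forall>f\<in>schwartz. norm (u f) \<le> C * schwartz_seminorm N f)"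

definition transl :: "'a::euclidean_space \<Rightarrow> ('a \<Rightarrow> complex) \<Rightarrow> 'a \<Rightarrow> complex" where
  "transl x f = (\<lambda>t. f (t - x))"

definition modul :: "'a::euclidean_space \<Rightarrow> ('a \<Rightarrow> complex) \<Rightarrow> 'a \<Rightarrow> complex" where
  "modul \<omega> f = (\<lambda>t. exp (2 * pi * \<i> * complex_of_real (t \<bullet> \<omega>)) * f t)"

definition stft :: "('a::euclidean_space \<Rightarrow> complex) \<Rightarrow> ('a \<Rightarrow> complex) \<Rightarrow> 'a \<times> 'a \<Rightarrow> complex" where
  "stft \<phi> f = (\<lambda>(x, \<omega>). LINT y|lborel.
      f y * cnj (\<phi> (y - x)) * exp (- (2 * pi * \<i> * complex_of_real (y \<bullet> \<omega>))))"

definition stft_distr :: "('a::euclidean_space \<Rightarrow> complex) \<Rightarrow> (('a \<Rightarrow> complex) \<Rightarrow> complex) \<Rightarrow> 'a \<times> 'a \<Rightarrow> complex" where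
  "stft_distr \<phi> u = (\<lambda>(z, \<zeta>). u (\<lambda>t. cnj (modul \<zeta> (transl z \<phi>) t)))"

definition v_weight :: "real \<Rightarrow> 'a::real_normed_vector \<Rightarrow> real" where
  "v_weight s z = (1 + norm z ^ 2) powr (s / 2)"

definition gauss_window :: "'a::euclidean_space \<Rightarrow> complex" where
  "gauss_window z = complex_of_real (exp (- pi * norm z ^ 2))"

definition Minf_vs :: "real \<Rightarrow> (((real^'d::finite) \<times> (real^'d) \<Rightarrow> complex) \<Rightarrow> complex) set" where
  "Minf_vs s = {F. tempered_distribution F \<and>
      (\<exists>C. \<forall>z \<zeta>. norm (stft_distr gauss_window F (z, \<zeta>)) * v_weight s z \<le> C)}"

definition square_integrable :: "('a::euclidean_space \<Rightarrow> complex) \<Rightarrow> bool" where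
  "square_integrable f \<longleftrightarrow> f \<in> borel_measurable lborel \<and> integrable lborel (\<lambda>x. norm (f x) ^ 2)"

definition L2_inner :: "('a::euclidean_space \<Rightarrow> complex) \<Rightarrow> ('a \<Rightarrow> complex) \<Rightarrow> complex" where
  "L2_inner f g = (LINT x|lborel. f x * cnj (g x))"

text \<open>T represents the (unique) bounded operator on L^2(R^d) that is the
  localization operator A_a^{phi1,phi2}: it acts on square integrable functions,
  is compatible with a.e. equality, linear, bounded, and satisfies the weak
  definition  <A f, g> = <a, V_phi1 f * conj(V_phi2 g)>-bilinear on the dense
  subspace of Schwartz functions.\<close>
definition is_loc_op ::
  "(((real^'d::finite) \<times> (real^'d) \<Rightarrow> complex) \<Rightarrow> complex) \<Rightarrow> ((real^'d) \<Rightarrow> complex) \<Rightarrow> ((real^'d) \<Rightarrow> complex)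
    \<Rightarrow> (((real^'d) \<Rightarrow> complex) \<Rightarrow> ((real^'d) \<Rightarrow> complex)) \<Rightarrow> bool" where
  "is_loc_op a \<phi>1 \<phi>2 T \<longleftrightarrow>
     (\<forall>f. square_integrable f \<longrightarrow> square_integrable (T f)) \<and>
     (\<forall>f g. square_integrable f \<longrightarrow> square_integrable g \<longrightarrow> (AE x in lborel. f x = g x)
            \<longrightarrow> (AE x in lborel. T f x = T g x)) \<and>
     (\<forall>f g. square_integrable f \<longrightarrow> square_integrable g
            \<longrightarrow> (AE x in lborel. T (\<lambda>y. f y + g y) x = T f x + T g x)) \<and>
     (\<forall>f c. square_integrable f
            \<longrightarrow> (AE x in lborel. T (\<lambda>y. c * f y) x = c * T f x)) \<and>
     (\<exists>C. \<forall>f. square_integrable f \<longrightarrow>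
            (LINT x|lborel. norm (T f x) ^ 2) \<le> C * (LINT x|lborel. norm (f x) ^ 2)) \<and>
     (\<forall>f\<in>schwartz. \<forall>g\<in>schwartz.
            L2_inner (T f) g = a (\<lambda>z. stft \<phi>1 f z * cnj (stft \<phi>2 g z)))"

end

theory Submission
  imports Defs "HOL-Probability.Probability"
begin

text \<open>
  Let \<open>\<pi>(w)\<close> be the time-frequency shift by \<open>w = (p, q)\<close>. By covariance,
  \<open>V\<^sub>\<phi>\<^sub>1 f \<cdot> cnj (V\<^sub>\<phi>\<^sub>2 (\<pi>(w) \<phi>))\<close> is, up to a unimodular constant, the translate by \<open>w\<close> of
  \<open>V\<^sub>\<phi>\<^sub>1 (\<pi>(w)* f) \<cdot> cnj (V\<^sub>\<phi>\<^sub>2 \<phi>)\<close>, without any modulation. If all \<open>V\<^sub>\<psi> f\<close>, \<open>\<psi>\<close> Schwartz, decay like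
  \<open>v\<^sub>r\<^sup>-\<^sup>1\<close>, these untranslated products, multiplied by \<open>v\<^sub>r(w)\<close>, form a bounded family of Schwartz functions,
  because derivatives of \<open>V\<^sub>\<psi> f\<close> are again short-time Fourier transforms of \<open>f\<close> with other windows.
  The hypothesis on \<open>a\<close> makes the pairing of \<open>a\<close> with the translates by \<open>w\<close> of a bounded family decay like
  \<open>v\<^sub>s(w)\<^sup>-\<^sup>1\<close>: expand the function into Gaussian time-frequency shifts.
  Hence the eigenvalue equation improves \<open>r\<close> to \<open>r + s\<close>, and \<open>V\<^sub>\<psi> f\<close> decays rapidly for every \<open>\<psi>\<close>;
  Fourier inversion then yields a Schwartz representative of \<open>f\<close>.
\<close>

subsection \<open>Families of smooth functions with growth conditions\<close>

text \<open>The factor that contains the eigenfunction only has to grow polynomially: from v_r(w) <=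
  C v_r(z + w) v_r(z), the weight v_r(w) costs a power of z, uniformly in w, and the fixed Schwartz
  factor of the product absorbs it. Since each derivative changes the window, decay has to be
  carried along for all Schwartz windows at once, and since w is a parameter, every estimate has to
  be uniform in it; hence families instead of single functions. Two obstacles shape the rest. The
  symbol prescribes the operator on Schwartz functions only, while the eigenfunction is merely
  square integrable, so the weak identity must first be extended by density. And the Gaussian
  expansion has to be pulled through a distribution that is known only through seminorm bounds,
  which calls for an integrand that is Schwartz jointly in the phase-space point and the argument.
  The iteration can start at r = 0, because the transform of a square integrable function is
  bounded, and as every step gains the same s > 0, finitely many steps reach any power.\<close>

abbreviation bracket :: "'a::real_normed_vector \<Rightarrow> real" where
  "bracket x \<equiv> 1 + norm x ^ 2"

definition dird :: "'a::euclidean_space \<Rightarrow> ('a \<Rightarrow> complex) \<Rightarrow> 'a \<Rightarrow> complex" where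
  "dird b f = (\<lambda>x. frechet_derivative f (at x) b)"

lemma dird_eq:
  assumes "\<And>x. (f has_derivative D x) (at x)"
  shows "dird b f = (\<lambda>x. D x b)"
  unfolding dird_def using frechet_derivative_at[OF assms] by auto

text \<open>Coordinates reduce a derivative to finitely many directional derivatives, which can be
  estimated, shown measurable and shown regular one at a time.\<close>

lemma has_derivative_dird_sum:
  assumes "f differentiable (at x)"
  shows "(f has_derivative (\<lambda>v. \<Sum>c\<in>Basis. of_real (v \<bullet> c) * dird c f x)) (at x)"
proof -
  have d: "(f has_derivative frechet_derivative f (at x)) (at x)"
    using assms frechet_derivative_works by blast
  then interpret bounded_linear "frechet_derivative f (at x)"
    by (rule has_derivative_bounded_linear)
  have "frechet_derivative f (at x) v = (\<Sum>c\<in>Basis. of_real (v \<bullet> c) * dird c f x)" for v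
  proof -
    have "frechet_derivative f (at x) (\<Sum>c\<in>Basis. (v \<bullet> c) *\<^sub>R c) = (\<Sum>c\<in>Basis. of_real (v \<bullet> c) * dird c f x)"
      by (simp only: sum scaleR) (simp add: dird_def scaleR_conv_of_real)
    thus ?thesis by (simp add: euclidean_representation)
  qed
  hence "frechet_derivative f (at x) = (\<lambda>v. \<Sum>c\<in>Basis. of_real (v \<bullet> c) * dird c f x)" by (rule ext)
  thus ?thesis using d by metis
qed

lemma norm_dird_sum_le:
  fixes v :: "'a::euclidean_space"
  assumes "\<And>c. c \<in> Basis \<Longrightarrow> norm (g c) \<le> B"
  shows "norm (\<Sum>c\<in>Basis. complex_of_real (v \<bullet> c) * g c) \<le> real DIM('a) * B * norm v"
proof -
  have "norm (complex_of_real (v \<bullet> c) * g c) \<le> B * norm v" if "c \<in> Basis" for c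
    using mult_mono[OF Basis_le_norm[OF that, of v] assms[OF that]]
    by (simp add: norm_mult mult.commute)
  from sum_norm_le[of Basis, OF this] show ?thesis by (simp add: mult_ac)
qed

text \<open>Estimates are stated for families of functions, so that all constants are uniform in the
  index; \<open>regular R n F\<close> says that all derivative families up to order \<open>n\<close> satisfy the
  growth condition \<open>R\<close>.\<close>

fun regular :: "(('i \<Rightarrow> 'a::euclidean_space \<Rightarrow> complex) \<Rightarrow> bool) \<Rightarrow> nat \<Rightarrow> ('i \<Rightarrow> 'a \<Rightarrow> complex) \<Rightarrow> bool" where
  "regular R 0 F \<longleftrightarrow> R F"
| "regular R (Suc n) F \<longleftrightarrow> R F \<and> (\<forall>i x. F i differentiable (at x)) \<and>
     (\<forall>b\<in>Basis. regular R n (\<lambda>i. dird b (F i)))"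

definition smooth :: "(('i \<Rightarrow> 'a::euclidean_space \<Rightarrow> complex) \<Rightarrow> bool) \<Rightarrow> ('i \<Rightarrow> 'a \<Rightarrow> complex) \<Rightarrow> bool" where
  "smooth R F \<longleftrightarrow> (\<forall>n. regular R n F)"

text \<open>The weight sits on \<open>\<rho> x\<close> so that decay in some coordinates only, such
  as \<open>fst\<close> or \<open>snd\<close>, or decay after a change of variables can be
  expressed. The constant is shared by all indices.\<close>

definition rapid_in :: "('a \<Rightarrow> 'b::real_normed_vector) \<Rightarrow> ('i \<Rightarrow> 'a \<Rightarrow> complex) \<Rightarrow> bool" where
  "rapid_in \<rho> F \<longleftrightarrow> (\<forall>N. \<exists>C. \<forall>i x. bracket (\<rho> x) ^ N * norm (F i x) \<le> C)"

abbreviation rapid :: "('i \<Rightarrow> 'a::euclidean_space \<Rightarrow> complex) \<Rightarrow> bool" where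
  "rapid \<equiv> rapid_in (\<lambda>x. x)"

definition poly_growth :: "('i \<Rightarrow> 'a::euclidean_space \<Rightarrow> complex) \<Rightarrow> bool" where
  "poly_growth F \<longleftrightarrow> (\<exists>N C. \<forall>i x. norm (F i x) \<le> C * bracket x ^ N)"

text \<open>Apart from a rule for products, being a linear subspace is all that the differentiation
  rules ask of a growth condition.\<close>

definition additive_growth :: "(('i \<Rightarrow> 'a::euclidean_space \<Rightarrow> complex) \<Rightarrow> bool) \<Rightarrow> bool" where
  "additive_growth R \<longleftrightarrow> R (\<lambda>i x. 0) \<and> (\<forall>F G. R F \<longrightarrow> R G \<longrightarrow> R (\<lambda>i x. F i x + G i x))
     \<and> (\<forall>F c. R F \<longrightarrow> R (\<lambda>i x. c * F i x))"

lemma regular_base: "regular R n F \<Longrightarrow> R F"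
  by (cases n) auto

lemma regular_Suc: "regular R (Suc n) F \<Longrightarrow> regular R n F"
proof (induction n arbitrary: F)
  case 0 thus ?case by simp
next
  case (Suc n) thus ?case by (subst regular.simps(2)) auto
qed

text \<open>Uniqueness of derivatives lets any derivative found by the calculus rules stand in for
  \<open>frechet_derivative\<close>.\<close>

lemma regular_SucI:
  assumes "R F" "\<And>i x. (F i has_derivative D i x) (at x)"
    "\<And>b. b \<in> Basis \<Longrightarrow> regular R n (\<lambda>i x. D i x b)"
  shows "regular R (Suc n) F"
  using assms(1,3) differentiableI[OF assms(2)] dird_eq[OF assms(2)] by auto

lemma regular_mono:
  assumes "\<And>F. R F \<Longrightarrow> R' F" "regular R n F"
  shows "regular R' n F"
  using assms(2) by (induction n arbitrary: F) (auto intro: assms(1))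

lemma smooth_mono: "(\<And>F. R F \<Longrightarrow> R' F) \<Longrightarrow> smooth R F \<Longrightarrow> smooth R' F"
  unfolding smooth_def using regular_mono by blast

lemma smooth_iff:
  "smooth R F \<longleftrightarrow> R F \<and> (\<forall>i x. F i differentiable (at x)) \<and> (\<forall>b\<in>Basis. smooth R (\<lambda>i. dird b (F i)))"
proof
  assume s: "smooth R F"
  have r: "regular R (Suc n) F" for n using s smooth_def by blast
  show "R F \<and> (\<forall>i x. F i differentiable (at x)) \<and> (\<forall>b\<in>Basis. smooth R (\<lambda>i. dird b (F i)))"
    using r r[of 0] unfolding smooth_def by simp
next
  assume a: "R F \<and> (\<forall>i x. F i differentiable (at x)) \<and> (\<forall>b\<in>Basis. smooth R (\<lambda>i. dird b (F i)))"
  show "smooth R F" unfolding smooth_def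
  proof
    fix n show "regular R n F" using a by (cases n) (auto simp: smooth_def)
  qed
qed

lemma smoothD: "smooth R F \<Longrightarrow> R F" "smooth R F \<Longrightarrow> F i differentiable (at x)"
  "smooth R F \<Longrightarrow> b \<in> Basis \<Longrightarrow> smooth R (\<lambda>i. dird b (F i))"
  by (drule smooth_iff[THEN iffD1], simp)+

lemma smooth_continuous: "smooth R F \<Longrightarrow> continuous_on UNIV (F i)"
  by (meson smoothD(2) differentiable_imp_continuous_within continuous_at_imp_continuous_on)

lemma regular_add:
  assumes R: "additive_growth R" and "regular R n F" "regular R n G"
  shows "regular R n (\<lambda>i x. F i x + G i x)"
  using assms(2,3)
proof (induction n arbitrary: F G)
  case 0 thus ?case using R by (simp add: additive_growth_def)
next
  case (Suc n)
  show ?case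
  proof (rule regular_SucI)
    show "R (\<lambda>i x. F i x + G i x)" using Suc.prems R by (simp add: additive_growth_def)
    show "((\<lambda>x. F i x + G i x) has_derivative
       (\<lambda>v. frechet_derivative (F i) (at x) v + frechet_derivative (G i) (at x) v)) (at x)" for i x
      using Suc.prems by (intro has_derivative_add) (auto simp: frechet_derivative_works)
  next
    fix b :: 'b assume "b \<in> Basis"
    thus "regular R n (\<lambda>i x. frechet_derivative (F i) (at x) b + frechet_derivative (G i) (at x) b)"
      using Suc.IH[of "\<lambda>i. dird b (F i)" "\<lambda>i. dird b (G i)"] Suc.prems by (simp add: dird_def)
  qed
qed

text \<open>Leibniz rule. Three separate growth conditions let one induction serve polynomial times
  polynomial, polynomial times rapid, and decay in \<open>fst\<close> times decay in
  \<open>snd\<close>.\<close>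

lemma regular_mult:
  assumes R3: "additive_growth R3"
    and RR: "\<And>F G. R1 F \<Longrightarrow> R2 G \<Longrightarrow> R3 (\<lambda>i x. F i x * G i x)"
    and "regular R1 n F" "regular R2 n G"
  shows "regular R3 n (\<lambda>i x. F i x * G i x)"
  using assms(3,4)
proof (induction n arbitrary: F G)
  case 0 thus ?case using RR by simp
next
  case (Suc n)
  show ?case
  proof (rule regular_SucI)
    show "R3 (\<lambda>i x. F i x * G i x)" using Suc.prems RR by simp
    show "((\<lambda>x. F i x * G i x) has_derivative
       (\<lambda>v. F i x * frechet_derivative (G i) (at x) v + frechet_derivative (F i) (at x) v * G i x)) (at x)" for i x
      using Suc.prems by (intro has_derivative_mult) (auto simp: frechet_derivative_works)
  next
    fix b :: 'b assume b: "b \<in> Basis"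
    show "regular R3 n (\<lambda>i x. F i x * frechet_derivative (G i) (at x) b + frechet_derivative (F i) (at x) b * G i x)"
      by (rule regular_add[OF R3])
         (use Suc.IH[of F "\<lambda>i. dird b (G i)"] Suc.IH[of "\<lambda>i. dird b (F i)" G] Suc.prems b
           regular_Suc[OF Suc.prems(1)] regular_Suc[OF Suc.prems(2)] in \<open>simp_all add: dird_def\<close>)
  qed
qed

lemma regular_const:
  assumes "additive_growth R" "R (\<lambda>i x. c i)"
  shows "regular R n (\<lambda>i x. c i)"
proof -
  have z: "regular R n (\<lambda>i x. 0)" for n
  proof (induction n)
    case 0 show ?case using assms by (simp add: additive_growth_def)
  next
    case (Suc n)
    show ?case by (rule regular_SucI[where D = "\<lambda>i x v. 0"]) (use Suc assms in \<open>auto simp: additive_growth_def\<close>)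
  qed
  show ?thesis
  proof (cases n)
    case (Suc m)
    show ?thesis unfolding Suc
      by (rule regular_SucI[where D = "\<lambda>i x v. 0"]) (use z assms in auto)
  qed (use assms in simp)
qed

lemma regular_cmult:
  assumes "additive_growth R" "regular R n F"
  shows "regular R n (\<lambda>i x. c * F i x)"
  using assms(2)
proof (induction n arbitrary: F)
  case 0 thus ?case using assms(1) by (simp add: additive_growth_def)
next
  case (Suc n)
  show ?case
  proof (rule regular_SucI)
    show "R (\<lambda>i x. c * F i x)" using Suc.prems assms(1) by (simp add: additive_growth_def)
    show "((\<lambda>x. c * F i x) has_derivative (\<lambda>v. c * frechet_derivative (F i) (at x) v)) (at x)" for i x
      using Suc.prems by (intro has_derivative_mult_right) (auto simp: frechet_derivative_works)
  next
    fix b :: 'b assume b: "b \<in> Basis"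
    show "regular R n (\<lambda>i x. c * frechet_derivative (F i) (at x) b)"
      using Suc.IH[of "\<lambda>i. dird b (F i)"] Suc.prems b by (simp add: dird_def)
  qed
qed

lemma regular_sum:
  assumes "additive_growth R" "finite S" "\<And>j. j \<in> S \<Longrightarrow> regular R n (F j)"
  shows "regular R n (\<lambda>i x. \<Sum>j\<in>S. F j i x)"
  using assms(2,3)
proof (induction S rule: finite_induct)
  case empty
  have "R (\<lambda>i x. 0)" using assms(1) additive_growth_def by blast
  from regular_const[OF assms(1) this] show ?case by simp
next
  case (insert j S)
  thus ?case by (simp add: regular_add[OF assms(1)])
qed

text \<open>By the chain rule each derivative is a combination, with constant coefficients, of the
  \<open>dird c (F i)\<close> composed with \<open>L\<close>, so the induction stays in the class.
  \<open>R'\<close> may differ from \<open>R\<close> because a non-injective \<open>L\<close> leaves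
  decay in \<open>L x\<close> only.\<close>

lemma regular_compose_linear:
  fixes L :: "'c::euclidean_space \<Rightarrow> 'a::euclidean_space"
  assumes L: "bounded_linear L" and R': "additive_growth R'"
    and RR: "\<And>F. R F \<Longrightarrow> R' (\<lambda>i x. F i (L x))"
    and "regular R n F"
  shows "regular R' n (\<lambda>i x. F i (L x))"
  using assms(4)
proof (induction n arbitrary: F)
  case 0 thus ?case using RR by simp
next
  case (Suc n)
  show ?case
  proof (rule regular_SucI)
    show "R' (\<lambda>i x. F i (L x))" using Suc.prems RR by simp
    show "((\<lambda>x. F i (L x)) has_derivative (\<lambda>v. \<Sum>c\<in>Basis. of_real (L v \<bullet> c) * dird c (F i) (L x))) (at x)" for i x
    proof -
      have "(F i has_derivative (\<lambda>v. \<Sum>c\<in>Basis. of_real (v \<bullet> c) * dird c (F i) (L x))) (at (L x))"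
        using Suc.prems by (intro has_derivative_dird_sum) simp
      from has_derivative_compose[OF bounded_linear_imp_has_derivative[OF L] this]
      show ?thesis .
    qed
  next
    fix b :: 'c assume b: "b \<in> Basis"
    show "regular R' n (\<lambda>i x. \<Sum>c\<in>Basis. of_real (L b \<bullet> c) * dird c (F i) (L x))"
      by (intro regular_sum regular_cmult R' finite_Basis Suc.IH) (use Suc.prems in auto)
  qed
qed

lemma regular_reindex:
  assumes "\<And>F. R F \<Longrightarrow> R' (\<lambda>j. F (\<sigma> j))" "regular R n F"
  shows "regular R' n (\<lambda>j. F (\<sigma> j))"
  using assms(2)
proof (induction n arbitrary: F)
  case 0 thus ?case using assms(1)[of F] by simp
next
  case (Suc n)
  thus ?case using assms(1)[of F] Suc.IH[of "\<lambda>i. dird b (F i)" for b] by simp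
qed

text \<open>Each derivative is a polynomially growing factor times the same exponential, so the
  growth condition needs checking only once, for the exponential itself.\<close>

lemma regular_exp:
  assumes R: "additive_growth R" and RP: "\<And>F G. poly_growth F \<Longrightarrow> R G \<Longrightarrow> R (\<lambda>i x. F i x * G i x)"
    and q: "smooth poly_growth q" and "R (\<lambda>i x. exp (q i x))"
  shows "regular R n (\<lambda>i x. exp (q i x))"
proof (induction n)
  case 0 thus ?case using assms(4) by simp
next
  case (Suc n)
  show ?case
  proof (rule regular_SucI)
    show "((\<lambda>x. exp (q i x)) has_derivative (\<lambda>v. frechet_derivative (q i) (at x) v * exp (q i x))) (at x)" for i x
    proof -
      have "(q i has_derivative frechet_derivative (q i) (at x)) (at x)"
        using smoothD(2)[OF q] frechet_derivative_works by blast
      moreover have "(exp has_derivative (\<lambda>h. h * exp (q i x))) (at (q i x))"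
        using DERIV_exp[of "q i x"] unfolding has_field_derivative_def by (simp add: mult_commute_abs)
      ultimately show ?thesis by (rule has_derivative_compose)
    qed
  next
    fix b :: 'b assume b: "b \<in> Basis"
    have "regular poly_growth n (\<lambda>i. dird b (q i))" using smoothD(3)[OF q b] smooth_def by blast
    from regular_mult[OF R RP this Suc]
    show "regular R n (\<lambda>i x. frechet_derivative (q i) (at x) b * exp (q i x))" by (simp add: dird_def)
  qed (rule assms)
qed

lemma regular_cnj:
  assumes RR: "\<And>F. R F \<Longrightarrow> R (\<lambda>i x. cnj (F i x))" and "regular R n F"
  shows "regular R n (\<lambda>i x. cnj (F i x))"
  using assms(2)
proof (induction n arbitrary: F)
  case 0 thus ?case using RR by simp
next
  case (Suc n)
  show ?case
  proof (rule regular_SucI)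
    show "R (\<lambda>i x. cnj (F i x))" using Suc.prems RR by simp
    show "((\<lambda>x. cnj (F i x)) has_derivative (\<lambda>v. cnj (frechet_derivative (F i) (at x) v))) (at x)" for i x
      using Suc.prems by (intro bounded_linear.has_derivative[OF bounded_linear_cnj]) (auto simp: frechet_derivative_works)
  next
    fix b :: 'b assume b: "b \<in> Basis"
    show "regular R n (\<lambda>i x. cnj (frechet_derivative (F i) (at x) b))"
      using Suc.IH[of "\<lambda>i. dird b (F i)"] Suc.prems b by (simp add: dird_def)
  qed
qed

subsection \<open>Growth conditions\<close>

lemma one_le_bracket: "1 \<le> 1 + norm (x::'a::real_normed_vector) ^ 2"
  by simp

lemma bracket_pos: "0 < 1 + norm (x::'a::real_normed_vector) ^ 2"
  by (simp add: add_pos_nonneg)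

lemma bracket_power_pos: "0 < bracket (x::'a::real_normed_vector) ^ N"
  using bracket_pos by (rule zero_less_power)

text \<open>Peetre's inequality, the tool that moves polynomial weights across translations.\<close>

lemma bracket_add_le:
  fixes x y :: "'a::real_normed_vector"
  shows "1 + norm (x + y) ^ 2 \<le> 2 * bracket x * bracket y"
proof -
  have "norm (x + y) ^ 2 \<le> (norm x + norm y) ^ 2"
    by (intro power_mono norm_triangle_ineq) auto
  also have "\<dots> \<le> 2 * norm x ^ 2 + 2 * norm y ^ 2"
    using zero_le_power2[of "norm x - norm y"] by (simp add: power2_eq_square algebra_simps)
  also have "1 + \<dots> \<le> 2 * bracket x * bracket y"
    by (simp add: algebra_simps)
  finally show ?thesis by simp
qed

lemma rapid_inE:
  assumes "rapid_in \<rho> F"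
  obtains C where "C \<ge> 0" "\<And>i x. bracket (\<rho> x) ^ N * norm (F i x) \<le> C"
proof -
  obtain C where "\<And>i x. bracket (\<rho> x) ^ N * norm (F i x) \<le> C"
    using assms unfolding rapid_in_def by blast
  thus ?thesis using that[of "max 0 C"] by (meson max.coboundedI2 max.cobounded1)
qed

lemma poly_growthE:
  assumes "poly_growth F"
  obtains C N where "C \<ge> 0" "\<And>i x. norm (F i x) \<le> C * bracket x ^ N"
proof -
  obtain C N where *: "\<And>i x. norm (F i x) \<le> C * bracket x ^ N"
    using assms unfolding poly_growth_def by blast
  have "norm (F i x) \<le> max 0 C * bracket x ^ N" for i x
    using *[of i x] bracket_power_pos[of x N]
    by (meson max.cobounded2 less_eq_real_def mult_right_mono order_trans)
  thus ?thesis using that[of "max 0 C" N] by simp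
qed

lemma additive_growth_rapid_in:
  fixes \<rho> :: "'a::euclidean_space \<Rightarrow> 'b::real_normed_vector"
  shows "additive_growth (rapid_in \<rho> :: ('c \<Rightarrow> 'a \<Rightarrow> complex) \<Rightarrow> bool)"
  unfolding additive_growth_def
proof (intro conjI allI impI)
  show "rapid_in \<rho> (\<lambda>i x. 0)" unfolding rapid_in_def by auto
next
  fix F G :: "'c \<Rightarrow> 'a \<Rightarrow> complex" assume F: "rapid_in \<rho> F" and G: "rapid_in \<rho> G"
  show "rapid_in \<rho> (\<lambda>i x. F i x + G i x)" unfolding rapid_in_def
  proof
    fix N
    obtain C where C: "\<And>i x. bracket (\<rho> x) ^ N * norm (F i x) \<le> C" using F rapid_inE by metis
    obtain D where D: "\<And>i x. bracket (\<rho> x) ^ N * norm (G i x) \<le> D" using G rapid_inE by metis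
    have "bracket (\<rho> x) ^ N * norm (F i x + G i x) \<le> C + D" for i x
    proof -
      have "bracket (\<rho> x) ^ N * norm (F i x + G i x)
          \<le> bracket (\<rho> x) ^ N * (norm (F i x) + norm (G i x))"
        by (intro mult_left_mono norm_triangle_ineq) simp
      thus ?thesis using C[of x i] D[of x i] by (simp add: distrib_left)
    qed
    thus "\<exists>C. \<forall>i x. bracket (\<rho> x) ^ N * norm (F i x + G i x) \<le> C" by blast
  qed
next
  fix F :: "'c \<Rightarrow> 'a \<Rightarrow> complex" and c assume F: "rapid_in \<rho> F"
  show "rapid_in \<rho> (\<lambda>i x. c * F i x)" unfolding rapid_in_def
  proof
    fix N
    obtain C where C: "\<And>i x. bracket (\<rho> x) ^ N * norm (F i x) \<le> C" using F rapid_inE by metis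
    have "bracket (\<rho> x) ^ N * norm (c * F i x) \<le> norm c * C" for i x
      using mult_left_mono[OF C[of x i], of "norm c"] by (simp add: norm_mult mult_ac)
    thus "\<exists>C. \<forall>i x. bracket (\<rho> x) ^ N * norm (c * F i x) \<le> C" by blast
  qed
qed

lemma poly_growth_mult:
  assumes "poly_growth F" "poly_growth G"
  shows "poly_growth (\<lambda>i x. F i x * G i x)"
proof -
  obtain C N where C: "C \<ge> 0" "\<And>i x. norm (F i x) \<le> C * bracket x ^ N" using assms(1) poly_growthE by metis
  obtain D M where D: "D \<ge> 0" "\<And>i x. norm (G i x) \<le> D * bracket x ^ M" using assms(2) poly_growthE by metis
  have "norm (F i x * G i x) \<le> (C * D) * bracket x ^ (N + M)" for i x
  proof -
    have "norm (F i x) * norm (G i x) \<le> (C * bracket x ^ N) * (D * bracket x ^ M)"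
      by (intro mult_mono C D) (auto intro!: mult_nonneg_nonneg C D)
    thus ?thesis by (simp add: norm_mult power_add mult_ac)
  qed
  thus ?thesis unfolding poly_growth_def by blast
qed

lemma poly_growth_const: "bounded (range c) \<Longrightarrow> poly_growth (\<lambda>i x. c i)"
  unfolding poly_growth_def bounded_iff by (metis mult.right_neutral power_0 rangeI)

lemma additive_growth_poly:
  "additive_growth (poly_growth :: ('c \<Rightarrow> 'a::euclidean_space \<Rightarrow> complex) \<Rightarrow> bool)"
  unfolding additive_growth_def
proof (intro conjI allI impI)
  show "poly_growth (\<lambda>i x. 0)" unfolding poly_growth_def by (rule exI[of _ 0], rule exI[of _ 0]) simp
next
  fix F G :: "'c \<Rightarrow> 'a \<Rightarrow> complex" assume F: "poly_growth F" and G: "poly_growth G"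
  obtain C N where C: "C \<ge> 0" "\<And>i x. norm (F i x) \<le> C * bracket x ^ N" using F poly_growthE by metis
  obtain D M where D: "D \<ge> 0" "\<And>i x. norm (G i x) \<le> D * bracket x ^ M" using G poly_growthE by metis
  have "norm (F i x + G i x) \<le> (C + D) * bracket x ^ (N + M)" for i x
  proof -
    have "C * bracket x ^ N \<le> C * bracket x ^ (N + M)"
      by (intro mult_left_mono power_increasing C) auto
    moreover have "D * bracket x ^ M \<le> D * bracket x ^ (N + M)"
      by (intro mult_left_mono power_increasing D) auto
    ultimately show ?thesis
      using norm_triangle_ineq[of "F i x" "G i x"] C(2)[of i x] D(2)[of i x]
      by (simp add: distrib_right)
  qed
  thus "poly_growth (\<lambda>i x. F i x + G i x)" unfolding poly_growth_def by blast
next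
  fix F :: "'c \<Rightarrow> 'a \<Rightarrow> complex" and c assume F: "poly_growth F"
  have "poly_growth (\<lambda>(i::'c) (x::'a). c)" by (rule poly_growth_const) (simp add: image_constant_conv)
  from poly_growth_mult[OF this F] show "poly_growth (\<lambda>i x. c * F i x)" .
qed

lemma rapid_poly_mult:
  assumes "poly_growth F" "rapid G"
  shows "rapid (\<lambda>i x. F i x * G i x)"
  unfolding rapid_in_def
proof
  fix N
  obtain C M where C: "C \<ge> 0" "\<And>i x. norm (F i x) \<le> C * bracket x ^ M" using assms(1) poly_growthE by metis
  obtain D where D: "\<And>i x. bracket x ^ (N + M) * norm (G i x) \<le> D" using assms(2) rapid_inE by metis
  have "bracket x ^ N * norm (F i x * G i x) \<le> C * D" for i x
  proof -
    have "bracket x ^ N * norm (G i x) * norm (F i x) \<le> bracket x ^ N * norm (G i x) * (C * bracket x ^ M)"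
      by (intro mult_left_mono C) auto
    also have "\<dots> = C * (bracket x ^ (N + M) * norm (G i x))" by (simp add: power_add mult_ac)
    also have "\<dots> \<le> C * D" by (intro mult_left_mono D C)
    finally show ?thesis by (simp add: norm_mult mult_ac)
  qed
  thus "\<exists>C. \<forall>i x. bracket x ^ N * norm (F i x * G i x) \<le> C" by blast
qed

lemma rapid_imp_poly: "rapid F \<Longrightarrow> poly_growth F"
  unfolding rapid_in_def poly_growth_def by (metis mult.left_neutral mult.right_neutral power_0)

text \<open>Rests on 1 + |p|^2 + |q|^2 <= (1 + |p|^2) (1 + |q|^2).\<close>

lemma rapid_tensor:
  assumes "rapid_in fst F" "rapid_in snd G"
  shows "rapid (\<lambda>i x. F i x * G i x)"
  unfolding rapid_in_def
proof
  fix N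
  obtain C where C: "C \<ge> 0" "\<And>i x. bracket (fst x) ^ N * norm (F i x) \<le> C" using assms(1) rapid_inE by metis
  obtain D where D: "\<And>i x. bracket (snd x) ^ N * norm (G i x) \<le> D" using assms(2) rapid_inE by metis
  have "bracket x ^ N * norm (F i x * G i x) \<le> C * D" for i x
  proof -
    have "1 + norm x ^ 2 \<le> bracket (fst x) * bracket (snd x)"
      by (cases x) (simp add: norm_Pair algebra_simps)
    hence "bracket x ^ N \<le> (bracket (fst x) * bracket (snd x)) ^ N"
      by (intro power_mono) auto
    hence "bracket x ^ N * norm (F i x * G i x)
       \<le> (bracket (fst x) * bracket (snd x)) ^ N * norm (F i x * G i x)"
      by (intro mult_right_mono) auto
    also have "\<dots> = (bracket (fst x) ^ N * norm (F i x)) * (bracket (snd x) ^ N * norm (G i x))"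
      by (simp add: power_mult_distrib norm_mult mult_ac)
    also have "\<dots> \<le> C * D" by (intro mult_mono C D) auto
    finally show ?thesis .
  qed
  thus "\<exists>C. \<forall>i x. bracket x ^ N * norm (F i x * G i x) \<le> C" by blast
qed

text \<open>Used for an invertible shear of variables, whose inverse supplies the constant
  \<open>K\<close>.\<close>

lemma rapid_in_change:
  fixes L :: "'a::euclidean_space \<Rightarrow> 'b::real_normed_vector"
  assumes "rapid_in L F" "\<And>x. 1 + norm x ^ 2 \<le> K * bracket (L x)" "K \<ge> 0"
  shows "rapid F"
  unfolding rapid_in_def
proof
  fix N
  obtain C where C: "C \<ge> 0" "\<And>i x. bracket (L x) ^ N * norm (F i x) \<le> C" using assms(1) rapid_inE by metis
  have "bracket x ^ N * norm (F i x) \<le> K ^ N * C" for i x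
  proof -
    have "bracket x ^ N \<le> (K * bracket (L x)) ^ N"
      by (intro power_mono assms) auto
    hence "bracket x ^ N * norm (F i x) \<le> (K * bracket (L x)) ^ N * norm (F i x)"
      by (intro mult_right_mono) auto
    also have "\<dots> = K ^ N * (bracket (L x) ^ N * norm (F i x))" by (simp add: power_mult_distrib mult_ac)
    also have "\<dots> \<le> K ^ N * C" using assms(3) by (intro mult_left_mono C) auto
    finally show ?thesis .
  qed
  thus "\<exists>C. \<forall>i x. bracket x ^ N * norm (F i x) \<le> C" by blast
qed

lemma rapid_in_compose: "rapid_in \<rho> F \<Longrightarrow> rapid_in (\<lambda>x. \<rho> (L x)) (\<lambda>i x. F i (L x))"
  unfolding rapid_in_def by meson

lemma rapid_in_cnj: "rapid_in \<rho> F \<Longrightarrow> rapid_in \<rho> (\<lambda>i x. cnj (F i x))"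
  unfolding rapid_in_def by simp

lemma poly_growth_linear:
  assumes "bounded_linear l"
  shows "poly_growth (\<lambda>i x. complex_of_real (l x))"
proof -
  interpret bounded_linear l by fact
  obtain K where K: "K \<ge> 0" "\<And>x. norm (l x) \<le> norm x * K" using nonneg_bounded by blast
  have "norm (complex_of_real (l x)) \<le> K * bracket x ^ 1" for x
  proof -
    have "norm x \<le> 1 + norm x ^ 2"
      using zero_le_power2[of "norm x - 1/2"] by (simp add: power2_eq_square algebra_simps)
    hence "norm x * K \<le> bracket x * K" using K by (intro mult_right_mono)
    thus ?thesis using K(2)[of x] by (simp add: mult_ac)
  qed
  thus ?thesis unfolding poly_growth_def by blast
qed

lemma smooth_linear:
  assumes "bounded_linear l"
  shows "smooth poly_growth (\<lambda>i x. complex_of_real (l x))"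
  unfolding smooth_def
proof
  fix n show "regular poly_growth n (\<lambda>i x. complex_of_real (l x))"
  proof (cases n)
    case 0 thus ?thesis using poly_growth_linear[OF assms] by simp
  next
    case (Suc m)
    show ?thesis unfolding Suc
    proof (rule regular_SucI)
      show "poly_growth (\<lambda>i x. complex_of_real (l x))" by (rule poly_growth_linear[OF assms])
      show "((\<lambda>x. complex_of_real (l x)) has_derivative (\<lambda>v. complex_of_real (l v))) (at x)" for x
        by (intro bounded_linear_imp_has_derivative bounded_linear_compose[OF bounded_linear_of_real assms])
      show "regular poly_growth m (\<lambda>i x. complex_of_real (l b))" for b
        by (intro regular_const additive_growth_poly poly_growth_const) (simp add: image_constant_conv)
    qed
  qed
qed

lemma smooth_add: "additive_growth R \<Longrightarrow> smooth R F \<Longrightarrow> smooth R G \<Longrightarrow> smooth R (\<lambda>i x. F i x + G i x)"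
  unfolding smooth_def using regular_add by blast

lemma smooth_cmult: "additive_growth R \<Longrightarrow> smooth R F \<Longrightarrow> smooth R (\<lambda>i x. c * F i x)"
  unfolding smooth_def using regular_cmult by blast

lemma smooth_sum:
  "additive_growth R \<Longrightarrow> finite S \<Longrightarrow> (\<And>j. j \<in> S \<Longrightarrow> smooth R (F j)) \<Longrightarrow> smooth R (\<lambda>i x. \<Sum>j\<in>S. F j i x)"
  unfolding smooth_def using regular_sum by blast

lemma smooth_poly_mult: "smooth poly_growth F \<Longrightarrow> smooth poly_growth G \<Longrightarrow> smooth poly_growth (\<lambda>i x. F i x * G i x)"
  unfolding smooth_def using regular_mult[OF additive_growth_poly poly_growth_mult] by blast

lemma smooth_rapid_mult: "smooth poly_growth F \<Longrightarrow> smooth rapid G \<Longrightarrow> smooth rapid (\<lambda>i x. F i x * G i x)"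
  unfolding smooth_def using regular_mult[OF additive_growth_rapid_in rapid_poly_mult] by blast

lemma smooth_rapid_imp_poly: "smooth rapid F \<Longrightarrow> smooth poly_growth F"
  by (rule smooth_mono[OF rapid_imp_poly])

lemma smooth_reindex:
  assumes "\<And>F. R F \<Longrightarrow> R' (\<lambda>j. F (\<sigma> j))" "smooth R F"
  shows "smooth R' (\<lambda>j. F (\<sigma> j))"
  using assms(2) regular_reindex[where R=R and R'=R' and \<sigma>=\<sigma>, OF assms(1)] unfolding smooth_def by simp

lemma smooth_rapid_reindex: "smooth rapid F \<Longrightarrow> smooth rapid (\<lambda>j. F (\<sigma> j))"
  by (rule smooth_reindex[where R=rapid and R'=rapid]) (unfold rapid_in_def, meson)

lemma smooth_rapid_cnj: "smooth rapid F \<Longrightarrow> smooth rapid (\<lambda>i x. cnj (F i x))"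
  unfolding smooth_def using regular_cnj[where R=rapid] rapid_in_cnj by blast

lemma smooth_inner_square: "smooth poly_growth (\<lambda>i x::'a::euclidean_space. complex_of_real (norm x ^ 2))"
proof -
  have "smooth poly_growth (\<lambda>i x::'a. \<Sum>b\<in>Basis. complex_of_real (x \<bullet> b) * complex_of_real (x \<bullet> b))"
    by (intro smooth_sum smooth_poly_mult additive_growth_poly smooth_linear bounded_linear_inner_left) auto
  moreover have "(\<Sum>b\<in>Basis. complex_of_real (x \<bullet> b) * complex_of_real (x \<bullet> b)) = complex_of_real (norm x ^ 2)" for x :: 'a
    by (simp only: of_real_mult[symmetric] of_real_sum[symmetric]) (simp add: power2_norm_eq_inner euclidean_inner[of x x] del: of_real_power)
  ultimately show ?thesis by simp
qed

subsection \<open>Schwartz functions\<close>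

text \<open>\<open>iter_dd\<close> peels off the outermost derivative, \<open>regular\<close> the
  innermost one; appending at the end of the list is the bridge between the two recursions.\<close>

lemma iter_dd_snoc: "iter_dd (vs @ [v]) f = iter_dd vs (dird v f)"
  by (induction vs) (auto simp: dird_def)

lemma iter_dd_Cons: "iter_dd (v # vs) f = dird v (iter_dd vs f)"
  by (simp add: dird_def)

lemma smooth_iter_dd:
  assumes "smooth R F" "set vs \<subseteq> Basis"
  shows "smooth R (\<lambda>i. iter_dd vs (F i))"
  using assms(2)
proof (induction vs)
  case Nil thus ?case using assms by simp
next
  case (Cons v vs)
  thus ?case unfolding iter_dd_Cons using smoothD(3) by (metis insert_subset list.simps(15))
qed

lemma schwartzD:
  assumes "f \<in> schwartz" "set vs \<subseteq> Basis"
  shows "iter_dd vs f differentiable (at x)" "\<exists>C. \<forall>x. bracket x ^ N * norm (iter_dd vs f x) \<le> C"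
  using assms unfolding schwartz_def by simp_all

lemma schwartz_dird:
  assumes "f \<in> schwartz" "b \<in> Basis" shows "dird b f \<in> schwartz"
  unfolding schwartz_def
proof (intro CollectI allI impI conjI)
  fix vs :: "'a list" and x and N :: nat
  assume "set vs \<subseteq> Basis"
  hence "set (vs @ [b]) \<subseteq> Basis" using assms by simp
  from schwartzD[OF assms(1) this]
  show "iter_dd vs (dird b f) differentiable (at x)"
    "\<exists>C. \<forall>x. bracket x ^ N * norm (iter_dd vs (dird b f) x) \<le> C"
    unfolding iter_dd_snoc by blast+
qed

lemma schwartz_imp_smooth:
  assumes "f \<in> schwartz" shows "smooth rapid (\<lambda>_::'i. f)"
  unfolding smooth_def
proof
  fix n show "regular rapid n (\<lambda>_::'i. f)" using assms
  proof (induction n arbitrary: f)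
    case 0
    show ?case using schwartzD(2)[OF 0, of "[]"] by (simp add: rapid_in_def)
  next
    case (Suc n)
    have 1: "rapid (\<lambda>_::'i. f)" using schwartzD(2)[OF Suc.prems, of "[]"] by (simp add: rapid_in_def)
    have 2: "f differentiable (at x)" for x using schwartzD(1)[OF Suc.prems, of "[]"] by simp
    show ?case using 1 2 Suc.IH schwartz_dird[OF Suc.prems] by simp
  qed
qed

lemma smooth_imp_schwartz:
  assumes "smooth rapid F" shows "F i \<in> schwartz"
proof -
  have "(\<forall>x. iter_dd vs (F i) differentiable (at x)) \<and>
        (\<forall>N::nat. \<exists>C. \<forall>x. bracket x ^ N * norm (iter_dd vs (F i) x) \<le> C)"
    if "set vs \<subseteq> Basis" for vs
    using smoothD(1,2)[OF smooth_iter_dd[OF assms that]] unfolding rapid_in_def by blast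
  thus ?thesis by (simp add: schwartz_def)
qed

text \<open>A single function is a family over \<open>unit\<close>; through this equivalence the
  closure properties of \<open>schwartz\<close> are read off from those of families.\<close>

lemma schwartz_iff_smooth: "f \<in> schwartz \<longleftrightarrow> smooth rapid (\<lambda>_::unit. f)"
  by (rule iffI, erule schwartz_imp_smooth, erule smooth_imp_schwartz)

lemma schwartz_add: "f \<in> schwartz \<Longrightarrow> g \<in> schwartz \<Longrightarrow> (\<lambda>x. f x + g x) \<in> schwartz"
  unfolding schwartz_iff_smooth by (rule smooth_add[OF additive_growth_rapid_in])

lemma schwartz_cmult: "f \<in> schwartz \<Longrightarrow> (\<lambda>x. c * f x) \<in> schwartz"
  unfolding schwartz_iff_smooth by (rule smooth_cmult[OF additive_growth_rapid_in])

lemma schwartz_cnj: "f \<in> schwartz \<Longrightarrow> (\<lambda>x. cnj (f x)) \<in> schwartz"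
  unfolding schwartz_iff_smooth by (rule smooth_rapid_cnj)

lemma schwartz_linear_mult: "f \<in> schwartz \<Longrightarrow> bounded_linear l \<Longrightarrow> (\<lambda>x. of_real (l x) * f x) \<in> schwartz"
  unfolding schwartz_iff_smooth by (intro smooth_rapid_mult smooth_linear)

lemma schwartz_mult: "f \<in> schwartz \<Longrightarrow> g \<in> schwartz \<Longrightarrow> (\<lambda>x. f x * g x) \<in> schwartz"
  unfolding schwartz_iff_smooth by (intro smooth_rapid_mult smooth_rapid_imp_poly)

lemma schwartz_continuous: "f \<in> schwartz \<Longrightarrow> continuous_on UNIV f"
  using smooth_continuous[OF schwartz_imp_smooth] by blast

lemma schwartz_measurable [measurable_dest]: "f \<in> schwartz \<Longrightarrow> f \<in> borel_measurable borel"
  using schwartz_continuous borel_measurable_continuous_onI by blast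

lemma schwartz_differentiable: "f \<in> schwartz \<Longrightarrow> f differentiable (at x)"
  using smoothD(2)[OF schwartz_imp_smooth] by blast

lemma schwartz_has_derivative:
  "f \<in> schwartz \<Longrightarrow> (f has_derivative (\<lambda>v. \<Sum>c\<in>Basis. of_real (v \<bullet> c) * dird c f x)) (at x)"
  by (intro has_derivative_dird_sum schwartz_differentiable)

lemma schwartzE:
  assumes "f \<in> schwartz"
  obtains C where "C \<ge> 0" "\<And>x. bracket x ^ N * norm (f x) \<le> C"
  using rapid_inE[OF smoothD(1)[OF schwartz_imp_smooth[OF assms]], of N] by metis

subsection \<open>Integration on Euclidean space\<close>

text \<open>Lebesgue measure is the image of the product of one-dimensional Lebesgue measures under
  the coordinate map, so products over coordinates integrate factor by factor.\<close>

lemma lborel_product_integral: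
  fixes g :: "'a::euclidean_space \<Rightarrow> real \<Rightarrow> 'b::{real_normed_field,banach,second_countable_topology}"
  assumes g: "\<And>b. b \<in> Basis \<Longrightarrow> integrable lborel (g b)"
  shows "integrable lborel (\<lambda>x::'a. \<Prod>b\<in>Basis. g b (x \<bullet> b))" (is ?I)
    and "(LINT x|lborel. (\<Prod>b\<in>Basis. g b (x \<bullet> b))) = (\<Prod>b\<in>Basis. LINT t|lborel. g b t)" (is ?E)
proof -
  interpret product_sigma_finite "\<lambda>_::'a. lborel :: real measure" ..
  have m: "(\<lambda>f. \<Sum>b\<in>Basis. f b *\<^sub>R b) \<in> measurable (Pi\<^sub>M (Basis::'a set) (\<lambda>_. lborel)) (borel :: 'a measure)"
    by measurable
  have gm [measurable]: "g b \<in> borel_measurable borel" if "b \<in> Basis" for b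
    using borel_measurable_integrable[OF g[OF that]] by simp
  have m2: "(\<lambda>x::'a. \<Prod>b\<in>Basis. g b (x \<bullet> b)) \<in> borel_measurable borel"
    by measurable
  have e: "(\<Prod>b\<in>Basis. g b ((\<Sum>c\<in>Basis. f c *\<^sub>R c) \<bullet> b)) = (\<Prod>b\<in>Basis. g b (f b))" for f :: "'a \<Rightarrow> real"
    by (rule prod.cong) auto
  show ?I
    by (subst lborel_eq, subst integrable_distr_eq[OF m m2], simp only: e, rule product_integrable_prod)
       (use g in auto)
  show ?E
    by (subst lborel_eq, subst integral_distr[OF m m2], simp only: e, rule product_integral_prod)
       (use g in auto)
qed

text \<open>The exponent is the dimension because one factor \<open>bracket x\<close> is spent per
  coordinate: it dominates 1 + (x . b)^2, and the product of the functions 1 / (1 + t^2) is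
  integrable.\<close>

lemma integrable_inverse_bracket:
  "integrable lborel (\<lambda>x::'a::euclidean_space. 1 / bracket x ^ DIM('a))"
proof (rule Bochner_Integration.integrable_bound)
  have "integrable lborel (\<lambda>t::real. inverse (1 + t\<^sup>2))"
    using integrable_inverse_1_plus_square by (simp add: set_integrable_def)
  from lborel_product_integral(1)[OF this]
  show "integrable lborel (\<lambda>x::'a. \<Prod>b\<in>Basis. inverse (1 + (x \<bullet> b)\<^sup>2))" .
  have "(1::real) / bracket x ^ DIM('a) \<le> (\<Prod>b\<in>Basis. inverse (1 + (x \<bullet> b)\<^sup>2))" for x :: 'a
  proof -
    have "(\<Prod>b\<in>(Basis::'a set). inverse (bracket x)) \<le> (\<Prod>b\<in>Basis. inverse (1 + (x \<bullet> b)\<^sup>2))"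
    proof (rule prod_mono, safe)
      fix b :: 'a assume "b \<in> Basis"
      hence "(x \<bullet> b)\<^sup>2 \<le> norm x ^ 2" using power_mono[OF Basis_le_norm[of b x], of 2] by simp
      thus "inverse (bracket x) \<le> inverse (1 + (x \<bullet> b)\<^sup>2)"
        by (intro le_imp_inverse_le) (auto intro: add_pos_nonneg)
    qed auto
    thus ?thesis by (simp add: power_inverse divide_inverse)
  qed
  moreover have "0 \<le> (\<Prod>b\<in>Basis. inverse (1 + (x \<bullet> b)\<^sup>2))" for x :: 'a
    by (intro prod_nonneg) (auto intro: add_nonneg_nonneg)
  ultimately show "AE x in lborel. norm (1 / bracket (x::'a) ^ DIM('a)) \<le> norm (\<Prod>b\<in>Basis. inverse (1 + (x \<bullet> b)\<^sup>2))"
    by (intro AE_I2) (simp add: abs_of_nonneg)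
qed simp

lemma integrable_bracket_bound:
  fixes f :: "'a::euclidean_space \<Rightarrow> 'b::{banach,second_countable_topology}"
  assumes "f \<in> borel_measurable borel" "\<And>x. bracket x ^ DIM('a) * norm (f x) \<le> C"
  shows "integrable lborel f"
proof (rule Bochner_Integration.integrable_bound)
  show "integrable lborel (\<lambda>x::'a. C * (1 / bracket x ^ DIM('a)))"
    by (rule integrable_mult_right[OF integrable_inverse_bracket])
  have "norm (f x) \<le> C * (1 / bracket x ^ DIM('a))" for x
    using assms(2)[of x] bracket_power_pos[of x "DIM('a)"] by (simp add: field_simps)
  thus "AE x in lborel. norm (f x) \<le> norm (C * (1 / bracket x ^ DIM('a)))"
    by (intro AE_I2) (metis abs_ge_self order_trans real_norm_def)
qed (use assms in simp)

lemma integral_bracket_bound: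
  fixes f :: "'a::euclidean_space \<Rightarrow> 'b::{banach,second_countable_topology}"
  assumes "f \<in> borel_measurable borel" "\<And>x. bracket x ^ DIM('a) * norm (f x) \<le> C"
  shows "norm (LINT x|lborel. f x) \<le> C * (LINT x|lborel. 1 / bracket (x::'a) ^ DIM('a))"
proof -
  have "norm (LINT x|lborel. f x) \<le> (LINT x|lborel. norm (f x))"
    by (rule integral_norm_bound)
  also have "\<dots> \<le> (LINT x|lborel. C * (1 / bracket (x::'a) ^ DIM('a)))"
  proof (rule integral_mono)
    show "norm (f x) \<le> C * (1 / bracket x ^ DIM('a))" for x
      using assms(2)[of x] bracket_power_pos[of x "DIM('a)"] by (simp add: field_simps)
    show "integrable lborel (\<lambda>x. norm (f x))" using integrable_bracket_bound[OF assms] by simp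
  qed (rule integrable_mult_right[OF integrable_inverse_bracket])
  also have "\<dots> = C * (LINT x|lborel. 1 / bracket (x::'a) ^ DIM('a))"
    by (rule integral_mult_right_zero)
  finally show ?thesis .
qed

lemma lborel_integrable_translate:
  fixes f :: "'a::euclidean_space \<Rightarrow> 'b::{banach,second_countable_topology}"
  assumes "integrable lborel f" shows "integrable lborel (\<lambda>x. f (x + c))"
proof -
  have m: "(+) c \<in> measurable lborel borel" by simp
  have fm: "f \<in> borel_measurable borel" using assms by simp
  have "integrable (distr lborel borel ((+) c)) f" using assms by (simp add: lborel_distr_plus)
  thus ?thesis by (simp add: integrable_distr_eq[OF m fm] add.commute)
qed

lemma lborel_integral_translate:
  fixes f :: "'a::euclidean_space \<Rightarrow> 'b::{banach,second_countable_topology}"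
  assumes "f \<in> borel_measurable borel"
  shows "(LINT x|lborel. f (x + c)) = (LINT x|lborel. f x)"
proof -
  have m: "(+) c \<in> measurable lborel borel" by simp
  have "(LINT x|lborel. f x) = (LINT x|distr lborel borel ((+) c). f x)" by (simp add: lborel_distr_plus)
  also have "\<dots> = (LINT x|lborel. f (c + x))" by (rule integral_distr[OF m assms])
  finally show ?thesis by (simp add: add.commute)
qed

text \<open>Dominated convergence along sequences tending to \<open>x0\<close>. The mean value
  inequality on the unit ball bounds the normalised remainder by \<open>2 * g y\<close>, one
  \<open>g y\<close> from the difference quotient and one from the linear term.\<close>

lemma has_derivative_lborel_integral:
  fixes F :: "'y::euclidean_space \<Rightarrow> 'a::euclidean_space \<Rightarrow> complex"
  assumes D: "\<And>y x. x \<in> ball x0 1 \<Longrightarrow> (F y has_derivative F' y x) (at x)"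
    and B: "\<And>y x v. x \<in> ball x0 1 \<Longrightarrow> norm (F' y x v) \<le> g y * norm v"
    and g: "integrable lborel g"
    and F: "\<And>x. integrable lborel (\<lambda>y. F y x)"
    and m: "\<And>v. (\<lambda>y. F' y x0 v) \<in> borel_measurable lborel"
  shows "((\<lambda>x. LINT y|lborel. F y x) has_derivative (\<lambda>v. LINT y|lborel. F' y x0 v)) (at x0)"
proof -
  have x0: "x0 \<in> ball x0 1" by simp
  have g0: "0 \<le> g y" for y
  proof -
    obtain b :: 'a where b: "b \<in> Basis" using nonempty_Basis by blast
    show ?thesis using order_trans[OF norm_ge_zero B[OF x0, of y b]] b by simp
  qed
  have iF': "integrable lborel (\<lambda>y. F' y x0 v)" for v
    by (rule Bochner_Integration.integrable_bound[of _ "\<lambda>y. g y * norm v"])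
       (use g m B[OF x0] g0 in \<open>auto simp: abs_mult\<close>)
  have bl: "bounded_linear (F' y x0)" for y
    using D[OF x0] by (rule has_derivative_bounded_linear)
  have BL: "bounded_linear (\<lambda>v. LINT y|lborel. F' y x0 v)"
  proof (rule bounded_linear_intro)
    fix v w :: 'a and r :: real
    show "(LINT y|lborel. F' y x0 (v + w)) = (LINT y|lborel. F' y x0 v) + (LINT y|lborel. F' y x0 w)"
      using Bochner_Integration.integral_add[OF iF'[of v] iF'[of w]] linear_add[OF bounded_linear.linear[OF bl]]
      by simp
    show "(LINT y|lborel. F' y x0 (r *\<^sub>R v)) = r *\<^sub>R (LINT y|lborel. F' y x0 v)"
      using linear_scale[OF bounded_linear.linear[OF bl]] by simp
    have "norm (LINT y|lborel. F' y x0 v) \<le> (LINT y|lborel. norm (F' y x0 v))"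
      by (rule integral_norm_bound)
    also have "\<dots> \<le> (LINT y|lborel. g y * norm v)"
      by (rule integral_mono) (use iF' g B[OF x0] in auto)
    finally have "norm (LINT y|lborel. F' y x0 v) \<le> (LINT y|lborel. g y * norm v)" .
    thus "norm (LINT y|lborel. F' y x0 v) \<le> norm v * (LINT y|lborel. g y)" by (simp add: mult.commute)
  qed
  let ?R = "\<lambda>x y. norm (F y x - F y x0 - F' y x0 (x - x0)) / norm (x - x0)"
  have lim: "(\<lambda>n. LINT y|lborel. ?R (X n) y) \<longlonglongrightarrow> (LINT y|(lborel::'y measure). 0)"
    if X: "\<And>n. X n \<noteq> x0" "\<And>n. X n \<in> ball x0 1" "X \<longlonglongrightarrow> x0" for X
  proof (rule integral_dominated_convergence[where w = "\<lambda>y. 2 * g y"])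
    show "integrable lborel (\<lambda>y. 2 * g y)" using g by simp
    show "(\<lambda>y. ?R (X n) y) \<in> borel_measurable lborel" for n
      using borel_measurable_integrable[OF F[of "X n"]] borel_measurable_integrable[OF F[of x0]] m[of "X n - x0"]
      by measurable
    show "AE y in lborel. (\<lambda>n. ?R (X n) y) \<longlonglongrightarrow> 0"
    proof (rule AE_I2)
      fix y
      have "((\<lambda>x. ?R x y) \<longlongrightarrow> 0) (at x0)"
        using D[OF x0, of y] unfolding has_derivative_iff_norm by (simp add: diff_diff_eq)
      thus "(\<lambda>n. ?R (X n) y) \<longlonglongrightarrow> 0"
        using X(1,3) unfolding tendsto_at_iff_sequentially comp_def by simp
    qed
    show "AE y in lborel. norm (?R (X n) y) \<le> 2 * g y" for n
    proof (rule AE_I2)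
      fix y
      have "norm (F y (X n) - F y x0) \<le> g y * norm (X n - x0)"
      proof (rule differentiable_bound[of "ball x0 1"])
        fix x assume x: "x \<in> ball x0 1"
        show "(F y has_derivative F' y x) (at x within ball x0 1)" using D[OF x] has_derivative_at_withinI by blast
        show "onorm (F' y x) \<le> g y" by (rule onorm_le) (use B[OF x] in auto)
      qed (use X in auto)
      hence "norm (F y (X n) - F y x0 - F' y x0 (X n - x0)) \<le> 2 * g y * norm (X n - x0)"
        using norm_triangle_ineq4[of "F y (X n) - F y x0" "F' y x0 (X n - x0)"] B[OF x0, of y "X n - x0"] by simp
      thus "norm (?R (X n) y) \<le> 2 * g y" using X(1)[of n] by (simp add: divide_le_eq)
    qed
  qed simp
  have iR: "integrable lborel (?R x)" for x
    using F iF' by (intro integrable_divide integrable_norm Bochner_Integration.integrable_diff) auto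
  have le: "norm ((LINT y|lborel. F y x) - (LINT y|lborel. F y x0) - (LINT y|lborel. F' y x0 (x - x0))) / norm (x - x0)
        \<le> (LINT y|lborel. ?R x y)" for x
  proof -
    have "(LINT y|lborel. F y x) - (LINT y|lborel. F y x0) - (LINT y|lborel. F' y x0 (x - x0))
        = (LINT y|lborel. F y x - F y x0 - F' y x0 (x - x0))"
      using F iF' by (simp add: Bochner_Integration.integral_diff)
    also have "norm \<dots> \<le> (LINT y|lborel. norm (F y x - F y x0 - F' y x0 (x - x0)))" by (rule integral_norm_bound)
    finally have "norm ((LINT y|lborel. F y x) - (LINT y|lborel. F y x0) - (LINT y|lborel. F' y x0 (x - x0))) / norm (x - x0)
       \<le> (LINT y|lborel. norm (F y x - F y x0 - F' y x0 (x - x0))) / norm (x - x0)"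
      by (rule divide_right_mono) simp
    thus ?thesis by simp
  qed
  show ?thesis unfolding has_derivative_iff_norm
  proof (intro conjI BL)
    show "((\<lambda>x. norm ((LINT y|lborel. F y x) - (LINT y|lborel. F y x0) - (LINT y|lborel. F' y x0 (x - x0))) / norm (x - x0)) \<longlongrightarrow> 0) (at x0)"
      unfolding tendsto_at_iff_sequentially comp_def
    proof (intro allI impI)
      fix X assume X0: "\<forall>i. X i \<in> UNIV - {x0}" and X1: "X \<longlonglongrightarrow> x0"
      obtain N where N: "\<And>n. n \<ge> N \<Longrightarrow> X n \<in> ball x0 1"
        using X1 unfolding lim_sequentially mem_ball by (metis dist_commute zero_less_one)
      \<comment> \<open>The sequence lies in the ball only eventually, so its first \<open>N\<close>
        terms are cut off.\<close>
      have l: "(\<lambda>n. LINT y|lborel. ?R (X (n + N)) y) \<longlonglongrightarrow> 0"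
        using lim[of "\<lambda>n. X (n + N)"] X0 X1 N by (simp add: LIMSEQ_ignore_initial_segment)
      show "(\<lambda>n. norm ((LINT y|lborel. F y (X n)) - (LINT y|lborel. F y x0) - (LINT y|lborel. F' y x0 (X n - x0))) / norm (X n - x0)) \<longlonglongrightarrow> 0"
        by (rule LIMSEQ_offset[of _ N], rule Lim_null_comparison[OF _ l], intro always_eventually allI)
           (use le in simp)
    qed
  qed
qed

lemma bracket_shift_le:
  fixes x y :: "'a::real_normed_vector"
  assumes "norm x \<le> 1"
  shows "1 + norm y ^ 2 \<le> 4 * bracket (y + x)"
proof -
  have "norm (-x) ^ 2 \<le> 1" using power_mono[OF assms, of 2] by simp
  moreover have "1 + norm ((y + x) + (-x)) ^ 2 \<le> 2 * bracket (y + x) * bracket (-x)"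
    by (rule bracket_add_le)
  moreover have "2 * bracket (y + x) * bracket (-x) \<le> 2 * bracket (y + x) * 2"
    using calculation(1) by (intro mult_left_mono) auto
  ultimately show ?thesis by simp
qed

text \<open>Translation invariance makes the integral of \<open>u (y + x)\<close> independent of \<open>x\<close>;
  differentiating it gives the boundary-free integration by parts formula.\<close>

lemma integral_derivative_eq_0:
  fixes u :: "'a::euclidean_space \<Rightarrow> complex"
  assumes D: "\<And>x. (u has_derivative u' x) (at x)"
    and B: "\<And>x v. bracket x ^ DIM('a) * norm (u' x v) \<le> C * norm v"
    and u: "integrable lborel u"
    and m: "\<And>v. (\<lambda>y. u' y v) \<in> borel_measurable lborel"
  shows "(LINT x|lborel. u' x v) = 0"
proof -
  \<comment> \<open>The factor \<open>4 ^ DIM('a)\<close> pays for moving the weight from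
    \<open>y + x\<close> to \<open>y\<close> while \<open>x\<close> stays in the unit ball.\<close>
  let ?g = "\<lambda>y::'a. 4 ^ DIM('a) * C * (1 / bracket y ^ DIM('a))"
  have "((\<lambda>x. LINT y|lborel. u (y + x)) has_derivative (\<lambda>v. LINT y|lborel. u' (y + 0) v)) (at 0)"
  proof (rule has_derivative_lborel_integral[where g = ?g])
    show "((\<lambda>x. u (y + x)) has_derivative u' (y + x)) (at x)" for y x
    proof -
      have "((\<lambda>x. y + x) has_derivative (\<lambda>v. v)) (at x)" by (auto intro!: derivative_eq_intros)
      from has_derivative_compose[OF this D] show ?thesis .
    qed
    show "norm (u' (y + x) v) \<le> ?g y * norm v" if "x \<in> ball 0 1" for y x v
    proof -
      let ?N = "DIM('a)"
      have "bracket y ^ ?N \<le> (4 * bracket (y + x)) ^ ?N"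
        by (intro power_mono bracket_shift_le) (use that in auto)
      hence "bracket y ^ ?N * norm (u' (y + x) v) \<le> (4 * bracket (y + x)) ^ ?N * norm (u' (y + x) v)"
        by (intro mult_right_mono) auto
      also have "\<dots> = 4 ^ ?N * (bracket (y + x) ^ ?N * norm (u' (y + x) v))"
        by (simp only: power_mult_distrib mult.assoc)
      also have "\<dots> \<le> 4 ^ ?N * (C * norm v)" by (intro mult_left_mono B) simp
      finally show ?thesis using bracket_power_pos[of y ?N] by (simp add: field_simps)
    qed
    show "integrable lborel ?g" by (rule integrable_mult_right[OF integrable_inverse_bracket])
    show "integrable lborel (\<lambda>y. u (y + x))" for x by (rule lborel_integrable_translate[OF u])
    show "(\<lambda>y. u' (y + 0) v) \<in> borel_measurable lborel" for v using m by simp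
  qed
  moreover have "(\<lambda>x. LINT y|lborel. u (y + x)) = (\<lambda>x. LINT y|lborel. u y)"
    using u by (intro ext lborel_integral_translate) simp
  ultimately have "((\<lambda>x::'a. LINT y|lborel. u y) has_derivative (\<lambda>v. LINT y|lborel. u' y v)) (at 0)" by simp
  from has_derivative_unique[OF this has_derivative_const] show ?thesis by metis
qed

subsection \<open>Characters and the Gaussian\<close>

definition chr :: "real \<Rightarrow> complex" where "chr t = exp (2 * pi * \<i> * complex_of_real t)"

lemma chr_add: "chr (s + t) = chr s * chr t"
  by (simp add: chr_def exp_add[symmetric] distrib_left)

lemma chr_0 [simp]: "chr 0 = 1"
  by (simp add: chr_def)

lemma norm_chr [simp]: "norm (chr t) = 1"
proof -
  have "chr t = exp (\<i> * complex_of_real (2 * pi * t))" by (simp add: chr_def mult_ac)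
  thus ?thesis by (simp only: norm_exp_i_times)
qed

lemma cnj_chr: "cnj (chr t) = chr (- t)"
  by (simp add: chr_def exp_cnj)

lemma chr_minus: "exp (- (2 * pi * \<i> * complex_of_real t)) = chr (- t)"
  by (simp add: chr_def)

lemma chr_mult_minus [simp]: "chr t * chr (- t) = 1" "chr (- t) * chr t = 1"
  by (simp_all add: chr_add[symmetric])

lemma chr_has_derivative: "(chr has_derivative (\<lambda>v. 2 * pi * \<i> * complex_of_real v * chr t)) (at t)"
proof -
  have "((\<lambda>t. 2 * pi * \<i> * complex_of_real t) has_derivative (\<lambda>v. 2 * pi * \<i> * complex_of_real v)) (at t)"
    by (intro bounded_linear_imp_has_derivative bounded_linear_compose[OF bounded_linear_mult_right bounded_linear_of_real])
  moreover have "(exp has_derivative (\<lambda>h. h * chr t)) (at (2 * pi * \<i> * complex_of_real t))"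
    using DERIV_exp[of "2 * pi * \<i> * complex_of_real t"]
    unfolding has_field_derivative_def chr_def by (simp add: mult_commute_abs)
  ultimately show ?thesis
    using has_derivative_compose[of "\<lambda>t. 2 * pi * \<i> * complex_of_real t" _ t UNIV exp] unfolding chr_def by simp
qed

lemma continuous_on_chr [continuous_intros]: "continuous_on S f \<Longrightarrow> continuous_on S (\<lambda>x. chr (f x))"
  unfolding chr_def by (intro continuous_intros)

lemma measurable_chr [measurable]: "chr \<in> borel_measurable borel"
  by (intro borel_measurable_continuous_onI continuous_intros)

definition fourier :: "('a::euclidean_space \<Rightarrow> complex) \<Rightarrow> 'a \<Rightarrow> complex" where
  "fourier g \<omega> = (LINT x|lborel. g x * chr (- (x \<bullet> \<omega>)))"

lemma integrable_mult_chr: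
  assumes "integrable lborel g" "f \<in> borel_measurable borel"
  shows "integrable lborel (\<lambda>x. g x * chr (f x))"
  by (rule Bochner_Integration.integrable_bound[OF assms(1)]) (use assms in \<open>auto simp: norm_mult\<close>)

text \<open>The substitution of sqrt(2 pi) x for x turns the standard normal density into exp(-pi
  x^2) / sqrt(2 pi), and its known characteristic function into the self-duality of this
  Gaussian.\<close>

lemma fourier_gauss_real:
  "integrable lborel (\<lambda>x::real. complex_of_real (exp (- pi * x\<^sup>2)) * chr (- (x * \<omega>)))"
  "(LINT x|lborel. complex_of_real (exp (- pi * x\<^sup>2)) * chr (- (x * \<omega>))) = complex_of_real (exp (- pi * \<omega>\<^sup>2))"
proof -
  let ?c = "sqrt (2 * pi)" and ?t = "- sqrt (2 * pi) * \<omega>"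
  have c0: "?c \<noteq> 0" by simp
  have i0: "integrable lborel std_normal_density" by simp
  let ?f = "\<lambda>x::real. std_normal_density x *\<^sub>R iexp (?t * x)"
  have e: "?f (0 + ?c * x) = (1 / ?c) *\<^sub>R (complex_of_real (exp (- pi * x\<^sup>2)) * chr (- (x * \<omega>)))" for x
  proof -
    have "- (?c * x)\<^sup>2 / 2 = - pi * x\<^sup>2" by (simp add: power_mult_distrib)
    moreover have "iexp (?t * (?c * x)) = chr (- (x * \<omega>))"
    proof -
      have "?t * (?c * x) = - (2 * pi) * (\<omega> * x)"
        by (simp add: mult.assoc[symmetric] mult.commute[of _ \<omega>])
      thus ?thesis by (simp add: chr_def mult_ac)
    qed
    ultimately show ?thesis by (simp add: std_normal_density_def scaleR_conv_of_real)
  qed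
  have i1: "integrable lborel ?f"
    by (rule Bochner_Integration.integrable_bound[OF i0]) auto
  from lborel_integrable_real_affine[OF this c0, of 0]
  have "integrable lborel (\<lambda>x. ?f (0 + ?c * x))" .
  hence "integrable lborel (\<lambda>x. ?c *\<^sub>R ((1 / ?c) *\<^sub>R (complex_of_real (exp (- pi * x\<^sup>2)) * chr (- (x * \<omega>)))))"
    unfolding e by (rule integrable_scaleR_right)
  thus "integrable lborel (\<lambda>x::real. complex_of_real (exp (- pi * x\<^sup>2)) * chr (- (x * \<omega>)))" by simp
  have "complex_of_real (exp (- pi * \<omega>\<^sup>2)) = char std_normal_distribution ?t"
    by (simp add: char_std_normal_distribution power_mult_distrib)
  also have "\<dots> = (LINT x|lborel. ?f x)"
    unfolding char_def by (subst integral_density) (auto simp: scaleR_conv_of_real mult_ac)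
  also have "\<dots> = \<bar>?c\<bar> *\<^sub>R (LINT x|lborel. ?f (0 + ?c * x))" by (rule lborel_integral_real_affine[OF c0])
  also have "\<dots> = (LINT x|lborel. complex_of_real (exp (- pi * x\<^sup>2)) * chr (- (x * \<omega>)))"
    unfolding e by simp
  finally show "(LINT x|lborel. complex_of_real (exp (- pi * x\<^sup>2)) * chr (- (x * \<omega>))) = complex_of_real (exp (- pi * \<omega>\<^sup>2))" by simp
qed

lemma fourier_gauss:
  fixes \<omega> :: "'a::euclidean_space"
  shows "fourier gauss_window \<omega> = gauss_window \<omega>"
proof -
  have s: "norm x ^ 2 = (\<Sum>b\<in>Basis. (x \<bullet> b)\<^sup>2)" for x :: 'a
    by (subst power2_norm_eq_inner, subst euclidean_inner) (simp add: power2_eq_square)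
  have g: "gauss_window x = (\<Prod>b\<in>Basis. complex_of_real (exp (- pi * (x \<bullet> b)\<^sup>2)))" for x :: 'a
    unfolding gauss_window_def s by (simp only: sum_distrib_left exp_sum[OF finite_Basis] of_real_prod)
  have chr_sum: "chr (\<Sum>b\<in>S. f b) = (\<Prod>b\<in>S. chr (f b))" if "finite S" for S :: "'a set" and f
    using that by (induction S rule: finite_induct) (auto simp: chr_add)
  have c: "chr (- (x \<bullet> \<omega>)) = (\<Prod>b\<in>Basis. chr (- ((x \<bullet> b) * (\<omega> \<bullet> b))))" for x :: 'a
    by (subst chr_sum[symmetric]) (simp_all add: euclidean_inner[of x \<omega>] sum_negf)
  have "fourier gauss_window \<omega> = (LINT x|lborel. (\<Prod>b\<in>Basis. complex_of_real (exp (- pi * (x \<bullet> b)\<^sup>2)) * chr (- ((x \<bullet> b) * (\<omega> \<bullet> b)))))"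
    unfolding fourier_def g c by (simp only: prod.distrib)
  also have "\<dots> = (\<Prod>b\<in>Basis. complex_of_real (exp (- pi * (\<omega> \<bullet> b)\<^sup>2)))"
    by (subst lborel_product_integral(2)) (simp_all only: fourier_gauss_real)
  also have "\<dots> = gauss_window \<omega>" by (simp add: g)
  finally show ?thesis .
qed

lemma gauss_window_simps: "gauss_window (- x) = gauss_window x" "cnj (gauss_window x) = gauss_window x"
  "gauss_window x \<noteq> 0" "gauss_window 0 = 1" "norm (gauss_window x) = exp (- pi * norm x ^ 2)"
  by (simp_all add: gauss_window_def)

text \<open>With r = |x|^2 this is a question about one real variable: the limit at infinity handles
  large r, compactness the rest.\<close>

lemma gauss_bracket_bound: "\<exists>C. \<forall>x::'a::euclidean_space. bracket x ^ N * norm (gauss_window x) \<le> C"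
proof -
  have "((\<lambda>r::real. (1 + r) ^ N * exp (- pi * r)) \<longlongrightarrow> 0) at_top" by real_asymp
  hence "eventually (\<lambda>r. norm ((1 + r) ^ N * exp (- pi * r)) < 1) at_top"
    by (auto simp: tendsto_iff dist_norm)
  then obtain R where R: "\<And>r. r \<ge> R \<Longrightarrow> norm ((1 + r) ^ N * exp (- pi * r)) < 1"
    by (auto simp: eventually_at_top_linorder)
  have "continuous_on {0..max 0 R} (\<lambda>r::real. norm ((1 + r) ^ N * exp (- pi * r)))"
    by (intro continuous_intros)
  from continuous_attains_sup[OF compact_Icc _ this]
  obtain B where B: "\<And>r. r \<in> {0..max 0 R} \<Longrightarrow> norm ((1 + r) ^ N * exp (- pi * r)) \<le> B"
    by fastforce
  have "(1 + r) ^ N * exp (- pi * r) \<le> max 1 B" if "r \<ge> 0" for r :: real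
  proof (rule order_trans[OF abs_ge_self])
    show "\<bar>(1 + r) ^ N * exp (- pi * r)\<bar> \<le> max 1 B"
    proof (cases "r \<ge> R")
      case True
      from R[OF this] show ?thesis unfolding real_norm_def by linarith
    next
      case False
      hence "r \<in> {0..max 0 R}" using that by simp
      from B[OF this] show ?thesis unfolding real_norm_def by linarith
    qed
  qed
  hence "bracket x ^ N * norm (gauss_window x) \<le> max 1 B" for x :: 'a
    by (simp add: gauss_window_simps)
  thus ?thesis by blast
qed

lemma gauss_schwartz: "(gauss_window :: 'a::euclidean_space \<Rightarrow> complex) \<in> schwartz"
proof -
  have q: "smooth poly_growth (\<lambda>(i::unit) x::'a. - complex_of_real pi * complex_of_real (norm x ^ 2))"
    by (intro smooth_cmult additive_growth_poly smooth_inner_square)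
  have e: "(\<lambda>i x. exp (- complex_of_real pi * complex_of_real (norm x ^ 2))) = (\<lambda>(i::unit) (x::'a). gauss_window x)"
    by (simp add: gauss_window_def exp_of_real[symmetric])
  have "rapid (\<lambda>(i::unit) (x::'a). gauss_window x)"
    unfolding rapid_in_def
  proof
    fix N show "\<exists>C. \<forall>(i::unit) (x::'a). bracket x ^ N * norm (gauss_window x) \<le> C"
      using gauss_bracket_bound[where 'a='a, of N] by auto
  qed
  hence "smooth rapid (\<lambda>(i::unit) (x::'a). gauss_window x)"
    unfolding smooth_def using regular_exp[OF additive_growth_rapid_in rapid_poly_mult q] unfolding e by blast
  thus ?thesis by (simp add: schwartz_iff_smooth)
qed

lemma smooth_chr:
  assumes "smooth poly_growth (\<lambda>i x. complex_of_real (q i x))"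
  shows "smooth poly_growth (\<lambda>i x. chr (q i x))"
proof -
  have "smooth poly_growth (\<lambda>i x. 2 * pi * \<i> * complex_of_real (q i x))"
    by (rule smooth_cmult[OF additive_growth_poly assms])
  moreover have "poly_growth (\<lambda>i x. exp (2 * pi * \<i> * complex_of_real (q i x)))"
    unfolding poly_growth_def chr_def[symmetric] by (rule exI[of _ 0], rule exI[of _ 1]) simp
  ultimately show ?thesis
    unfolding chr_def by (subst smooth_def) (intro allI regular_exp additive_growth_poly poly_growth_mult)
qed

subsection \<open>A monotone class theorem for characters\<close>

text \<open>A functional monotone class argument that serves both \<open>fourier_unique\<close> and
  \<open>schwartz_dense\<close>. Closure under multiplication by characters takes the place of
  closure under products, which cannot be verified directly for the classes in question.\<close>

locale character_class =
  fixes P :: "('a::euclidean_space \<Rightarrow> complex) \<Rightarrow> bool"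
  assumes one: "P (\<lambda>x. 1)"
    and add: "\<And>f g. P f \<Longrightarrow> P g \<Longrightarrow> P (\<lambda>x. f x + g x)"
    and cmult: "\<And>f c. P f \<Longrightarrow> P (\<lambda>x. c * f x)"
    and chr: "\<And>f \<omega>. P f \<Longrightarrow> P (\<lambda>x. chr (x \<bullet> \<omega>) * f x)"
    and bdd: "\<And>f. P f \<Longrightarrow> \<exists>B. \<forall>x. norm (f x) \<le> B"
    and lim: "\<And>F f B. (\<And>n. P (F n)) \<Longrightarrow> (\<And>n x. norm (F n x) \<le> B) \<Longrightarrow> (\<And>x. (\<lambda>n. F n x) \<longlonglongrightarrow> f x) \<Longrightarrow> P f"
begin

lemma zero: "P (\<lambda>x. 0)"
  using cmult[OF one, of 0] by simp

text \<open>A shifted sine is a combination of two characters. Carrying a second factor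
  \<open>g\<close> along allows products to be built one factor at a time.\<close>

lemma sine: 
  assumes "P g"
  shows "P (\<lambda>x. of_real (sin (2 * pi * (x \<bullet> \<omega> - c))) * g x)"
proof -
  have e: "of_real (sin (2 * pi * (x \<bullet> \<omega> - c))) * g x
    = (chr (- c) / (2 * \<i>)) * (chr (x \<bullet> \<omega>) * g x) + (- chr c / (2 * \<i>)) * (chr (x \<bullet> (- \<omega>)) * g x)" for x
  proof -
    have "complex_of_real (sin (2 * pi * t)) = (chr t - chr (- t)) / (2 * \<i>)" for t
      by (simp add: chr_def sin_of_real[symmetric] sin_exp_eq mult_ac)
    from this[of "x \<bullet> \<omega> + (- c)"] chr_add[of "x \<bullet> \<omega>" "- c"] chr_add[of "- (x \<bullet> \<omega>)" c]
    have "complex_of_real (sin (2 * pi * (x \<bullet> \<omega> - c)))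
       = (chr (- c) * chr (x \<bullet> \<omega>) - chr c * chr (- (x \<bullet> \<omega>))) / (2 * \<i>)" by (simp add: mult.commute)
    thus ?thesis by (simp only:) (simp add: algebra_simps diff_divide_distrib)
  qed
  show ?thesis unfolding e by (rule add[OF cmult[OF chr[OF assms]] cmult[OF chr[OF assms]]])
qed

text \<open>\<open>g\<close> stays arbitrary in the induction: a product of polynomials acts by two
  successive multiplications.\<close>

lemma polynomial_sine:
  fixes p :: "real \<Rightarrow> real"
  assumes "real_polynomial_function p" "P g"
  shows "P (\<lambda>x. of_real (p (sin (2 * pi * (x \<bullet> \<omega> - c)))) * g x)"
  using assms
proof (induction p arbitrary: g rule: real_polynomial_function.induct)
  case (linear f)
  have "f y = f 1 * y" for y
    using linear_scale[OF bounded_linear.linear[OF linear(1)], of y 1] by (simp add: mult.commute)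
  from this[of "sin (2 * pi * (x \<bullet> \<omega> - c))" for x]
  have e: "complex_of_real (f (sin (2 * pi * (x \<bullet> \<omega> - c)))) * g x
     = of_real (f 1) * (of_real (sin (2 * pi * (x \<bullet> \<omega> - c))) * g x)" for x
    by (simp only: of_real_mult mult.assoc)
  show ?case unfolding e by (rule cmult[OF sine[OF linear(2)]])
next
  case (const k)
  thus ?case by (rule cmult)
next
  case (add f h)
  from character_class.add[OF character_class_axioms, OF add.IH(1)[OF add.prems] add.IH(2)[OF add.prems]]
  show ?case by (simp add: distrib_right)
next
  case (mult f h)
  from mult.IH(1)[OF mult.IH(2)[OF mult.prems]] show ?case by (simp add: mult.assoc)
qed

text \<open>Weierstrass approximation on [-1, 1], the range of sine. Errors of at most 1 keep the
  approximations uniformly bounded, as \<open>lim\<close> requires.\<close>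

lemma continuous_sine:
  fixes F :: "real \<Rightarrow> real"
  assumes F: "continuous_on {-1..1} F" and g: "P g"
  shows "P (\<lambda>x. of_real (F (sin (2 * pi * (x \<bullet> \<omega> - c)))) * g x)"
proof -
  have "\<exists>p. real_polynomial_function p \<and> (\<forall>y\<in>{-1..1}. \<bar>F y - p y\<bar> < 1 / real (Suc n))" for n
  proof (rule Stone_Weierstrass_real_polynomial_function[OF compact_Icc F, of "1 / real (Suc n)"])
    show "0 < 1 / real (Suc n)" by simp
  qed blast
  then obtain p where p: "\<And>n. real_polynomial_function (p n)"
    "\<And>n y. y \<in> {-1..1} \<Longrightarrow> \<bar>F y - p n y\<bar> < 1 / real (Suc n)" by metis
  obtain B where B: "\<And>x. norm (g x) \<le> B" using bdd[OF g] by blast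
  obtain K where K: "\<And>y. y \<in> {-1..1} \<Longrightarrow> \<bar>F y\<bar> \<le> K"
    using compact_imp_bounded[OF compact_continuous_image[OF F compact_Icc]] unfolding bounded_iff
    by (metis imageI real_norm_def)
  let ?s = "\<lambda>x. sin (2 * pi * (x \<bullet> \<omega> - c))"
  have s: "?s x \<in> {-1..1}" for x by simp
  show ?thesis
  proof (rule lim)
    show "P (\<lambda>x. of_real (p n (?s x)) * g x)" for n by (rule polynomial_sine[OF p(1) g])
    show "norm (of_real (p n (?s x)) * g x) \<le> (K + 1) * B" for n x
    proof -
      have "\<bar>p n (?s x)\<bar> \<le> \<bar>F (?s x)\<bar> + \<bar>F (?s x) - p n (?s x)\<bar>" by simp
      also have "\<dots> \<le> K + 1"
      proof (rule add_mono[OF K[OF s]])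
        have "1 / real (Suc n) \<le> 1" by simp
        thus "\<bar>F (?s x) - p n (?s x)\<bar> \<le> 1" using p(2)[OF s, of x n] by linarith
      qed
      finally show ?thesis unfolding norm_mult by (intro mult_mono B) (auto intro: order_trans[OF abs_ge_zero])
    qed
    show "(\<lambda>n. of_real (p n (?s x)) * g x) \<longlonglongrightarrow> of_real (F (?s x)) * g x" for x
    proof (intro tendsto_mult tendsto_of_real tendsto_const)
      show "(\<lambda>n. p n (?s x)) \<longlonglongrightarrow> F (?s x)"
      proof (rule LIM_zero_cancel, rule Lim_null_comparison[OF _ LIMSEQ_inverse_real_of_nat], intro always_eventually allI)
        fix n show "norm (p n (?s x) - F (?s x)) \<le> inverse (real (Suc n))"
          using p(2)[OF s, of x n] by (simp add: abs_minus_commute inverse_eq_divide)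
      qed
    qed
  qed
qed

text \<open>The ramps max 0 (min 1 (n y)) are continuous, take values in [0, 1] and tend to the
  indicator of y > 0.\<close>

lemma indicator_sine:
  assumes g: "P g"
  shows "P (\<lambda>x. indicator {x. sin (2 * pi * (x \<bullet> \<omega> - c)) > 0} x * g x)"
proof -
  obtain B where B: "\<And>x. norm (g x) \<le> B" using bdd[OF g] by blast
  let ?F = "\<lambda>n y. max 0 (min 1 (real n * y))"
  show ?thesis
  proof (rule lim)
    show "P (\<lambda>x. of_real (?F n (sin (2 * pi * (x \<bullet> \<omega> - c)))) * g x)" for n
      by (rule continuous_sine[OF _ g]) (intro continuous_intros)
    show "norm (of_real (?F n (sin (2 * pi * (x \<bullet> \<omega> - c)))) * g x) \<le> 1 * B" for n x
      unfolding norm_mult by (intro mult_mono B) auto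
    fix x
    let ?y = "sin (2 * pi * (x \<bullet> \<omega> - c))"
    have "(\<lambda>n. ?F n ?y) \<longlonglongrightarrow> (if ?y > 0 then 1 else 0)"
    proof (cases "?y > 0")
      case True
      obtain N :: nat where "real N * ?y > 1" using reals_Archimedean3[OF True] by blast
      moreover have "real n * ?y \<ge> real N * ?y" if "n \<ge> N" for n
        using that True by (intro mult_right_mono) auto
      ultimately have "\<forall>n\<ge>N. ?F n ?y = 1" by fastforce
      hence "eventually (\<lambda>n. ?F n ?y = 1) sequentially" unfolding eventually_sequentially by blast
      thus ?thesis using True by (simp add: tendsto_eventually)
    next
      case False
      hence "real n * ?y \<le> 0" for n by (simp add: mult_nonneg_nonpos)
      hence "?F n ?y = 0" for n by (meson dual_order.trans max.absorb1 min.cobounded2)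
      thus ?thesis using False by simp
    qed
    from tendsto_mult[OF tendsto_of_real[OF this] tendsto_const[of "g x"]]
    show "(\<lambda>n. of_real (?F n ?y) * g x) \<longlonglongrightarrow> indicator {x. sin (2 * pi * (x \<bullet> \<omega> - c)) > 0} x * g x"
      by (simp add: indicator_def of_bool_def if_distrib cong: if_cong)
  qed
qed

text \<open>Dividing the angle 2 pi (x . b - c) by n + 1 eventually brings it into (-pi, pi), where
  sine has the sign of its argument. So at each point the periodic indicators are eventually equal
  to that of the half-space.\<close>

lemma indicator_halfspace:
  assumes g: "P g"
  shows "P (\<lambda>x. indicator {x. x \<bullet> b > c} x * g x)"
proof -
  obtain B where B: "\<And>x. norm (g x) \<le> B" using bdd[OF g] by blast
  let ?A = "\<lambda>n. {x. sin (2 * pi * (x \<bullet> (inverse (real (Suc n)) *\<^sub>R b) - inverse (real (Suc n)) * c)) > 0}"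
  show ?thesis
  proof (rule lim)
    show "P (\<lambda>x. indicator (?A n) x * g x)" for n
      by (rule indicator_sine[OF g])
    show "norm (indicator (?A n) x * g x) \<le> 1 * B" for n x
      unfolding norm_mult by (intro mult_mono B) (auto simp: indicator_def)
    fix x
    let ?t = "x \<bullet> b - c"
    have e: "2 * pi * (x \<bullet> (inverse (real (Suc n)) *\<^sub>R b) - inverse (real (Suc n)) * c) = inverse (real (Suc n)) * (2 * pi * ?t)" for n
      by (simp add: algebra_simps)
    have "(\<lambda>n. inverse (real (Suc n)) * (2 * pi * ?t)) \<longlonglongrightarrow> 0"
      using tendsto_mult_left[OF LIMSEQ_inverse_real_of_nat, of "2 * pi * ?t"] by (simp add: mult.commute)
    hence "eventually (\<lambda>n. norm (inverse (real (Suc n)) * (2 * pi * ?t)) < pi) sequentially"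
      using pi_gt_zero by (auto simp: tendsto_iff dist_norm)
    hence "eventually (\<lambda>n. indicator (?A n) x * g x = indicator {x. x \<bullet> b > c} x * g x) sequentially"
    proof eventually_elim
      case (elim n)
      let ?u = "inverse (real (Suc n)) * (2 * pi * ?t)"
      have "sin ?u > 0 \<longleftrightarrow> ?u > 0"
      proof
        assume "?u > 0"
        thus "sin ?u > 0" using elim by (intro sin_gt_zero) auto
      next
        assume *: "sin ?u > 0"
        show "?u > 0"
        proof (rule ccontr)
          assume "\<not> ?u > 0"
          hence "sin (- ?u) \<ge> 0" using elim by (intro sin_ge_zero) auto
          thus False using * by simp
        qed
      qed
      also have "?u > 0 \<longleftrightarrow> x \<bullet> b > c" by (simp add: zero_less_mult_iff)
      finally have "x \<in> ?A n \<longleftrightarrow> x \<in> {x. x \<bullet> b > c}" by (simp only: e mem_Collect_eq)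
      thus ?case by (simp only: indicator_def)
    qed
    thus "(\<lambda>n. indicator (?A n) x * g x) \<longlonglongrightarrow> indicator {x. x \<bullet> b > c} x * g x" by (rule tendsto_eventually)
  qed
qed

text \<open>Each coordinate contributes two open half-spaces, one of them with normal
  \<open>- i\<close>; their indicators are multiplied in one after another.\<close>

lemma indicator_box: "P (indicator (box a b))"
proof -
  have *: "P (\<lambda>x. (\<Prod>i\<in>S. indicator {x. x \<bullet> i > a \<bullet> i} x * indicator {x. x \<bullet> (- i) > - (b \<bullet> i)} x))"
    if "finite S" for S :: "'a set"
    using that
  proof (induction S rule: finite_induct)
    case empty thus ?case using one by simp
  next
    case (insert i S)
    show ?case
      using indicator_halfspace[OF indicator_halfspace[OF insert.IH], where c = "a \<bullet> i" and b = i and c1 = "- (b \<bullet> i)" and b1 = "- i"] insert.hyps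
      by (simp add: mult.assoc)
  qed
  have "(\<Prod>i\<in>Basis. indicator {x. x \<bullet> i > a \<bullet> i} x * indicator {x. x \<bullet> (- i) > - (b \<bullet> i)} x) = (indicator (box a b) x :: complex)" for x
  proof (cases "x \<in> box a b")
    case True
    thus ?thesis by (auto simp: mem_box indicator_def intro!: prod.neutral)
  next
    case False
    then obtain i where "i \<in> Basis" "\<not> (a \<bullet> i < x \<bullet> i \<and> x \<bullet> i < b \<bullet> i)" by (auto simp: mem_box)
    hence "(\<Prod>i\<in>Basis. indicator {x. x \<bullet> i > a \<bullet> i} x * indicator {x. x \<bullet> (- i) > - (b \<bullet> i)} x) = (0 :: complex)"
      by (intro prod_zero) (auto intro!: bexI[of _ i] simp: indicator_def)
    thus ?thesis using False by simp
  qed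
  thus ?thesis using *[OF finite_Basis] by simp
qed

lemma sum: "finite S \<Longrightarrow> (\<And>j. j \<in> S \<Longrightarrow> P (F j)) \<Longrightarrow> P (\<lambda>x. \<Sum>j\<in>S. F j x)"
  by (induction S rule: finite_induct) (auto intro: zero add)

text \<open>Open boxes generate the Borel sets and are stable under intersection, so by Dynkin's
  theorem complements and disjoint unions suffice.\<close>

lemma indicator_borel:
  assumes "A \<in> sets borel"
  shows "P (indicator A)"
proof -
  have A: "A \<in> sigma_sets UNIV (range (\<lambda>(a, b). box a b))"
    using assms by (subst (asm) borel_eq_box) simp
  have "Int_stable (range (\<lambda>(a, b). box a b :: 'a set))"
    by (auto simp: Int_stable_def box_Int_box)
  moreover have "range (\<lambda>(a, b). box a b :: 'a set) \<subseteq> Pow UNIV" by simp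
  ultimately have "P (indicator A)" using A
  proof (rule sigma_sets_induct_disjoint[of "range (\<lambda>(a, b). box a b :: 'a set)" UNIV A "\<lambda>A. P (indicator A)"])
    show "P (indicator A)" if "A \<in> range (\<lambda>(a, b). box a b)" for A using that indicator_box by auto
    have "(indicator {} :: 'a \<Rightarrow> complex) = (\<lambda>x. 0)" by auto
    thus "P (indicator {})" using zero by simp
    show "P (indicator (UNIV - A))" if "P (indicator A)" for A :: "'a set"
    proof -
      from add[OF one cmult[OF that, of "-1"]] have "P (\<lambda>x. 1 + - 1 * indicator A x)" .
      moreover have "(\<lambda>x. 1 + - 1 * indicator A x) = (indicator (UNIV - A) :: 'a \<Rightarrow> complex)"
        by (auto simp: indicator_def fun_eq_iff)
      ultimately show ?thesis by simp
    qed
    show "P (indicator (\<Union>i. A i))" if d: "disjoint_family A" and A: "\<And>i. P (indicator (A i))" for A :: "nat \<Rightarrow> 'a set"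
    proof (rule lim)
      have e: "(\<Sum>i<n. indicator (A i) x) = (indicator (\<Union>i<n. A i) x :: complex)" for n x
      proof (subst indicator_UN_disjoint)
        show "disjoint_family_on A {..<n}" using d by (rule disjoint_family_on_mono[OF subset_UNIV])
      qed auto
      show "P (\<lambda>x. \<Sum>i<n. indicator (A i) x)" for n using A by (intro sum) auto
      show "norm (\<Sum>i<n. indicator (A i) x :: complex) \<le> 1" for n x unfolding e by (simp add: indicator_def)
      fix x
      show "(\<lambda>n. \<Sum>i<n. indicator (A i) x :: complex) \<longlonglongrightarrow> indicator (\<Union>i. A i) x"
        unfolding e by (rule LIMSEQ_indicator_UN)
    qed
  qed
  thus ?thesis .
qed

theorem bounded_borel:
  assumes f: "f \<in> borel_measurable borel" and B: "\<And>x. norm (f x) \<le> B"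
  shows "P f"
proof -
  obtain F where F: "\<And>i. simple_function borel (F i)" "\<And>x. (\<lambda>i. F i x) \<longlonglongrightarrow> f x"
    "\<And>i x. dist (F i x) 0 \<le> 2 * dist (f x) 0"
    using borel_measurable_implies_sequence_metric[OF f, of 0] by auto
  show ?thesis
  proof (rule lim[OF _ _ F(2)])
    fix i
    have "F i x = (\<Sum>y\<in>range (F i). y * indicator (F i -` {y}) x)" for x
      using simple_function_indicator_representation_banach[OF F(1)[of i], of x]
      by (simp add: indicator_scaleR_eq_if if_distrib[of "\<lambda>z. _ * z"] indicator_def of_bool_def mult.commute cong: if_cong)
         (simp add: if_distrib[of "\<lambda>z. z *\<^sub>R _"] cong: if_cong)
    moreover have "P (\<lambda>x. \<Sum>y\<in>range (F i). y * indicator (F i -` {y}) x)"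
    proof (intro sum cmult indicator_borel)
      show "finite (range (F i))" using F(1)[of i] by (auto simp: simple_function_def)
      show "F i -` {y} \<in> sets borel" if "y \<in> range (F i)" for y
        using F(1)[of i] that by (auto simp: simple_function_def)
    qed
    ultimately show "P (F i)" by (subst ext[of "F i" "\<lambda>x. \<Sum>y\<in>range (F i). y * indicator (F i -` {y}) x"])
    show "norm (F i x) \<le> 2 * B" for x using F(3)[of i x] B[of x] by simp
  qed
qed

end

lemma measurable_cnj [measurable]: "cnj \<in> borel_measurable borel"
  by (intro borel_measurable_continuous_onI continuous_intros)

subsection \<open>Fourier uniqueness and inversion\<close>

text \<open>The bounded \<open>f\<close> for which q f is orthogonal to all characters form a
  character class. It therefore contains \<open>cnj (sgn (q x))\<close>, whose pairing with
  \<open>q\<close> is the L1 norm.\<close>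

theorem fourier_unique:
  fixes q :: "'a::euclidean_space \<Rightarrow> complex"
  assumes q: "integrable lborel q" and z: "\<And>\<omega>. fourier q \<omega> = 0"
  shows "AE x in lborel. q x = 0"
proof -
  have [measurable]: "q \<in> borel_measurable borel" using q by simp
  \<comment> \<open>Quantifying over all frequencies is what makes \<open>P\<close> stable under
    multiplication by characters.\<close>
  define P where "P f \<longleftrightarrow> f \<in> borel_measurable borel \<and> (\<exists>B. \<forall>x. norm (f x) \<le> B) \<and>
     (\<forall>\<omega>. (LINT x|lborel. q x * (f x * chr (x \<bullet> \<omega>))) = 0)" for f :: "'a \<Rightarrow> complex"
  have PD: "\<exists>B. \<forall>x. norm (f x) \<le> B" if "P f" for f using that unfolding P_def by blast
  have PM [measurable_dest]: "f \<in> borel_measurable borel" if "P f" for f using that unfolding P_def by blast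
  have i: "integrable lborel (\<lambda>x. q x * (f x * chr (x \<bullet> \<omega>)))" if Pf: "P f" for f \<omega>
  proof -
    obtain B where B: "\<And>x. norm (f x) \<le> B" using PD[OF Pf] by blast
    have [measurable]: "f \<in> borel_measurable borel" using that unfolding P_def by blast
    show ?thesis
    proof (rule Bochner_Integration.integrable_bound)
      show "integrable lborel (\<lambda>x. q x * of_real B)" using q by simp
      show "AE x in lborel. norm (q x * (f x * chr (x \<bullet> \<omega>))) \<le> norm (q x * of_real B)"
        by (intro AE_I2) (auto simp: norm_mult intro!: mult_left_mono order_trans[OF B])
    qed measurable
  qed
  interpret character_class P
  proof
    show "P (\<lambda>x. 1)"
      unfolding P_def using z[of "- \<omega>" for \<omega>] by (auto simp: fourier_def)
    show "P (\<lambda>x. f x + g x)" if Pf: "P f" and Pg: "P g" for f g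
    proof -
      obtain B C where "\<forall>x. norm (f x) \<le> B" "\<forall>x. norm (g x) \<le> C" using PD[OF Pf] PD[OF Pg] by blast
      hence "\<forall>x. norm (f x + g x) \<le> B + C" by (meson add_mono norm_triangle_le)
      moreover have "(\<lambda>x. f x + g x) \<in> borel_measurable borel" using PM[OF Pf] PM[OF Pg] by measurable
      moreover have "(LINT x|lborel. q x * ((f x + g x) * chr (x \<bullet> \<omega>))) = 0" for \<omega>
        using Bochner_Integration.integral_add[OF i[OF Pf, of \<omega>] i[OF Pg, of \<omega>]] that
        by (simp add: P_def algebra_simps)
      ultimately show ?thesis unfolding P_def by blast
    qed
    show "P (\<lambda>x. c * f x)" if Pf: "P f" for f c
    proof -
      obtain B where B: "\<And>x. norm (f x) \<le> B" using PD[OF Pf] by blast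
      have "\<forall>x. norm (c * f x) \<le> norm c * B" by (auto simp: norm_mult intro!: mult_left_mono B)
      moreover have "(\<lambda>x. c * f x) \<in> borel_measurable borel" using PM[OF Pf] by measurable
      moreover have "(LINT x|lborel. q x * (c * f x * chr (x \<bullet> \<omega>))) = 0" for \<omega>
      proof -
        have "(LINT x|lborel. q x * (c * f x * chr (x \<bullet> \<omega>))) = (LINT x|lborel. c * (q x * (f x * chr (x \<bullet> \<omega>))))"
          by (simp add: mult_ac)
        also have "\<dots> = 0" using that by (simp only: integral_mult_right_zero) (simp add: P_def)
        finally show ?thesis .
      qed
      ultimately show ?thesis unfolding P_def by blast
    qed
    show "P (\<lambda>x. chr (x \<bullet> \<eta>) * f x)" if "P f" for f \<eta>
    proof -
      have [measurable]: "f \<in> borel_measurable borel" using that unfolding P_def by blast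
      have "(LINT x|lborel. q x * (chr (x \<bullet> \<eta>) * f x * chr (x \<bullet> \<omega>))) = (LINT x|lborel. q x * (f x * chr (x \<bullet> (\<eta> + \<omega>))))" for \<omega>
        by (simp add: inner_add_right chr_add mult_ac)
      moreover have "(\<lambda>x. chr (x \<bullet> \<eta>) * f x) \<in> borel_measurable borel" by measurable
      ultimately show ?thesis using that unfolding P_def by (simp add: norm_mult)
    qed
    show "\<exists>B. \<forall>x. norm (f x) \<le> B" if "P f" for f using that unfolding P_def by blast
    show "P f" if F: "\<And>n. P (F n)" and B: "\<And>n x. norm (F n x) \<le> B" and l: "\<And>x. (\<lambda>n. F n x) \<longlonglongrightarrow> f x" for F f B
      unfolding P_def
    proof (intro conjI allI exI)
      have [measurable]: "F n \<in> borel_measurable borel" for n using F unfolding P_def by blast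
      show fm [measurable]: "f \<in> borel_measurable borel"
        by (rule borel_measurable_LIMSEQ_metric[of F]) (use l in auto)
      show fB: "norm (f x) \<le> B" for x
        by (rule LIMSEQ_le_const2[OF tendsto_norm[OF l[of x]]]) (use B in auto)
      fix \<omega>
      have "(\<lambda>n. LINT x|lborel. q x * (F n x * chr (x \<bullet> \<omega>))) \<longlonglongrightarrow> (LINT x|lborel. q x * (f x * chr (x \<bullet> \<omega>)))"
      proof (rule integral_dominated_convergence[where w = "\<lambda>x. norm (q x) * B"])
        show "integrable lborel (\<lambda>x. norm (q x) * B)" using q by simp
        show "AE x in lborel. (\<lambda>n. q x * (F n x * chr (x \<bullet> \<omega>))) \<longlonglongrightarrow> q x * (f x * chr (x \<bullet> \<omega>))"
          by (intro AE_I2 tendsto_intros l)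
        show "AE x in lborel. norm (q x * (F n x * chr (x \<bullet> \<omega>))) \<le> norm (q x) * B" for n
          by (intro AE_I2) (auto simp: norm_mult intro!: mult_left_mono B)
      qed measurable
      moreover have "(LINT x|lborel. q x * (F n x * chr (x \<bullet> \<omega>))) = 0" for n using F unfolding P_def by blast
      ultimately show "(LINT x|lborel. q x * (f x * chr (x \<bullet> \<omega>))) = 0"
        by (simp add: LIMSEQ_const_iff)
    qed
  qed
  have "P (\<lambda>x. cnj (sgn (q x)))"
  proof (rule bounded_borel[of _ 1])
    show "(\<lambda>x. cnj (sgn (q x))) \<in> borel_measurable borel"
      unfolding sgn_div_norm by measurable
  qed (auto simp: norm_sgn)
  hence "(LINT x|lborel. q x * (cnj (sgn (q x)) * chr (x \<bullet> 0))) = 0" unfolding P_def by blast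
  moreover have "q x * (cnj (sgn (q x)) * chr (x \<bullet> 0)) = complex_of_real (norm (q x))" for x
  proof (cases "q x = 0")
    case False
    have "q x * cnj (sgn (q x)) = (q x * cnj (q x)) / of_real (norm (q x))"
      by (simp add: sgn_eq)
    also have "\<dots> = of_real (norm (q x))" using False by (simp add: complex_norm_square[symmetric] power2_eq_square)
    finally show ?thesis by simp
  qed simp
  ultimately have "complex_of_real (LINT x|lborel. norm (q x)) = 0" by simp
  hence "(LINT x|lborel. norm (q x)) = 0" by (simp only: of_real_eq_0_iff)
  thus ?thesis using integral_nonneg_eq_0_iff_AE[of lborel "\<lambda>x. norm (q x)"] q by simp
qed

text \<open>Justifies Fubini for kernels made of unimodular characters; \<open>h\<close> plays the
  role of the character.\<close>

lemma integrable_tensor: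
  fixes f :: "'a::euclidean_space \<Rightarrow> complex" and g :: "'b::euclidean_space \<Rightarrow> complex"
  assumes f: "integrable lborel f" and g: "integrable lborel g"
    and h: "h \<in> borel_measurable (lborel \<Otimes>\<^sub>M lborel)" "\<And>x y. norm (h (x, y)) \<le> 1"
  shows "integrable (lborel \<Otimes>\<^sub>M lborel) (\<lambda>(x, y). f x * g y * h (x, y))"
proof (rule Bochner_Integration.integrable_bound)
  have [measurable]: "f \<in> borel_measurable borel" "g \<in> borel_measurable borel" using f g by auto
  show "integrable (lborel \<Otimes>\<^sub>M lborel) (\<lambda>(x, y). f x * g y)"
  proof (rule lborel_pair.Fubini_integrable)
    show "integrable lborel (\<lambda>x. LINT y|lborel. norm (case (x, y) of (x, y) \<Rightarrow> f x * g y))"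
      using f by (simp add: norm_mult)
    show "AE x in lborel. integrable lborel (\<lambda>y. case (x, y) of (x, y) \<Rightarrow> f x * g y)"
      using g by simp
  qed measurable
  show "AE p in lborel \<Otimes>\<^sub>M lborel. norm (case p of (x, y) \<Rightarrow> f x * g y * h (x, y)) \<le> norm (case p of (x, y) \<Rightarrow> f x * g y)"
  proof (intro AE_I2)
    fix p :: "'a \<times> 'b"
    obtain x y where p: "p = (x, y)" by (cases p)
    have "norm (f x * g y) * norm (h (x, y)) \<le> norm (f x * g y) * 1" by (intro mult_left_mono h) auto
    thus "norm (case p of (x, y) \<Rightarrow> f x * g y * h (x, y)) \<le> norm (case p of (x, y) \<Rightarrow> f x * g y)"
      by (simp add: p norm_mult)
  qed
  show "(\<lambda>(x, y). f x * g y * h (x, y)) \<in> borel_measurable (lborel \<Otimes>\<^sub>M lborel)"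
    using h(1) by measurable
qed

lemma schwartz_integrable:
  fixes f :: "'a::euclidean_space \<Rightarrow> complex"
  assumes "f \<in> schwartz" shows "integrable lborel f"
  using schwartzE[OF assms, of "DIM('a)"] integrable_bracket_bound[OF schwartz_measurable[OF assms]] by metis

text \<open>The right-hand side \<open>k\<close> is merely bounded, so both sides are first
  multiplied by the Gaussian. Fubini and the self-duality of the Gaussian show that the products
  have the same Fourier transform; uniqueness applies, and the Gaussian, which never vanishes, is
  cancelled.\<close>

theorem fourier_inversion:
  fixes g :: "'a::euclidean_space \<Rightarrow> complex"
  assumes g: "integrable lborel g" and fg: "integrable lborel (fourier g)"
  shows "AE t in lborel. g t = (LINT \<omega>|lborel. fourier g \<omega> * chr (t \<bullet> \<omega>))"
proof -
  define k where "k t = (LINT \<omega>|lborel. fourier g \<omega> * chr (t \<bullet> \<omega>))" for t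
  have [measurable]: "g \<in> borel_measurable borel" "fourier g \<in> borel_measurable borel" using g fg by auto
  have gi: "integrable lborel (gauss_window :: 'a \<Rightarrow> complex)" by (rule schwartz_integrable[OF gauss_schwartz])
  have [measurable]: "(gauss_window :: 'a \<Rightarrow> complex) \<in> borel_measurable borel" by (rule schwartz_measurable[OF gauss_schwartz])
  have km [measurable]: "k \<in> borel_measurable borel"
    unfolding k_def by measurable
  define K where "K = (LINT \<omega>|lborel. norm (fourier g \<omega>))"
  have kB: "norm (k t) \<le> K" for t
  proof -
    have "norm (k t) \<le> (LINT \<omega>|lborel. norm (fourier g \<omega> * chr (t \<bullet> \<omega>)))" unfolding k_def by (rule integral_norm_bound)
    thus ?thesis by (simp add: norm_mult K_def)
  qed
  have i1: "integrable lborel (\<lambda>t. g t * gauss_window t)"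
  proof (rule Bochner_Integration.integrable_bound[OF g])
    show "AE t in lborel. norm (g t * gauss_window t) \<le> norm (g t)"
      by (intro AE_I2) (auto simp: norm_mult gauss_window_simps intro!: mult_left_le)
  qed measurable
  have i2: "integrable lborel (\<lambda>t. k t * gauss_window t)"
  proof (rule Bochner_Integration.integrable_bound)
    show "integrable lborel (\<lambda>t::'a. of_real K * gauss_window t)" using gi by simp
    show "AE t in lborel. norm (k t * gauss_window t) \<le> norm (of_real K * gauss_window t)"
      using kB by (intro AE_I2) (auto simp: norm_mult intro!: mult_right_mono order_trans[OF kB])
  qed measurable
  have "fourier (\<lambda>t. (g t - k t) * gauss_window t) \<eta> = 0" for \<eta>
  proof -
    have "(LINT t|lborel. k t * gauss_window t * chr (- (t \<bullet> \<eta>)))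
       = (LINT t|lborel. (LINT \<omega>|lborel. gauss_window t * fourier g \<omega> * (chr (t \<bullet> \<omega>) * chr (- (t \<bullet> \<eta>)))))"
      unfolding k_def by (simp add: mult_ac flip: integral_mult_right_zero integral_mult_left_zero)
    also have "\<dots> = (LINT \<omega>|lborel. (LINT t|lborel. gauss_window t * fourier g \<omega> * (chr (t \<bullet> \<omega>) * chr (- (t \<bullet> \<eta>)))))"
    proof (rule lborel_pair.Fubini_integral[symmetric])
      show "integrable (lborel \<Otimes>\<^sub>M lborel) (\<lambda>(t, \<omega>). gauss_window t * fourier g \<omega> * (chr (t \<bullet> \<omega>) * chr (- (t \<bullet> \<eta>))))"
        using integrable_tensor[OF gi fg, of "\<lambda>(t, \<omega>). chr (t \<bullet> \<omega>) * chr (- (t \<bullet> \<eta>))"] by (simp add: norm_mult case_prod_unfold)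
    qed
    also have "\<dots> = (LINT \<omega>|lborel. fourier g \<omega> * fourier gauss_window (\<eta> - \<omega>))"
      unfolding fourier_def[of gauss_window]
      by (simp add: inner_diff_right chr_add[symmetric] mult_ac flip: integral_mult_right_zero)
    also have "\<dots> = (LINT \<omega>|lborel. fourier g \<omega> * gauss_window (\<omega> - \<eta>))"
      unfolding fourier_gauss using gauss_window_simps(1)[of "\<eta> - \<omega>" for \<omega>] by simp
    also have "\<dots> = (LINT \<omega>|lborel. (LINT t|lborel. g t * gauss_window (\<omega> - \<eta>) * chr (- (t \<bullet> \<omega>))))"
      unfolding fourier_def by (simp add: mult_ac flip: integral_mult_right_zero integral_mult_left_zero)
    also have "\<dots> = (LINT t|lborel. (LINT \<omega>|lborel. g t * gauss_window (\<omega> - \<eta>) * chr (- (t \<bullet> \<omega>))))"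
    proof (rule lborel_pair.Fubini_integral)
      have "integrable lborel (\<lambda>\<omega>. gauss_window (\<omega> - \<eta>))"
        using lborel_integrable_translate[OF gi, of "- \<eta>"] by simp
      from integrable_tensor[OF g this, of "\<lambda>(t, \<omega>). chr (- (t \<bullet> \<omega>))"]
      show "integrable (lborel \<Otimes>\<^sub>M lborel) (\<lambda>(t, \<omega>). g t * gauss_window (\<omega> - \<eta>) * chr (- (t \<bullet> \<omega>)))"
        by (simp add: case_prod_unfold)
    qed
    also have "\<dots> = (LINT t|lborel. g t * gauss_window t * chr (- (t \<bullet> \<eta>)))"
    proof (rule Bochner_Integration.integral_cong[OF refl])
      fix t
      have "(LINT \<omega>|lborel. gauss_window (\<omega> - \<eta>) * chr (- (t \<bullet> \<omega>)))
          = (LINT \<omega>|lborel. gauss_window ((\<omega> + \<eta>) - \<eta>) * chr (- (t \<bullet> (\<omega> + \<eta>))))"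
        by (rule lborel_integral_translate[symmetric]) measurable
      also have "\<dots> = (LINT \<omega>|lborel. chr (- (t \<bullet> \<eta>)) * (gauss_window \<omega> * chr (- (\<omega> \<bullet> t))))"
        by (simp add: inner_add_right chr_add[symmetric] inner_commute[of _ t] mult_ac)
      also have "\<dots> = chr (- (t \<bullet> \<eta>)) * fourier gauss_window t"
        unfolding fourier_def by (rule integral_mult_right_zero)
      finally show "(LINT \<omega>|lborel. g t * gauss_window (\<omega> - \<eta>) * chr (- (t \<bullet> \<omega>))) = g t * gauss_window t * chr (- (t \<bullet> \<eta>))"
        by (simp add: fourier_gauss mult.assoc mult_ac)
    qed
    finally have "(LINT t|lborel. k t * gauss_window t * chr (- (t \<bullet> \<eta>))) = (LINT t|lborel. g t * gauss_window t * chr (- (t \<bullet> \<eta>)))" .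
    moreover have "fourier (\<lambda>t. (g t - k t) * gauss_window t) \<eta>
      = (LINT t|lborel. g t * gauss_window t * chr (- (t \<bullet> \<eta>)) - k t * gauss_window t * chr (- (t \<bullet> \<eta>)))"
      unfolding fourier_def by (simp add: left_diff_distrib)
    moreover have "\<dots> = (LINT t|lborel. g t * gauss_window t * chr (- (t \<bullet> \<eta>))) - (LINT t|lborel. k t * gauss_window t * chr (- (t \<bullet> \<eta>)))"
      using i1 i2 by (intro Bochner_Integration.integral_diff integrable_mult_chr) auto
    ultimately show ?thesis by simp
  qed
  moreover have "integrable lborel (\<lambda>t. (g t - k t) * gauss_window t)"
    using Bochner_Integration.integrable_diff[OF i1 i2] by (simp add: left_diff_distrib)
  ultimately have "AE t in lborel. (g t - k t) * gauss_window t = 0"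
    using fourier_unique by blast
  thus ?thesis unfolding k_def by (rule AE_mp) (auto simp: gauss_window_simps)
qed

subsection \<open>Square integrable functions\<close>

definition norm2 :: "('a::euclidean_space \<Rightarrow> complex) \<Rightarrow> real" where
  "norm2 f = (LINT x|lborel. norm (f x) ^ 2)"

lemma norm2_nonneg: "0 \<le> norm2 f"
  unfolding norm2_def by (rule Bochner_Integration.integral_nonneg) simp

lemma square_integrableD:
  assumes "square_integrable f"
  shows "f \<in> borel_measurable borel" "integrable lborel (\<lambda>x. norm (f x) ^ 2)"
  using assms unfolding square_integrable_def by auto

lemma norm_add_square_le: "norm (a + b :: 'a::real_normed_vector) ^ 2 \<le> 2 * norm a ^ 2 + 2 * norm b ^ 2"
proof -
  have "norm (a + b) ^ 2 \<le> (norm a + norm b) ^ 2" by (intro power_mono norm_triangle_ineq) auto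
  also have "\<dots> \<le> 2 * norm a ^ 2 + 2 * norm b ^ 2"
    using zero_le_power2[of "norm a - norm b"] by (simp add: power2_eq_square algebra_simps)
  finally show ?thesis .
qed

lemma square_integrable_bound:
  assumes "f \<in> borel_measurable borel" "integrable lborel h" "\<And>x. norm (f x) ^ 2 \<le> h x"
  shows "square_integrable f"
  unfolding square_integrable_def
proof
  show "integrable lborel (\<lambda>x. norm (f x) ^ 2)"
  proof (rule Bochner_Integration.integrable_bound[OF assms(2)])
    show "AE x in lborel. norm (norm (f x) ^ 2) \<le> norm (h x)"
      using assms(3) by (intro AE_I2) (simp, meson abs_ge_self order_trans)
  qed (use assms(1) in measurable)
qed (use assms(1) in simp)

lemma square_integrable_add:
  assumes "square_integrable f" "square_integrable g"
  shows "square_integrable (\<lambda>x. f x + g x)"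
    and "norm2 (\<lambda>x. f x + g x) \<le> 2 * norm2 f + 2 * norm2 g"
proof -
  note [measurable] = square_integrableD(1)[OF assms(1)] square_integrableD(1)[OF assms(2)]
  note i = square_integrableD(2)[OF assms(1)] square_integrableD(2)[OF assms(2)]
  have i2: "integrable lborel (\<lambda>x. 2 * norm (f x) ^ 2 + 2 * norm (g x) ^ 2)" using i by simp
  show 1: "square_integrable (\<lambda>x. f x + g x)"
    by (rule square_integrable_bound[OF _ i2 norm_add_square_le]) measurable
  have "norm2 (\<lambda>x. f x + g x) \<le> (LINT x|lborel. 2 * norm (f x) ^ 2 + 2 * norm (g x) ^ 2)"
    unfolding norm2_def by (rule integral_mono[OF square_integrableD(2)[OF 1] i2 norm_add_square_le])
  also have "\<dots> = 2 * norm2 f + 2 * norm2 g" using i by (simp add: norm2_def)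
  finally show "norm2 (\<lambda>x. f x + g x) \<le> 2 * norm2 f + 2 * norm2 g" .
qed

lemma square_integrable_cmult:
  assumes "square_integrable f"
  shows "square_integrable (\<lambda>x. c * f x)" and "norm2 (\<lambda>x. c * f x) = norm c ^ 2 * norm2 f"
proof -
  have "integrable lborel (\<lambda>x. norm c ^ 2 * norm (f x) ^ 2)" using square_integrableD(2)[OF assms] by simp
  thus "square_integrable (\<lambda>x. c * f x)"
    using square_integrableD(1)[OF assms] by (simp add: square_integrable_def norm_mult power_mult_distrib)
  show "norm2 (\<lambda>x. c * f x) = norm c ^ 2 * norm2 f"
    by (simp add: norm2_def norm_mult power_mult_distrib)
qed

lemma square_integrable_diff:
  assumes "square_integrable f" "square_integrable g"
  shows "square_integrable (\<lambda>x. f x - g x)"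
  using square_integrable_add(1)[OF assms(1) square_integrable_cmult(1)[OF assms(2), of "-1"]] by simp

lemma square_integrable_mult_bounded:
  assumes "square_integrable f" "m \<in> borel_measurable borel" "\<And>x. norm (m x) \<le> K"
  shows "square_integrable (\<lambda>x. m x * f x)" and "norm2 (\<lambda>x. m x * f x) \<le> K ^ 2 * norm2 f"
proof -
  note [measurable] = square_integrableD(1)[OF assms(1)] assms(2)
  have i: "integrable lborel (\<lambda>x. K ^ 2 * norm (f x) ^ 2)" using square_integrableD(2)[OF assms(1)] by simp
  have b: "norm (m x * f x) ^ 2 \<le> K ^ 2 * norm (f x) ^ 2" for x
    unfolding norm_mult power_mult_distrib by (intro mult_right_mono power_mono assms) auto
  show 1: "square_integrable (\<lambda>x. m x * f x)" by (rule square_integrable_bound[OF _ i b]) measurable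
  show "norm2 (\<lambda>x. m x * f x) \<le> K ^ 2 * norm2 f"
    using integral_mono[OF square_integrableD(2)[OF 1] i b] by (simp add: norm2_def)
qed

text \<open>The inequality 2 |f g| <= |f|^2 + |g|^2 takes the place of Cauchy-Schwarz: only bounds
  that are uniform on norm-bounded sets are called for later.\<close>

lemma square_integrable_mult:
  assumes "square_integrable f" "square_integrable g"
  shows "integrable lborel (\<lambda>x. f x * g x)"
    and "norm (LINT x|lborel. f x * g x) \<le> (norm2 f + norm2 g) / 2"
proof -
  note [measurable] = square_integrableD(1)[OF assms(1)] square_integrableD(1)[OF assms(2)]
  note i = square_integrableD(2)[OF assms(1)] square_integrableD(2)[OF assms(2)]
  have i2: "integrable lborel (\<lambda>x. (norm (f x) ^ 2 + norm (g x) ^ 2) / 2)" using i by simp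
  have b: "norm (f x * g x) \<le> (norm (f x) ^ 2 + norm (g x) ^ 2) / 2" for x
    using zero_le_power2[of "norm (f x) - norm (g x)"] by (simp add: norm_mult power2_eq_square algebra_simps)
  show 1: "integrable lborel (\<lambda>x. f x * g x)"
    by (rule Bochner_Integration.integrable_bound[OF i2])
       (use b in \<open>auto intro!: AE_I2 order_trans[OF b]\<close>)
  have "norm (LINT x|lborel. f x * g x) \<le> (LINT x|lborel. norm (f x * g x))" by (rule integral_norm_bound)
  also have "\<dots> \<le> (LINT x|lborel. (norm (f x) ^ 2 + norm (g x) ^ 2) / 2)"
    by (rule integral_mono[OF integrable_norm[OF 1] i2 b])
  also have "\<dots> = (norm2 f + norm2 g) / 2" using i by (simp add: norm2_def)
  finally show "norm (LINT x|lborel. f x * g x) \<le> (norm2 f + norm2 g) / 2" .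
qed

lemma square_integrable_bracket_bound:
  fixes f :: "'a::euclidean_space \<Rightarrow> complex"
  assumes "f \<in> borel_measurable borel" "\<And>x. bracket x ^ DIM('a) * norm (f x) \<le> C"
  shows "square_integrable f"
proof (rule square_integrable_bound[OF assms(1)])
  show "integrable lborel (\<lambda>x. C * norm (f x))"
    using integrable_bracket_bound[OF assms] by simp
  fix x
  have "1 * norm (f x) \<le> bracket x ^ DIM('a) * norm (f x)"
    by (intro mult_right_mono one_le_power one_le_bracket norm_ge_zero)
  hence "norm (f x) \<le> C" using assms(2)[of x] by simp
  thus "norm (f x) ^ 2 \<le> C * norm (f x)" unfolding power2_eq_square by (intro mult_right_mono) auto
qed

lemma schwartz_square_integrable:
  fixes f :: "'a::euclidean_space \<Rightarrow> complex"
  assumes "f \<in> schwartz" shows "square_integrable f"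
  using schwartzE[OF assms, of "DIM('a)"] square_integrable_bracket_bound[OF schwartz_measurable[OF assms]] by metis

lemma square_integrable_translate:
  assumes "square_integrable f"
  shows "square_integrable (\<lambda>x. f (x + c))" and "norm2 (\<lambda>x. f (x + c)) = norm2 f"
proof -
  note [measurable] = square_integrableD(1)[OF assms]
  show "square_integrable (\<lambda>x. f (x + c))"
    unfolding square_integrable_def
    using lborel_integrable_translate[OF square_integrableD(2)[OF assms], of c] by simp
  show "norm2 (\<lambda>x. f (x + c)) = norm2 f"
    unfolding norm2_def by (rule lborel_integral_translate) measurable
qed

section \<open>Modulations and translates of Schwartz functions\<close>

lemma schwartz_chr_mult:
  fixes f :: "'a::euclidean_space \<Rightarrow> complex"
  assumes "f \<in> schwartz" shows "(\<lambda>x. chr (x \<bullet> \<omega>) * f x) \<in> schwartz"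
  unfolding schwartz_iff_smooth
  by (intro smooth_rapid_mult smooth_chr smooth_linear bounded_linear_inner_left)
     (use assms schwartz_iff_smooth in blast)

lemma schwartz_translate:
  fixes f :: "'a::euclidean_space \<Rightarrow> complex"
  assumes "f \<in> schwartz" shows "(\<lambda>x. f (x + c)) \<in> schwartz"
proof -
  have "regular rapid n (\<lambda>_::unit. \<lambda>x. f (x + c))" if "f \<in> schwartz" for n and f :: "'a \<Rightarrow> complex"
    using that
  proof (induction n arbitrary: f)
    case (0 f)
    have "rapid (\<lambda>_::unit. \<lambda>x. f (x + c))" unfolding rapid_in_def
    proof
      fix N
      obtain C where C: "\<And>x. bracket x ^ N * norm (f x) \<le> C" using schwartzE[OF 0] by metis
      have "bracket x ^ N * norm (f (x + c)) \<le> (2 * bracket c) ^ N * C" for x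
      proof -
        have "1 + norm ((x + c) + (- c)) ^ 2 \<le> 2 * bracket (x + c) * bracket (- c)"
          by (rule bracket_add_le)
        hence "bracket x ^ N \<le> (2 * bracket c * bracket (x + c)) ^ N"
          by (intro power_mono) (simp_all add: algebra_simps)
        hence "bracket x ^ N * norm (f (x + c)) \<le> (2 * bracket c * bracket (x + c)) ^ N * norm (f (x + c))"
          by (intro mult_right_mono) auto
        also have "\<dots> = (2 * bracket c) ^ N * (bracket (x + c) ^ N * norm (f (x + c)))"
          by (simp only: power_mult_distrib mult.assoc)
        also have "\<dots> \<le> (2 * bracket c) ^ N * C" by (intro mult_left_mono C) auto
        finally show ?thesis .
      qed
      thus "\<exists>C. \<forall>(i::unit) x. bracket x ^ N * norm (f (x + c)) \<le> C" by blast
    qed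
    thus ?case by simp
  next
    case (Suc n f)
    show ?case
    proof (rule regular_SucI)
      show "rapid (\<lambda>_::unit. \<lambda>x. f (x + c))" using Suc.IH[OF Suc.prems] by (rule regular_base)
      show "((\<lambda>x. f (x + c)) has_derivative frechet_derivative f (at (x + c))) (at x)" for x
      proof -
        have "((\<lambda>x. x + c) has_derivative (\<lambda>v. v)) (at x)" by (auto intro!: derivative_eq_intros)
        moreover have "(f has_derivative frechet_derivative f (at (x + c))) (at (x + c))"
          using schwartz_differentiable[OF Suc.prems] frechet_derivative_works by blast
        ultimately show ?thesis by (rule has_derivative_compose)
      qed
      show "regular rapid n (\<lambda>_::unit. \<lambda>x. frechet_derivative f (at (x + c)) b)" if "b \<in> Basis" for b
        using Suc.IH[OF schwartz_dird[OF Suc.prems that]] by (simp add: dird_def)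
    qed
  qed
  thus ?thesis using assms unfolding schwartz_iff_smooth smooth_def by blast
qed

subsection \<open>Schwartz functions are dense\<close>

definition schwartz_limit :: "('a::euclidean_space \<Rightarrow> complex) \<Rightarrow> bool" where
  "schwartz_limit f \<longleftrightarrow> square_integrable f \<and> (\<forall>\<epsilon>>0. \<exists>p\<in>schwartz. norm2 (\<lambda>x. f x - p x) < \<epsilon>)"

lemma schwartz_limit_closed:
  assumes f: "square_integrable f" and "\<And>\<epsilon>. \<epsilon> > 0 \<Longrightarrow> \<exists>g. schwartz_limit g \<and> norm2 (\<lambda>x. f x - g x) < \<epsilon>"
  shows "schwartz_limit f"
  unfolding schwartz_limit_def
proof (intro conjI f allI impI)
  fix \<epsilon> :: real assume e: "\<epsilon> > 0"
  \<comment> \<open>\<open>norm2\<close> is the squared norm, whose triangle inequality carries a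
    factor 2; hence quarters of \<open>\<epsilon>\<close>.\<close>
  obtain g where g: "schwartz_limit g" "norm2 (\<lambda>x. f x - g x) < \<epsilon> / 4" using assms(2)[of "\<epsilon> / 4"] e by auto
  obtain p where p: "p \<in> schwartz" "norm2 (\<lambda>x. g x - p x) < \<epsilon> / 4"
    using g(1) e unfolding schwartz_limit_def by (meson divide_pos_pos zero_less_numeral)
  have sg: "square_integrable g" using g(1) schwartz_limit_def by blast
  have "norm2 (\<lambda>x. (f x - g x) + (g x - p x)) \<le> 2 * norm2 (\<lambda>x. f x - g x) + 2 * norm2 (\<lambda>x. g x - p x)"
    by (intro square_integrable_add square_integrable_diff f sg schwartz_square_integrable p)
  hence "norm2 (\<lambda>x. f x - p x) < \<epsilon>" using g p by simp
  thus "\<exists>p\<in>schwartz. norm2 (\<lambda>x. f x - p x) < \<epsilon>" using p by blast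
qed

lemma schwartz_limit_add:
  assumes "schwartz_limit f" "schwartz_limit g"
  shows "schwartz_limit (\<lambda>x. f x + g x)"
  unfolding schwartz_limit_def
proof (intro conjI allI impI)
  have f: "square_integrable f" and g: "square_integrable g" using assms schwartz_limit_def by blast+
  thus "square_integrable (\<lambda>x. f x + g x)" by (rule square_integrable_add)
  fix \<epsilon> :: real assume e: "\<epsilon> > 0"
  hence e4: "\<epsilon> / 4 > 0" by simp
  obtain p where p: "p \<in> schwartz" "norm2 (\<lambda>x. f x - p x) < \<epsilon> / 4"
    using assms(1) e4 unfolding schwartz_limit_def by blast
  obtain r where r: "r \<in> schwartz" "norm2 (\<lambda>x. g x - r x) < \<epsilon> / 4"
    using assms(2) e4 unfolding schwartz_limit_def by blast
  have "norm2 (\<lambda>x. (f x - p x) + (g x - r x)) \<le> 2 * norm2 (\<lambda>x. f x - p x) + 2 * norm2 (\<lambda>x. g x - r x)"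
    by (intro square_integrable_add square_integrable_diff f g schwartz_square_integrable p r)
  hence "norm2 (\<lambda>x. f x + g x - (p x + r x)) < \<epsilon>" using r p by (simp add: algebra_simps)
  thus "\<exists>p\<in>schwartz. norm2 (\<lambda>x. f x + g x - p x) < \<epsilon>" using schwartz_add[OF p(1) r(1)] by (intro bexI[of _ "\<lambda>x. p x + r x"])
qed

lemma schwartz_limit_mult:
  assumes f: "schwartz_limit f" and m: "m \<in> borel_measurable borel" "\<And>x. norm (m x) \<le> K"
    and S: "\<And>p. p \<in> schwartz \<Longrightarrow> (\<lambda>x. m x * p x) \<in> schwartz"
  shows "schwartz_limit (\<lambda>x. m x * f x)"
  unfolding schwartz_limit_def
proof (intro conjI allI impI)
  have sf: "square_integrable f" using f schwartz_limit_def by blast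
  show "square_integrable (\<lambda>x. m x * f x)" by (rule square_integrable_mult_bounded[OF sf m])
  fix \<epsilon> :: real assume e: "\<epsilon> > 0"
  \<comment> \<open>The summand 1 keeps the denominator positive when \<open>K\<close> is 0.\<close>
  have "\<epsilon> / (K ^ 2 + 1) > 0" using e by (simp add: add_nonneg_pos)
  then obtain p where p: "p \<in> schwartz" "norm2 (\<lambda>x. f x - p x) < \<epsilon> / (K ^ 2 + 1)"
    using f unfolding schwartz_limit_def by blast
  have "norm2 (\<lambda>x. m x * (f x - p x)) \<le> K ^ 2 * norm2 (\<lambda>x. f x - p x)"
    by (intro square_integrable_mult_bounded square_integrable_diff sf schwartz_square_integrable p m)
  also have "\<dots> \<le> (K ^ 2 + 1) * norm2 (\<lambda>x. f x - p x)"
    using norm2_nonneg by (intro mult_right_mono) auto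
  also have "\<dots> < \<epsilon>" using p(2) by (simp add: pos_less_divide_eq add_nonneg_pos mult.commute)
  finally have "norm2 (\<lambda>x. m x * f x - m x * p x) < \<epsilon>" by (simp add: right_diff_distrib)
  thus "\<exists>p\<in>schwartz. norm2 (\<lambda>x. m x * f x - p x) < \<epsilon>" using S[OF p(1)] by (intro bexI[of _ "\<lambda>x. m x * p x"])
qed

lemma norm2_dominated_convergence:
  assumes "\<And>n. F n \<in> borel_measurable borel" "f \<in> borel_measurable borel"
    and h: "integrable lborel h" "\<And>n x. norm (f x - F n x) ^ 2 \<le> h x"
    and l: "\<And>x. (\<lambda>n. F n x) \<longlonglongrightarrow> f x"
  shows "(\<lambda>n. norm2 (\<lambda>x. f x - F n x)) \<longlonglongrightarrow> 0"
proof -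
  note [measurable] = assms(1,2)
  have "(\<lambda>n. LINT x|lborel. norm (f x - F n x) ^ 2) \<longlonglongrightarrow> (LINT x|(lborel::'a measure). 0)"
  proof (rule integral_dominated_convergence[OF _ _ h(1)])
    show "AE x in lborel. (\<lambda>n. norm (f x - F n x) ^ 2) \<longlonglongrightarrow> 0"
    proof (intro AE_I2)
      fix x
      have "(\<lambda>n. norm (f x - F n x) ^ 2) \<longlonglongrightarrow> norm (f x - f x) ^ 2" by (intro tendsto_intros l)
      thus "(\<lambda>n. norm (f x - F n x) ^ 2) \<longlonglongrightarrow> 0" by simp
    qed
  qed (use h(2) in auto)
  thus ?thesis by (simp add: norm2_def)
qed

text \<open>Characters times the Gaussian are Schwartz, so the bounded \<open>h\<close> for which
  \<open>h\<close> times the Gaussian is an L2 limit of Schwartz functions form a character class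
  and exhaust the bounded Borel functions. A truncation of \<open>f\<close> divided by the Gaussian
  is such an \<open>h\<close>, and the truncations converge to \<open>f\<close>.\<close>

theorem schwartz_dense:
  fixes f :: "'a::euclidean_space \<Rightarrow> complex"
  assumes f: "square_integrable f" and e: "\<epsilon> > 0"
  obtains p where "p \<in> schwartz" "norm2 (\<lambda>x. f x - p x) < \<epsilon>"
proof -
  have [measurable]: "(gauss_window :: 'a \<Rightarrow> complex) \<in> borel_measurable borel" by (rule schwartz_measurable[OF gauss_schwartz])
  have sg: "square_integrable (gauss_window :: 'a \<Rightarrow> complex)" by (rule schwartz_square_integrable[OF gauss_schwartz])
  have [measurable]: "f \<in> borel_measurable borel" using f by (rule square_integrableD)
  define P where "P h \<longleftrightarrow> h \<in> borel_measurable borel \<and> (\<exists>B. \<forall>x. norm (h x) \<le> B) \<and>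
     schwartz_limit (\<lambda>x. h x * gauss_window x)" for h :: "'a \<Rightarrow> complex"
  have PD: "h \<in> borel_measurable borel" "\<exists>B. \<forall>x. norm (h x) \<le> B" "schwartz_limit (\<lambda>x. h x * gauss_window x)"
    if "P h" for h using that unfolding P_def by blast+
  have lS: "schwartz_limit p" if "p \<in> schwartz" for p :: "'a \<Rightarrow> complex"
    unfolding schwartz_limit_def
    using schwartz_square_integrable[OF that] that by (auto intro!: bexI[of _ p] simp: norm2_def)
  interpret character_class P
  proof
    have "schwartz_limit (gauss_window :: 'a \<Rightarrow> complex)" by (rule lS[OF gauss_schwartz])
    thus "P (\<lambda>x. 1)" unfolding P_def by (auto intro!: exI[of _ 1])
    show "P (\<lambda>x. h x + k x)" if h: "P h" and k: "P k" for h k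
      unfolding P_def
    proof (intro conjI)
      show "(\<lambda>x. h x + k x) \<in> borel_measurable borel" using PD(1)[OF h] PD(1)[OF k] by measurable
      obtain B C where "\<forall>x. norm (h x) \<le> B" "\<forall>x. norm (k x) \<le> C" using PD(2)[OF h] PD(2)[OF k] by blast
      hence "\<forall>x. norm (h x + k x) \<le> B + C" by (meson add_mono norm_triangle_le)
      thus "\<exists>B. \<forall>x. norm (h x + k x) \<le> B" by blast
      show "schwartz_limit (\<lambda>x. (h x + k x) * gauss_window x)"
        using schwartz_limit_add[OF PD(3)[OF h] PD(3)[OF k]] by (simp add: distrib_right)
    qed
    show "P (\<lambda>x. c * h x)" if h: "P h" for h c
      unfolding P_def
    proof (intro conjI)
      show "(\<lambda>x. c * h x) \<in> borel_measurable borel" using PD(1)[OF h] by measurable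
      obtain B where B: "\<And>x. norm (h x) \<le> B" using PD(2)[OF h] by blast
      have "\<forall>x. norm (c * h x) \<le> norm c * B" by (auto simp: norm_mult intro!: mult_left_mono B)
      thus "\<exists>B. \<forall>x. norm (c * h x) \<le> B" by blast
      have "schwartz_limit (\<lambda>x. c * (h x * gauss_window x))"
        by (rule schwartz_limit_mult[OF PD(3)[OF h], of "\<lambda>_. c" "norm c"]) (auto intro: schwartz_cmult)
      thus "schwartz_limit (\<lambda>x. (c * h x) * gauss_window x)" by (simp add: mult.assoc)
    qed
    show "P (\<lambda>x. chr (x \<bullet> \<eta>) * h x)" if h: "P h" for h \<eta>
      unfolding P_def
    proof (intro conjI)
      show "(\<lambda>x. chr (x \<bullet> \<eta>) * h x) \<in> borel_measurable borel" using PD(1)[OF h] by measurable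
      show "\<exists>B. \<forall>x. norm (chr (x \<bullet> \<eta>) * h x) \<le> B" using PD(2)[OF h] by (simp add: norm_mult)
      have "schwartz_limit (\<lambda>x. chr (x \<bullet> \<eta>) * (h x * gauss_window x))"
        by (rule schwartz_limit_mult[OF PD(3)[OF h], of _ 1]) (auto intro: schwartz_chr_mult)
      thus "schwartz_limit (\<lambda>x. (chr (x \<bullet> \<eta>) * h x) * gauss_window x)" by (simp add: mult.assoc)
    qed
    show "\<exists>B. \<forall>x. norm (h x) \<le> B" if "P h" for h using PD(2)[OF that] .
    show "P h" if F: "\<And>n. P (F n)" and B: "\<And>n x. norm (F n x) \<le> B" and l: "\<And>x. (\<lambda>n. F n x) \<longlonglongrightarrow> h x" for F h B
      unfolding P_def
    proof (intro conjI)
      have [measurable]: "F n \<in> borel_measurable borel" for n by (rule PD(1)[OF F])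
      show hm [measurable]: "h \<in> borel_measurable borel"
        by (rule borel_measurable_LIMSEQ_metric[of F]) (use l in auto)
      have hB: "norm (h x) \<le> B" for x
        by (rule LIMSEQ_le_const2[OF tendsto_norm[OF l[of x]]]) (use B in auto)
      thus "\<exists>B. \<forall>x. norm (h x) \<le> B" by blast
      have "(\<lambda>n. norm2 (\<lambda>x. h x * gauss_window x - F n x * gauss_window x)) \<longlonglongrightarrow> 0"
      proof (rule norm2_dominated_convergence)
        show "integrable lborel (\<lambda>x::'a. (2 * B) ^ 2 * norm (gauss_window x) ^ 2)"
          using square_integrableD(2)[OF sg] by simp
        show "norm (h x * gauss_window x - F n x * gauss_window x) ^ 2 \<le> (2 * B) ^ 2 * norm (gauss_window x) ^ 2" for n x
        proof -
          have "norm (h x - F n x) \<le> 2 * B"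
            using norm_triangle_ineq4[of "h x" "F n x"] hB[of x] B[of n x] by simp
          hence "norm (h x - F n x) ^ 2 * norm (gauss_window x) ^ 2 \<le> (2 * B) ^ 2 * norm (gauss_window x) ^ 2"
            by (intro mult_right_mono power_mono) auto
          thus ?thesis by (simp only: left_diff_distrib[symmetric] norm_mult power_mult_distrib)
        qed
        show "(\<lambda>n. F n x * gauss_window x) \<longlonglongrightarrow> h x * gauss_window x" for x
          by (intro tendsto_intros l)
      qed measurable
      hence l2: "\<exists>n. norm2 (\<lambda>x. h x * gauss_window x - F n x * gauss_window x) < \<epsilon>" if "\<epsilon> > 0" for \<epsilon>
    using eventually_happens'[OF sequentially_bot order_tendstoD(2)[OF _ that]] by blast
      show "schwartz_limit (\<lambda>x. h x * gauss_window x)"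
      proof (rule schwartz_limit_closed)
        show "square_integrable (\<lambda>x. h x * gauss_window x)"
          by (rule square_integrable_mult_bounded[OF sg hm hB])
        fix \<epsilon> :: real assume "\<epsilon> > 0"
        from l2[OF this] obtain n where "norm2 (\<lambda>x. h x * gauss_window x - F n x * gauss_window x) < \<epsilon>" by blast
        thus "\<exists>g. schwartz_limit g \<and> norm2 (\<lambda>x. h x * gauss_window x - g x) < \<epsilon>"
          using PD(3)[OF F] by blast
      qed
    qed
  qed
  \<comment> \<open>Both the point and the value are truncated: on \<open>A n\<close> the quotient
    of \<open>f\<close> by the Gaussian is at most n exp(pi n^2).\<close>
  define A where "A n = {x. norm x \<le> real n \<and> norm (f x) \<le> real n}" for n
  have [measurable]: "A n \<in> sets borel" for n unfolding A_def by measurable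
  have fn: "schwartz_limit (\<lambda>x. indicator (A n) x * f x)" for n
  proof -
    let ?h = "\<lambda>x. indicator (A n) x * f x / gauss_window x"
    have "P ?h"
    proof (rule bounded_borel[of _ "real n * exp (pi * real n ^ 2)"])
      show "norm (?h x) \<le> real n * exp (pi * real n ^ 2)" for x
      proof (cases "x \<in> A n")
        case True
        hence x: "norm x \<le> real n" "norm (f x) \<le> real n" by (auto simp: A_def)
        have "norm (?h x) = norm (f x) * exp (pi * norm x ^ 2)"
          using True by (simp add: norm_divide gauss_window_simps exp_minus field_simps)
        also have "\<dots> \<le> real n * exp (pi * real n ^ 2)"
          using x by (intro mult_mono) (auto intro!: power_mono)
        finally show ?thesis .
      qed simp
    qed measurable
    from PD(3)[OF this] show ?thesis by (simp add: gauss_window_simps)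
  qed
  have "(\<lambda>n. norm2 (\<lambda>x. f x - indicator (A n) x * f x)) \<longlonglongrightarrow> 0"
  proof (rule norm2_dominated_convergence)
    show "integrable lborel (\<lambda>x. norm (f x) ^ 2)" using f by (rule square_integrableD)
    show "norm (f x - indicator (A n) x * f x) ^ 2 \<le> norm (f x) ^ 2" for n x
      by (cases "x \<in> A n") auto
    show "(\<lambda>n. indicator (A n) x * f x) \<longlonglongrightarrow> f x" for x
    proof (rule tendsto_eventually)
      obtain N :: nat where N: "max (norm x) (norm (f x)) \<le> real N" using real_arch_simple by blast
      have "x \<in> A n" if "n \<ge> N" for n
        using that N by (auto simp: A_def intro: order_trans)
      thus "eventually (\<lambda>n. indicator (A n) x * f x = f x) sequentially"
        unfolding eventually_sequentially by (auto intro!: exI[of _ N])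
    qed
  qed measurable
  hence l2: "\<exists>n. norm2 (\<lambda>x. f x - indicator (A n) x * f x) < \<epsilon>" if "\<epsilon> > 0" for \<epsilon>
    using eventually_happens'[OF sequentially_bot order_tendstoD(2)[OF _ that]] by blast
  have "schwartz_limit f"
  proof (rule schwartz_limit_closed[OF f])
    fix \<epsilon> :: real assume "\<epsilon> > 0"
    from l2[OF this] obtain n where "norm2 (\<lambda>x. f x - indicator (A n) x * f x) < \<epsilon>" by blast
    thus "\<exists>g. schwartz_limit g \<and> norm2 (\<lambda>x. f x - g x) < \<epsilon>" using fn by blast
  qed
  thus ?thesis using that e unfolding schwartz_limit_def by blast
qed

subsection \<open>The short-time Fourier transform\<close>

lemma stft_eq: "stft \<psi> f z = (LINT y|lborel. f y * cnj (\<psi> (y - fst z)) * chr (- (y \<bullet> snd z)))"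
  by (cases z) (simp only: stft_def split_conv fst_conv snd_conv chr_minus)

lemma schwartz_conj_shift:
  fixes \<psi> :: "'a::euclidean_space \<Rightarrow> complex"
  assumes "\<psi> \<in> schwartz" shows "(\<lambda>y. cnj (\<psi> (y - x))) \<in> schwartz"
  using schwartz_cnj[OF schwartz_translate[OF assms, of "- x"]] by simp

lemma integrable_stft:
  fixes f \<psi> :: "'a::euclidean_space \<Rightarrow> complex"
  assumes "square_integrable f" "\<psi> \<in> schwartz"
  shows "integrable lborel (\<lambda>y. f y * cnj (\<psi> (y - x)) * chr (- (y \<bullet> \<omega>)))"
  by (intro integrable_mult_chr square_integrable_mult assms schwartz_square_integrable schwartz_conj_shift) measurable

lemma norm_stft_le:
  fixes f \<psi> :: "'a::euclidean_space \<Rightarrow> complex"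
  assumes f: "square_integrable f" and \<psi>: "\<psi> \<in> schwartz"
  shows "norm (stft \<psi> f z) \<le> (norm2 f + norm2 \<psi>) / 2"
proof -
  let ?g = "\<lambda>y. chr (y \<bullet> - snd z) * cnj (\<psi> (y - fst z))"
  have g: "?g \<in> schwartz" by (intro schwartz_chr_mult schwartz_conj_shift \<psi>)
  have "norm2 ?g = norm2 \<psi>"
    using square_integrable_translate(2)[OF schwartz_square_integrable[OF \<psi>], of "- fst z"]
    by (simp add: norm2_def norm_mult)
  moreover have "stft \<psi> f z = (LINT y|lborel. f y * ?g y)"
    by (simp add: stft_eq mult_ac)
  ultimately show ?thesis
    using square_integrable_mult(2)[OF f schwartz_square_integrable[OF g]] by simp
qed

lemma stft_add:
  fixes f g \<psi> :: "'a::euclidean_space \<Rightarrow> complex"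
  assumes "square_integrable f" "square_integrable g" "\<psi> \<in> schwartz"
  shows "stft \<psi> (\<lambda>x. f x + g x) z = stft \<psi> f z + stft \<psi> g z"
  unfolding stft_eq
  using Bochner_Integration.integral_add[OF integrable_stft[OF assms(1,3), of "fst z" "snd z"] integrable_stft[OF assms(2,3), of "fst z" "snd z"]]
  by (simp add: distrib_right)

lemma stft_cmult: "stft \<psi> (\<lambda>x. c * f x) z = c * stft \<psi> f z"
  unfolding stft_eq by (simp add: mult.assoc)

text \<open>Differentiation under the integral, with \<open>f\<close> merely square integrable. The
  window is weighted with one power of the bracket more than the dimension: the factor
  \<open>y\<close> from the character uses up one power, and what remains is the square integrable
  function \<open>h\<close> to pair with \<open>f\<close>.\<close>

lemma stft_has_derivative:
  fixes f \<psi> :: "'a::euclidean_space \<Rightarrow> complex"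
  assumes f: "square_integrable f" and \<psi>: "\<psi> \<in> schwartz"
  shows "(stft \<psi> f has_derivative (\<lambda>v. LINT y|lborel.
     f y * ((- (\<Sum>c\<in>Basis. of_real (fst v \<bullet> c) * cnj (dird c \<psi> (y - fst z)))
       - 2 * pi * \<i> * of_real (y \<bullet> snd v) * cnj (\<psi> (y - fst z))) * chr (- (y \<bullet> snd z))))) (at z)"
    (is "(_ has_derivative (\<lambda>v. LINT y|lborel. ?F' y z v)) _")
proof -
  let ?F = "\<lambda>y z. f y * cnj (\<psi> (y - fst z)) * chr (- (y \<bullet> snd z))"
  let ?N = "DIM('a)"
  note [measurable] = square_integrableD(1)[OF f] schwartz_measurable[OF \<psi>]
  have dm [measurable]: "dird c \<psi> \<in> borel_measurable borel" if "c \<in> Basis" for c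
    using schwartz_measurable[OF schwartz_dird[OF \<psi> that]] .
  have "\<exists>C\<ge>0. \<forall>x. bracket x ^ (?N + 1) * norm (dird c \<psi> x) \<le> C" if "c \<in> Basis" for c
    using schwartzE[OF schwartz_dird[OF \<psi> that], of "?N + 1"] by metis
  then obtain C where C: "\<And>c. c \<in> Basis \<Longrightarrow> C c \<ge> 0"
    "\<And>c x. c \<in> Basis \<Longrightarrow> bracket x ^ (?N + 1) * norm (dird c \<psi> x) \<le> C c" by metis
  obtain C0 where C0: "C0 \<ge> 0" "\<And>x. bracket x ^ (?N + 1) * norm (\<psi> x) \<le> C0"
    using schwartzE[OF \<psi>] by metis
  have fst_le: "norm (fst v) \<le> norm v" and snd_le: "norm (snd v) \<le> norm v" for v :: "'a \<times> 'a"
    using norm_fst_le[of "fst v" "snd v"] norm_snd_le[of "snd v" "fst v"] by simp_all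
  define K where "K = C0 + (\<Sum>c\<in>Basis. C c)"
  have Kc: "C c \<le> K" if "c \<in> Basis" for c
    unfolding K_def using member_le_sum[OF that, of C] C(1) C0(1) by simp
  have K0: "C0 \<le> K" unfolding K_def using C(1) by (simp add: sum_nonneg)
  have Kn: "K \<ge> 0" using C0(1) K0 by simp
  \<comment> \<open>By Peetre's inequality, moving the weight from \<open>y - fst w\<close> to
    \<open>y\<close> costs at most \<open>L\<close> as long as \<open>w\<close> stays in the unit
    ball around \<open>z\<close>.\<close>
  define L where "L = (2 * (1 + (norm (fst z) + 1) ^ 2)) ^ (?N + 1)"
  define h where "h y = complex_of_real (1 / bracket y ^ ?N)" for y :: 'a
  have hm [measurable]: "h \<in> borel_measurable borel" unfolding h_def by measurable
  have hn: "norm (h y) = 1 / bracket y ^ ?N" for y unfolding h_def norm_of_real by simp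
  have hs: "square_integrable h"
  proof (rule square_integrable_bracket_bound[OF hm, of 1])
    show "bracket x ^ ?N * norm (h x) \<le> 1" for x
      using bracket_power_pos[of x ?N] unfolding hn by simp
  qed
  have shift: "norm (g (y - fst w)) \<le> K * L / bracket y ^ (?N + 1)"
    if w: "w \<in> ball z 1" and g: "\<And>x. bracket x ^ (?N + 1) * norm (g x) \<le> K" for y w and g :: "'a \<Rightarrow> complex"
  proof -
    have "norm (fst w) \<le> norm (fst z) + norm (fst w - fst z)" by (metis add.commute diff_add_cancel norm_triangle_ineq)
    also have "norm (fst w - fst z) \<le> 1"
      using w fst_le[of "w - z"] by (simp add: dist_norm norm_minus_commute)
    finally have n: "norm (fst w) ^ 2 \<le> (norm (fst z) + 1) ^ 2" by (intro power_mono) auto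
    have "1 + norm ((y - fst w) + fst w) ^ 2 \<le> 2 * bracket (y - fst w) * bracket (fst w)"
      by (rule bracket_add_le)
    also have "\<dots> \<le> 2 * bracket (y - fst w) * (1 + (norm (fst z) + 1) ^ 2)"
      using n by (intro mult_left_mono) auto
    finally have "bracket y ^ (?N + 1) \<le> (2 * bracket (y - fst w) * (1 + (norm (fst z) + 1) ^ 2)) ^ (?N + 1)"
      by (intro power_mono) auto
    also have "\<dots> = L * bracket (y - fst w) ^ (?N + 1)"
      unfolding L_def by (simp only: power_mult_distrib mult_ac)
    finally have "bracket y ^ (?N + 1) * norm (g (y - fst w)) \<le> L * bracket (y - fst w) ^ (?N + 1) * norm (g (y - fst w))"
      by (rule mult_right_mono) simp
    also have "\<dots> \<le> L * K" unfolding mult.assoc by (intro mult_left_mono g) (simp add: L_def)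
    finally show ?thesis using bracket_power_pos[of y "?N + 1"] by (simp add: pos_le_divide_eq mult_ac)
  qed
  have bnd: "norm (?F' y w v) \<le> ((real ?N + 2 * pi) * K * L * norm (f y * h y)) * norm v"
    if w: "w \<in> ball z 1" for y w v
  proof -
    let ?b = "1 + norm y ^ 2"
    define A where "A = K * L / ?b ^ (?N + 1)"
    have A0: "A \<ge> 0" using Kn by (simp add: A_def L_def)
    have "norm (\<Sum>c\<in>Basis. complex_of_real (fst v \<bullet> c) * cnj (dird c \<psi> (y - fst w))) \<le> real ?N * A * norm (fst v)"
    proof (rule norm_dird_sum_le)
      fix c :: 'a assume c: "c \<in> Basis"
      show "norm (cnj (dird c \<psi> (y - fst w))) \<le> A"
        using shift[OF w order_trans[OF C(2)[OF c] Kc[OF c]], of y] unfolding complex_mod_cnj A_def .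
    qed
    also have "\<dots> \<le> real ?N * A * norm v" using fst_le[of v] A0 by (intro mult_left_mono) auto
    also have "\<dots> = real ?N * A * norm v * 1" by simp
    also have "\<dots> \<le> real ?N * A * norm v * ?b"
      using A0 by (intro mult_left_mono mult_nonneg_nonneg) auto
    finally have 1: "norm (\<Sum>c\<in>Basis. complex_of_real (fst v \<bullet> c) * cnj (dird c \<psi> (y - fst w))) \<le> real ?N * A * norm v * ?b" .
    have 2: "norm (2 * pi * \<i> * of_real (y \<bullet> snd v) * cnj (\<psi> (y - fst w))) \<le> 2 * pi * A * norm v * ?b"
    proof -
      have "norm y \<le> ?b" using zero_le_power2[of "norm y - 1/2"] by (simp add: power2_eq_square algebra_simps)
      hence "\<bar>y \<bullet> snd v\<bar> \<le> ?b * norm v"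
        using Cauchy_Schwarz_ineq2[of y "snd v"] snd_le[of v]
        by (meson mult_mono norm_ge_zero order_trans)
      moreover have "norm (\<psi> (y - fst w)) \<le> A" using shift[OF w order_trans[OF C0(2) K0], of y] unfolding A_def .
      ultimately have "\<bar>y \<bullet> snd v\<bar> * norm (\<psi> (y - fst w)) \<le> (?b * norm v) * A"
        by (intro mult_mono) (auto intro: add_nonneg_nonneg mult_nonneg_nonneg)
      hence "2 * pi * (\<bar>y \<bullet> snd v\<bar> * norm (\<psi> (y - fst w))) \<le> 2 * pi * ((?b * norm v) * A)"
        by (intro mult_left_mono) auto
      thus ?thesis by (simp add: norm_mult mult_ac)
    qed
    have "norm (?F' y w v) \<le> norm (f y) * (real ?N * A * norm v * ?b + 2 * pi * A * norm v * ?b)"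
      unfolding norm_mult norm_chr mult_1_right
      by (intro mult_left_mono order_trans[OF norm_triangle_ineq4] add_mono) (use 1 2 in \<open>auto simp: norm_mult\<close>)
    also have "\<dots> = ((real ?N + 2 * pi) * K * L * norm (f y * h y)) * norm v"
    proof -
      have "A * ?b = K * L * norm (h y)"
        using bracket_pos[of y] by (simp add: hn A_def)
      hence "norm (f y) * ((real ?N + 2 * pi) * norm v * (A * ?b)) = norm (f y) * ((real ?N + 2 * pi) * norm v * (K * L * norm (h y)))" by simp
      thus ?thesis by (simp only: norm_mult) (simp only: distrib_left distrib_right mult_ac)
    qed
    finally show ?thesis .
  qed
  have "((\<lambda>z. LINT y|lborel. ?F y z) has_derivative (\<lambda>v. LINT y|lborel. ?F' y z v)) (at z)"
  proof (rule has_derivative_lborel_integral[where g = "\<lambda>y. (real ?N + 2 * pi) * K * L * norm (f y * h y)"])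
    show "integrable lborel (\<lambda>y. (real ?N + 2 * pi) * K * L * norm (f y * h y))"
      using square_integrable_mult(1)[OF f hs] by (intro integrable_mult_right integrable_norm)
    show "integrable lborel (\<lambda>y. ?F y w)" for w by (rule integrable_stft[OF f \<psi>])
    show "(\<lambda>y. ?F' y z v) \<in> borel_measurable lborel" for v by measurable
    show "norm (?F' y w v) \<le> ((real ?N + 2 * pi) * K * L * norm (f y * h y)) * norm v" if "w \<in> ball z 1" for y w v
      by (rule bnd[OF that])
    show "(?F y has_derivative ?F' y w) (at w)" if "w \<in> ball z 1" for y w
    proof -
      have 1: "((\<lambda>z. y - fst z) has_derivative (\<lambda>v. - fst v)) (at w)"
        by (auto intro!: derivative_eq_intros)
      have 2: "((\<lambda>z. - (y \<bullet> snd z)) has_derivative (\<lambda>v. - (y \<bullet> snd v))) (at w)"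
        by (auto intro!: derivative_eq_intros)
      note d1 = bounded_linear.has_derivative[OF bounded_linear_cnj has_derivative_compose[OF 1 schwartz_has_derivative[OF \<psi>]]]
      note d2 = has_derivative_compose[OF 2 chr_has_derivative]
      from has_derivative_mult[OF has_derivative_mult_right[OF d1, of "f y"] d2]
      show ?thesis
        by (rule has_derivative_eq_rhs) (auto simp: fun_eq_iff sum_negf algebra_simps sum_distrib_left)
    qed
  qed
  thus ?thesis by (simp only: stft_eq[abs_def])
qed

text \<open>\<open>f\<close> never gets differentiated: all derivatives fall on the window or on the
  character. The induction therefore runs over all Schwartz windows, and polynomial factors are
  absorbed by the hypothesis \<open>RP\<close>.\<close>

lemma regular_stft:
  fixes f :: "'i \<Rightarrow> 'a::euclidean_space \<Rightarrow> complex"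
  assumes f: "\<And>i. square_integrable (f i)" and R: "additive_growth R"
    and RP: "\<And>F G. poly_growth F \<Longrightarrow> R G \<Longrightarrow> R (\<lambda>i x. F i x * G i x)"
    and Rs: "\<And>\<psi>. \<psi> \<in> schwartz \<Longrightarrow> R (\<lambda>i. stft \<psi> (f i))"
    and \<psi>: "\<psi> \<in> schwartz"
  shows "regular R n (\<lambda>i. stft \<psi> (f i))"
  using \<psi>
proof (induction n arbitrary: \<psi>)
  case 0 thus ?case using Rs by simp
next
  case (Suc n)
  note \<psi> = Suc.prems
  let ?D = "\<lambda>i z v. LINT y|lborel.
     f i y * ((- (\<Sum>c\<in>Basis. of_real (fst v \<bullet> c) * cnj (dird c \<psi> (y - fst z)))
       - 2 * pi * \<i> * of_real (y \<bullet> snd v) * cnj (\<psi> (y - fst z))) * chr (- (y \<bullet> snd z)))"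
  show ?case
  proof (rule regular_SucI)
    show "R (\<lambda>i. stft \<psi> (f i))" by (rule Rs[OF \<psi>])
    show "(stft \<psi> (f i) has_derivative ?D i z) (at z)" for i z by (rule stft_has_derivative[OF f \<psi>])
    fix b :: "'a \<times> 'a" assume "b \<in> Basis"
    then consider c where "c \<in> Basis" "b = (c, 0)" | c where "c \<in> Basis" "b = (0, c)"
      by (auto simp: Basis_prod_def)
    thus "regular R n (\<lambda>i z. ?D i z b)"
    proof cases
      case 1
      have "?D i z b = -1 * stft (dird c \<psi>) (f i) z" for i z
      proof -
        have "(\<Sum>d\<in>Basis. complex_of_real (c \<bullet> d) * cnj (dird d \<psi> (y - fst z))) = cnj (dird c \<psi> (y - fst z))" for y
          using 1(1) by (simp add: inner_Basis if_distrib[of of_real] if_distrib[of "\<lambda>x. x * _"] cong: if_cong)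
        thus ?thesis by (simp add: 1(2) stft_eq mult.assoc)
      qed
      thus ?thesis using regular_cmult[OF R Suc.IH[OF schwartz_dird[OF \<psi> 1(1)]], of "-1"] by simp
    next
      case 2
      \<comment> \<open>The frequency derivative produces y . c = (y - x) . c + x . c. The first
        part goes into the window, the second comes out of the integral as a polynomial.\<close>
      let ?\<psi> = "\<lambda>t. of_real (t \<bullet> c) * \<psi> t"
      have \<psi>': "?\<psi> \<in> schwartz" by (rule schwartz_linear_mult[OF \<psi> bounded_linear_inner_left])
      have "?D i z b = (- 2 * pi * \<i>) * (stft ?\<psi> (f i) z + of_real (fst z \<bullet> c) * stft \<psi> (f i) z)" for i z
      proof -
        have "stft ?\<psi> (f i) z + of_real (fst z \<bullet> c) * stft \<psi> (f i) z =
          (LINT y|lborel. f i y * cnj (?\<psi> (y - fst z)) * chr (- (y \<bullet> snd z)) + of_real (fst z \<bullet> c) * (f i y * cnj (\<psi> (y - fst z)) * chr (- (y \<bullet> snd z))))"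
          unfolding stft_eq
          by (subst Bochner_Integration.integral_add)
             (simp_all add: integrable_stft[OF f \<psi>'] integrable_stft[OF f \<psi>] del: complex_cnj_mult)
        also have "\<dots> = (LINT y|lborel. f i y * (of_real (y \<bullet> c) * cnj (\<psi> (y - fst z))) * chr (- (y \<bullet> snd z)))"
          by (rule Bochner_Integration.integral_cong) (simp_all add: inner_diff_left algebra_simps)
        finally have e: "stft ?\<psi> (f i) z + of_real (fst z \<bullet> c) * stft \<psi> (f i) z = \<dots>" .
        show ?thesis unfolding e 2(2)
          by (subst integral_mult_right_zero[symmetric], rule Bochner_Integration.integral_cong) (simp_all add: mult_ac)
      qed
      moreover have "regular R n (\<lambda>i z. (- 2 * pi * \<i>) * (stft ?\<psi> (f i) z + of_real (fst z \<bullet> c) * stft \<psi> (f i) z))"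
      proof (intro regular_cmult regular_add R Suc.IH \<psi>')
        have "bounded_linear (\<lambda>z::'a\<times>'a. fst z \<bullet> c)"
          using bounded_linear_compose[OF bounded_linear_inner_left bounded_linear_fst] .
        from smooth_linear[OF this] have "regular poly_growth n (\<lambda>(i::'i) z::'a\<times>'a. complex_of_real (fst z \<bullet> c))"
          unfolding smooth_def by blast
        from regular_mult[OF R RP this Suc.IH[OF \<psi>]]
        show "regular R n (\<lambda>i z. of_real (fst z \<bullet> c) * stft \<psi> (f i) z)" .
      qed
      ultimately show ?thesis by simp
    qed
  qed
qed

lemma smooth_stft_poly:
  fixes f :: "'i \<Rightarrow> 'a::euclidean_space \<Rightarrow> complex"
  assumes "\<And>i. square_integrable (f i)" "\<And>\<psi>. \<psi> \<in> schwartz \<Longrightarrow> poly_growth (\<lambda>i. stft \<psi> (f i))" "\<psi> \<in> schwartz"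
  shows "smooth poly_growth (\<lambda>i. stft \<psi> (f i))"
  unfolding smooth_def by (intro allI regular_stft additive_growth_poly poly_growth_mult assms)

subsection \<open>Decay of Fourier transforms of Schwartz functions\<close>

lemma integral_dird_schwartz:
  fixes g :: "'a::euclidean_space \<Rightarrow> complex"
  assumes g: "g \<in> schwartz" and b: "b \<in> Basis"
  shows "(LINT x|lborel. dird b g x) = 0"
proof -
  let ?N = "DIM('a)"
  let ?u' = "\<lambda>x v. \<Sum>c\<in>Basis. of_real (v \<bullet> c) * dird c g x"
  have "\<exists>C\<ge>0. \<forall>x. bracket x ^ ?N * norm (dird c g x) \<le> C" if "c \<in> Basis" for c
    using schwartzE[OF schwartz_dird[OF g that], of ?N] by metis
  then obtain C where C: "\<And>c. c \<in> Basis \<Longrightarrow> C c \<ge> 0"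
    "\<And>c x. c \<in> Basis \<Longrightarrow> bracket x ^ ?N * norm (dird c g x) \<le> C c" by metis
  define K where "K = (\<Sum>c\<in>Basis. C c)"
  have Kc: "C c \<le> K" if "c \<in> Basis" for c unfolding K_def using member_le_sum[OF that, of C] C(1) by simp
  have "(LINT x|lborel. ?u' x b) = 0"
  proof (rule integral_derivative_eq_0)
    show "(g has_derivative ?u' x) (at x)" for x by (rule schwartz_has_derivative[OF g])
    show "integrable lborel g" by (rule schwartz_integrable[OF g])
    show "bracket x ^ ?N * norm (?u' x v) \<le> (real ?N * K) * norm v" for x v
    proof -
      have "norm (?u' x v) \<le> real ?N * (K / bracket x ^ ?N) * norm v"
      proof (rule norm_dird_sum_le)
        fix c :: 'a assume c: "c \<in> Basis"
        show "norm (dird c g x) \<le> K / bracket x ^ ?N"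
          using order_trans[OF C(2)[OF c] Kc[OF c], of x] bracket_power_pos[of x ?N] by (simp add: pos_le_divide_eq mult.commute)
      qed
      thus ?thesis using bracket_power_pos[of x ?N] by (simp add: field_simps)
    qed
    have "dird c g \<in> borel_measurable borel" if "c \<in> Basis" for c
      using schwartz_measurable[OF schwartz_dird[OF g that]] .
    thus "(\<lambda>y. ?u' y v) \<in> borel_measurable lborel" for v by measurable
  qed
  moreover have "?u' x b = dird b g x" for x
    using b by (simp add: inner_Basis if_distrib[of of_real] if_distrib[of "\<lambda>x. x * _"] cong: if_cong)
  ultimately show ?thesis by simp
qed

lemma dird_chr_mult:
  fixes g :: "'a::euclidean_space \<Rightarrow> complex"
  assumes "\<And>x. g differentiable (at x)"
  shows "dird b (\<lambda>x. chr (x \<bullet> \<omega>) * g x) = (\<lambda>x. chr (x \<bullet> \<omega>) * dird b g x + 2 * pi * \<i> * of_real (b \<bullet> \<omega>) * (chr (x \<bullet> \<omega>) * g x))"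
proof -
  have 1: "(g has_derivative (\<lambda>v. frechet_derivative g (at x) v)) (at x)" for x
    using assms frechet_derivative_works by blast
  have 2: "((\<lambda>x. x \<bullet> \<omega>) has_derivative (\<lambda>v. v \<bullet> \<omega>)) (at x)" for x
    by (auto intro!: derivative_eq_intros)
  from dird_eq[OF has_derivative_mult[OF has_derivative_compose[OF 2 chr_has_derivative] 1]]
  show ?thesis by (simp add: dird_def mult_ac)
qed

lemma fourier_dird:
  fixes g :: "'a::euclidean_space \<Rightarrow> complex"
  assumes g: "g \<in> schwartz" and b: "b \<in> Basis"
  shows "fourier (dird b g) \<omega> = 2 * pi * \<i> * of_real (b \<bullet> \<omega>) * fourier g \<omega>"
proof -
  let ?u = "\<lambda>x. chr (x \<bullet> - \<omega>) * g x"
  have i1: "integrable lborel (\<lambda>x. chr (x \<bullet> - \<omega>) * dird b g x)"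
    by (intro schwartz_integrable schwartz_chr_mult schwartz_dird g b)
  have i2: "integrable lborel (\<lambda>x. 2 * pi * \<i> * of_real (b \<bullet> - \<omega>) * (chr (x \<bullet> - \<omega>) * g x))"
    by (intro integrable_mult_right schwartz_integrable schwartz_chr_mult g)
  have "0 = (LINT x|lborel. dird b ?u x)"
    by (rule integral_dird_schwartz[symmetric]) (intro schwartz_chr_mult g b)+
  also have "\<dots> = (LINT x|lborel. chr (x \<bullet> - \<omega>) * dird b g x) + 2 * pi * \<i> * of_real (b \<bullet> - \<omega>) * (LINT x|lborel. chr (x \<bullet> - \<omega>) * g x)"
    unfolding dird_chr_mult[OF schwartz_differentiable[OF g]] Bochner_Integration.integral_add[OF i1 i2]
    by (simp only: integral_mult_right_zero)
  finally show ?thesis by (simp add: fourier_def mult.commute[of "chr _"])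
qed

lemma fourier_smooth_bounded:
  fixes G :: "'i \<Rightarrow> 'a::euclidean_space \<Rightarrow> complex"
  assumes "smooth rapid G"
  shows "\<exists>C. \<forall>i \<omega>. norm (fourier (G i) \<omega>) \<le> C"
proof -
  obtain C where C: "\<And>i x. bracket x ^ DIM('a) * norm (G i x) \<le> C"
    using rapid_inE[OF smoothD(1)[OF assms], of "DIM('a)"] by metis
  have "norm (fourier (G i) \<omega>) \<le> C * (LINT x|lborel. 1 / bracket (x::'a) ^ DIM('a))" for i \<omega>
    unfolding fourier_def
  proof (rule integral_bracket_bound)
    show "(\<lambda>x. G i x * chr (- (x \<bullet> \<omega>))) \<in> borel_measurable borel"
      using schwartz_measurable[OF smooth_imp_schwartz[OF assms, of i]] by measurable
    show "bracket x ^ DIM('a) * norm (G i x * chr (- (x \<bullet> \<omega>))) \<le> C" for x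
      using C by (simp add: norm_mult)
  qed
  thus ?thesis by blast
qed

text \<open>Subtracting a multiple of the Laplacian multiplies the Fourier transform by exactly
  \<open>bracket \<omega>\<close> and keeps the family bounded in the Schwartz space, so each step
  of the induction gains one power.\<close>

lemma fourier_rapid:
  fixes G :: "'i \<Rightarrow> 'a::euclidean_space \<Rightarrow> complex"
  assumes "smooth rapid G"
  shows "rapid (\<lambda>i. fourier (G i))"
proof -
  have "\<exists>C. \<forall>i \<omega>. bracket \<omega> ^ N * norm (fourier (G i) \<omega>) \<le> C" for N
    using assms
  proof (induction N arbitrary: G)
    case 0 thus ?case using fourier_smooth_bounded[OF 0] by simp
  next
    case (Suc N G)
    \<comment> \<open>Inverse of (2 pi i)^2, so that the Laplacian contributes exactly
      |omega|^2.\<close>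
    let ?c = "- 1 / (4 * complex_of_real pi ^ 2)"
    let ?G = "\<lambda>i x. G i x + ?c * (\<Sum>b\<in>Basis. dird b (dird b (G i)) x)"
    have G: "G i \<in> schwartz" for i by (rule smooth_imp_schwartz[OF Suc.prems])
    have "smooth rapid ?G"
      by (intro smooth_add smooth_cmult smooth_sum additive_growth_rapid_in finite_Basis smoothD(3) Suc.prems)
    from Suc.IH[OF this] obtain C where C: "\<And>i \<omega>. bracket \<omega> ^ N * norm (fourier (?G i) \<omega>) \<le> C" by blast
    have e: "fourier (?G i) \<omega> = of_real (bracket \<omega>) * fourier (G i) \<omega>" for i \<omega>
    proof -
      have i0: "integrable lborel (\<lambda>x. G i x * chr (- (x \<bullet> \<omega>)))"
        by (intro integrable_mult_chr schwartz_integrable G) measurable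
      have ib: "integrable lborel (\<lambda>x. dird b (dird b (G i)) x * chr (- (x \<bullet> \<omega>)))" if "b \<in> Basis" for b
        by (intro integrable_mult_chr schwartz_integrable schwartz_dird G that) measurable
      have "fourier (?G i) \<omega> = (LINT x|lborel. G i x * chr (- (x \<bullet> \<omega>)) + ?c * (\<Sum>b\<in>Basis. dird b (dird b (G i)) x * chr (- (x \<bullet> \<omega>))))"
        unfolding fourier_def by (simp only: distrib_right mult.assoc sum_distrib_right)
      also have "\<dots> = (LINT x|lborel. G i x * chr (- (x \<bullet> \<omega>))) + (LINT x|lborel. ?c * (\<Sum>b\<in>Basis. dird b (dird b (G i)) x * chr (- (x \<bullet> \<omega>))))"
        by (intro Bochner_Integration.integral_add i0 integrable_mult_right Bochner_Integration.integrable_sum ib)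
      also have "(LINT x|lborel. ?c * (\<Sum>b\<in>Basis. dird b (dird b (G i)) x * chr (- (x \<bullet> \<omega>)))) = ?c * (\<Sum>b\<in>Basis. fourier (dird b (dird b (G i))) \<omega>)"
        by (simp only: integral_mult_right_zero fourier_def Bochner_Integration.integral_sum[OF ib])
      also have "(\<Sum>b\<in>Basis. fourier (dird b (dird b (G i))) \<omega>) = (\<Sum>b\<in>Basis. (2 * pi * \<i>) ^ 2 * of_real ((\<omega> \<bullet> b) * (\<omega> \<bullet> b)) * fourier (G i) \<omega>)"
      proof (rule sum.cong[OF refl])
        fix b :: 'a assume b: "b \<in> Basis"
        show "fourier (dird b (dird b (G i))) \<omega> = (2 * pi * \<i>) ^ 2 * of_real ((\<omega> \<bullet> b) * (\<omega> \<bullet> b)) * fourier (G i) \<omega>"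
          by (simp add: fourier_dird[OF schwartz_dird[OF G b] b] fourier_dird[OF G b] power2_eq_square inner_commute[of b])
      qed
      also have "\<dots> = (2 * pi * \<i>) ^ 2 * of_real (norm \<omega> ^ 2) * fourier (G i) \<omega>"
        by (subst power2_norm_eq_inner, subst euclidean_inner) (simp only: of_real_sum sum_distrib_left sum_distrib_right)
      also have "?c * \<dots> = of_real (norm \<omega> ^ 2) * fourier (G i) \<omega>"
        by (simp add: power_mult_distrib)
      finally show ?thesis by (simp add: fourier_def distrib_right)
    qed
    have "bracket \<omega> ^ Suc N * norm (fourier (G i) \<omega>) \<le> C" for i \<omega>
    proof -
      have "norm (complex_of_real (bracket \<omega>)) = 1 + norm \<omega> ^ 2"
        by (simp only: norm_of_real) simp
      thus ?thesis using C[of \<omega> i] unfolding e norm_mult by (simp add: mult_ac)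
    qed
    thus ?case by blast
  qed
  thus ?thesis unfolding rapid_in_def by blast
qed

lemma bracket_shift_diff_le:
  fixes x t :: "'a::real_normed_vector"
  shows "1 + norm x ^ 2 \<le> 2 * bracket t * bracket (t - x)"
  using bracket_add_le[of t "x - t"] by (simp add: norm_minus_commute)

text \<open>The weight is taken at the translation parameter. By Peetre's inequality the decay of
  \<open>\<psi>\<close> pays for it up to a power of \<open>t\<close>, so the growth is uniform over
  all translates.\<close>

lemma smooth_weighted_translates:
  fixes \<psi> :: "'a::euclidean_space \<Rightarrow> complex"
  assumes "\<psi> \<in> schwartz"
  shows "smooth poly_growth (\<lambda>j t. of_real (bracket (snd j) ^ M) * \<psi> (t - snd (j :: 'i \<times> 'a)))"
  unfolding smooth_def
proof
  let ?W = "\<lambda>\<psi> (j :: 'i \<times> 'a) t. of_real (bracket (snd j) ^ M) * \<psi> (t - snd j)"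
  have base: "poly_growth (?W \<psi>)" if S: "\<psi> \<in> schwartz" for \<psi>
  proof -
    obtain C where C: "C \<ge> 0" "\<And>x. bracket x ^ M * norm (\<psi> x) \<le> C" using schwartzE[OF S] by metis
    have "norm (?W \<psi> j t) \<le> (2 ^ M * C) * bracket t ^ M" for j t
    proof -
      have "bracket (snd j) ^ M \<le> (2 * bracket t * bracket (t - snd j)) ^ M"
        by (intro power_mono bracket_shift_diff_le) simp
      hence "bracket (snd j) ^ M * norm (\<psi> (t - snd j)) \<le> (2 * bracket t * bracket (t - snd j)) ^ M * norm (\<psi> (t - snd j))"
        by (rule mult_right_mono) simp
      also have "\<dots> = 2 ^ M * bracket t ^ M * (bracket (t - snd j) ^ M * norm (\<psi> (t - snd j)))"
        by (simp only: power_mult_distrib mult_ac)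
      also have "\<dots> \<le> 2 ^ M * bracket t ^ M * C" by (intro mult_left_mono C) simp
      finally show ?thesis by (simp add: norm_mult norm_power mult_ac del: of_real_add of_real_power of_real_1)
    qed
    thus ?thesis unfolding poly_growth_def by blast
  qed
  fix n show "regular poly_growth n (?W \<psi>)" using assms
  proof (induction n arbitrary: \<psi>)
    case 0 thus ?case using base by simp
  next
    case (Suc n)
    show ?case
    proof (rule regular_SucI)
      show "poly_growth (?W \<psi>)" by (rule base[OF Suc.prems])
      show "(?W \<psi> j has_derivative (\<lambda>v. of_real (bracket (snd j) ^ M) * frechet_derivative \<psi> (at (t - snd j)) v)) (at t)" for j t
      proof -
        have "((\<lambda>t. t - snd j) has_derivative (\<lambda>v. v)) (at t)" by (auto intro!: derivative_eq_intros)
        moreover have "(\<psi> has_derivative frechet_derivative \<psi> (at (t - snd j))) (at (t - snd j))"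
          using schwartz_differentiable[OF Suc.prems] frechet_derivative_works by blast
        ultimately show ?thesis by (intro has_derivative_mult_right) (rule has_derivative_compose)
      qed
      show "regular poly_growth n (\<lambda>(j :: 'i \<times> 'a) t. of_real (bracket (snd j) ^ M) * frechet_derivative \<psi> (at (t - snd j)) b)" if "b \<in> Basis" for b
        using Suc.IH[OF schwartz_dird[OF Suc.prems that]] by (simp add: dird_def)
    qed
  qed
qed

text \<open>At a fixed position the transform is the Fourier transform of \<open>F\<close> times a
  translated window. Including the position weight in that window keeps the family bounded, so the
  decay in frequency given by \<open>fourier_rapid\<close> holds uniformly against the position
  weight, which is joint decay.\<close>

lemma stft_rapid:
  fixes F :: "'i \<Rightarrow> 'a::euclidean_space \<Rightarrow> complex"
  assumes F: "smooth rapid F" and \<psi>: "\<psi> \<in> schwartz"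
  shows "rapid (\<lambda>i. stft \<psi> (F i))"
  unfolding rapid_in_def
proof
  fix M
  let ?G = "\<lambda>j t. (of_real (bracket (snd j) ^ M) * cnj (\<psi> (t - snd j))) * F (fst j) t"
  have "smooth rapid ?G"
    by (intro smooth_rapid_mult smooth_weighted_translates[OF schwartz_cnj[OF \<psi>]] smooth_rapid_reindex[OF F])
  from fourier_rapid[OF this] obtain C where C: "\<And>j \<omega>. bracket \<omega> ^ M * norm (fourier (?G j) \<omega>) \<le> C"
    unfolding rapid_in_def by meson
  have "bracket z ^ M * norm (stft \<psi> (F i) z) \<le> C" for i z
  proof -
    let ?x = "fst z" and ?\<omega> = "snd z"
    have "fourier (?G (i, ?x)) ?\<omega> = of_real (bracket ?x ^ M) * stft \<psi> (F i) z"
      unfolding fourier_def stft_eq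
      by (subst integral_mult_right_zero[symmetric], rule Bochner_Integration.integral_cong) (simp_all add: mult_ac)
    hence e: "norm (fourier (?G (i, ?x)) ?\<omega>) = bracket ?x ^ M * norm (stft \<psi> (F i) z)"
      by (simp only: norm_mult norm_of_real) simp
    have "1 + norm z ^ 2 \<le> bracket ?\<omega> * bracket ?x"
      by (cases z) (simp add: norm_Pair algebra_simps)
    hence "bracket z ^ M \<le> (bracket ?\<omega> * bracket ?x) ^ M" by (intro power_mono) auto
    hence "bracket z ^ M * norm (stft \<psi> (F i) z) \<le> (bracket ?\<omega> * bracket ?x) ^ M * norm (stft \<psi> (F i) z)"
      by (rule mult_right_mono) simp
    also have "\<dots> = bracket ?\<omega> ^ M * norm (fourier (?G (i, ?x)) ?\<omega>)"
      unfolding e by (simp add: power_mult_distrib)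
    also have "\<dots> \<le> C" by (rule C)
    finally show ?thesis .
  qed
  thus "\<exists>C. \<forall>i z. bracket z ^ M * norm (stft \<psi> (F i) z) \<le> C" by blast
qed

lemma smooth_stft_rapid:
  fixes F :: "'i \<Rightarrow> 'a::euclidean_space \<Rightarrow> complex"
  assumes F: "smooth rapid F" and \<psi>: "\<psi> \<in> schwartz"
  shows "smooth rapid (\<lambda>i. stft \<psi> (F i))"
  unfolding smooth_def
  by (intro allI regular_stft schwartz_square_integrable smooth_imp_schwartz[OF F] additive_growth_rapid_in rapid_poly_mult stft_rapid F \<psi>)

lemma stft_schwartz:
  fixes f \<psi> :: "'a::euclidean_space \<Rightarrow> complex"
  assumes "f \<in> schwartz" "\<psi> \<in> schwartz"
  shows "stft \<psi> f \<in> schwartz"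
  using smooth_imp_schwartz[OF smooth_stft_rapid[OF schwartz_imp_smooth[OF assms(1)] assms(2)]] .

text \<open>Covariance under time-frequency shifts, by translating the integration variable. The
  phase depends on the frequency but not on the function, so it disappears in norms and cancels in
  sesquilinear products.\<close>

lemma stft_shift:
  fixes f \<psi> :: "'a::euclidean_space \<Rightarrow> complex"
  assumes f: "f \<in> borel_measurable borel" and \<psi>: "\<psi> \<in> schwartz"
  shows "stft \<psi> f (x + p, \<omega> + q) = chr (- (p \<bullet> (\<omega> + q))) * stft \<psi> (\<lambda>y. f (y + p) * chr (- (y \<bullet> q))) (x, \<omega>)"
proof -
  note [measurable] = f schwartz_measurable[OF \<psi>]
  have "stft \<psi> f (x + p, \<omega> + q) = (LINT y|lborel. f y * cnj (\<psi> (y - (x + p))) * chr (- (y \<bullet> (\<omega> + q))))"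
    by (simp add: stft_eq)
  also have "\<dots> = (LINT y|lborel. f (y + p) * cnj (\<psi> (y + p - (x + p))) * chr (- ((y + p) \<bullet> (\<omega> + q))))"
    by (rule lborel_integral_translate[symmetric]) measurable
  also have "\<dots> = (LINT y|lborel. chr (- (p \<bullet> (\<omega> + q))) * (f (y + p) * chr (- (y \<bullet> q)) * cnj (\<psi> (y - x)) * chr (- (y \<bullet> \<omega>))))"
    by (rule Bochner_Integration.integral_cong[OF refl])
       (simp add: inner_add_left inner_add_right chr_add[symmetric] mult_ac, simp add: algebra_simps)
  finally show ?thesis by (simp add: stft_eq)
qed

subsection \<open>Tempered distributions and integrals\<close>

lemma iter_dd_schwartz: "f \<in> schwartz \<Longrightarrow> set vs \<subseteq> Basis \<Longrightarrow> iter_dd vs f \<in> schwartz"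
  using smooth_iter_dd[of rapid "\<lambda>_::unit. f"] unfolding schwartz_iff_smooth by blast

lemma schwartz_zero: "(\<lambda>x. 0) \<in> schwartz"
  using schwartz_cmult[OF gauss_schwartz, of 0] by simp

lemma schwartz_sum: "finite S \<Longrightarrow> (\<And>j. j \<in> S \<Longrightarrow> F j \<in> schwartz) \<Longrightarrow> (\<lambda>x. \<Sum>j\<in>S. F j x) \<in> schwartz"
  by (induction S rule: finite_induct) (auto intro: schwartz_zero schwartz_add)

lemma iter_dd_add:
  assumes "f \<in> schwartz" "g \<in> schwartz" "set vs \<subseteq> Basis"
  shows "iter_dd vs (\<lambda>x. f x + g x) = (\<lambda>x. iter_dd vs f x + iter_dd vs g x)"
  using assms(3)
proof (induction vs)
  case (Cons v vs)
  have 1: "(iter_dd vs f has_derivative frechet_derivative (iter_dd vs f) (at x)) (at x)"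
    "(iter_dd vs g has_derivative frechet_derivative (iter_dd vs g) (at x)) (at x)" for x
    using schwartzD(1)[OF assms(1), of vs] schwartzD(1)[OF assms(2), of vs] Cons.prems
    by (auto simp: frechet_derivative_works)
  show ?case using dird_eq[OF has_derivative_add[OF 1]] Cons unfolding iter_dd_Cons by (simp add: dird_def)
qed simp

lemma iter_dd_cmult:
  assumes "f \<in> schwartz" "set vs \<subseteq> Basis"
  shows "iter_dd vs (\<lambda>x. c * f x) = (\<lambda>x. c * iter_dd vs f x)"
  using assms(2)
proof (induction vs)
  case (Cons v vs)
  have 1: "(iter_dd vs f has_derivative frechet_derivative (iter_dd vs f) (at x)) (at x)" for x
    using schwartzD(1)[OF assms(1), of vs] Cons.prems by (auto simp: frechet_derivative_works)
  show ?case using dird_eq[OF has_derivative_mult_right[OF 1]] Cons unfolding iter_dd_Cons by (simp add: dird_def)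
qed simp

lemma iter_dd_sum:
  assumes "finite S" "\<And>j. j \<in> S \<Longrightarrow> F j \<in> schwartz" "set vs \<subseteq> Basis"
  shows "iter_dd vs (\<lambda>x. \<Sum>j\<in>S. F j x) = (\<lambda>x. \<Sum>j\<in>S. iter_dd vs (F j) x)"
  using assms(1,2)
proof (induction S rule: finite_induct)
  case empty
  show ?case using iter_dd_cmult[OF gauss_schwartz assms(3), of 0] by simp
next
  case (insert j S)
  thus ?case using iter_dd_add[OF _ schwartz_sum[of S F] assms(3), of "F j"] by simp
qed

lemma schwartz_seminorm_le:
  assumes "\<And>vs x. set vs \<subseteq> Basis \<Longrightarrow> length vs \<le> N \<Longrightarrow> bracket x ^ N * norm (iter_dd vs f x) \<le> K"
  shows "schwartz_seminorm N f \<le> K"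
  unfolding schwartz_seminorm_def
  by (intro cSUP_least) (use assms in \<open>auto intro!: exI[of _ "[]"]\<close>)

lemma tempered_add: "tempered_distribution u \<Longrightarrow> f \<in> schwartz \<Longrightarrow> g \<in> schwartz \<Longrightarrow> u (\<lambda>x. f x + g x) = u f + u g"
  unfolding tempered_distribution_def by blast

lemma tempered_cmult: "tempered_distribution u \<Longrightarrow> f \<in> schwartz \<Longrightarrow> u (\<lambda>x. c * f x) = c * u f"
  unfolding tempered_distribution_def by blast

lemma tempered_sum:
  assumes u: "tempered_distribution u" and "finite S" "\<And>j. j \<in> S \<Longrightarrow> F j \<in> schwartz"
  shows "u (\<lambda>x. \<Sum>j\<in>S. F j x) = (\<Sum>j\<in>S. u (F j))"
  using assms(2,3)
proof (induction S rule: finite_induct)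
  case empty
  show ?case using tempered_cmult[OF u gauss_schwartz, of 0] by simp
next
  case (insert j S)
  thus ?case using tempered_add[OF u _ schwartz_sum[of S F], of "F j"] by simp
qed

text \<open>Suprema in the reals are meaningful only for bounded sets, so continuity is restated
  with a common bound \<open>K\<close> of all the entries. Since the seminorm is then nonnegative,
  \<open>C\<close> may be replaced by its absolute value.\<close>

lemma tempered_bound:
  assumes "tempered_distribution u"
  shows "\<exists>C N. C \<ge> 0 \<and> (\<forall>f\<in>schwartz. \<forall>K.
       (\<forall>vs x. set vs \<subseteq> Basis \<longrightarrow> length vs \<le> N \<longrightarrow> bracket x ^ N * norm (iter_dd vs f x) \<le> K)
       \<longrightarrow> norm (u f) \<le> C * K)"
proof -
  obtain C N where C: "\<And>f. f \<in> schwartz \<Longrightarrow> norm (u f) \<le> C * schwartz_seminorm N f"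
    using assms unfolding tempered_distribution_def by blast
  show ?thesis
  proof (intro exI conjI ballI allI impI)
    show "0 \<le> \<bar>C\<bar>" by simp
    fix f :: "'a \<Rightarrow> complex" and K
    assume f: "f \<in> schwartz" and K': "\<forall>vs x. set vs \<subseteq> Basis \<longrightarrow> length vs \<le> N \<longrightarrow> bracket x ^ N * norm (iter_dd vs f x) \<le> K"
    have K: "bracket x ^ N * norm (iter_dd vs f x) \<le> K" if "set vs \<subseteq> Basis" "length vs \<le> N" for vs x
      using K' that by blast
    have "0 \<le> schwartz_seminorm N f"
    proof -
      let ?V = "{vs. set vs \<subseteq> (Basis::'a set) \<and> length vs \<le> N}"
      let ?s = "\<lambda>vs. SUP x. bracket x ^ N * norm (iter_dd vs f x)"
      have "0 \<le> bracket (0::'a) ^ N * norm (iter_dd [] f 0)" by simp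
      also have "\<dots> \<le> ?s []"
        by (rule cSUP_upper) (use K[of "[]"] in \<open>auto intro!: bdd_aboveI[of _ K]\<close>)
      also have "\<dots> \<le> (SUP vs\<in>?V. ?s vs)"
      proof (rule cSUP_upper)
        show "bdd_above (?s ` ?V)" by (rule bdd_aboveI[of _ K]) (use K in \<open>auto intro!: cSUP_least\<close>)
      qed simp
      finally show ?thesis unfolding schwartz_seminorm_def .
    qed
    hence "C * schwartz_seminorm N f \<le> \<bar>C\<bar> * schwartz_seminorm N f" by (intro mult_right_mono) auto
    also have "\<dots> \<le> \<bar>C\<bar> * K" by (intro mult_left_mono schwartz_seminorm_le K) auto
    finally show "norm (u f) \<le> \<bar>C\<bar> * K" using C[OF f] by simp
  qed
qed


section \<open>Slices and marginals of Schwartz functions on a product space\<close>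

lemma Pair_Basis: "c \<in> Basis \<Longrightarrow> (0, c) \<in> Basis" "b \<in> Basis \<Longrightarrow> (b, 0) \<in> Basis"
  by (auto simp: Basis_prod_def)

lemma sum_Basis_prod_snd:
  "(\<Sum>c\<in>Basis. of_real ((0, v) \<bullet> c) * G c) = (\<Sum>c\<in>Basis. of_real (v \<bullet> c) * (G (0, c) :: complex))"
  unfolding Basis_prod_def
  by (subst sum.union_disjoint) (auto simp: sum.reindex inj_on_def o_def)

lemma sum_Basis_prod_fst:
  "(\<Sum>c\<in>Basis. of_real ((v, 0) \<bullet> c) * G c) = (\<Sum>c\<in>Basis. of_real (v \<bullet> c) * (G (c, 0) :: complex))"
  unfolding Basis_prod_def
  by (subst sum.union_disjoint) (auto simp: sum.reindex inj_on_def o_def)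

lemma slice_has_derivative:
  fixes h :: "'y::euclidean_space \<times> 'a::euclidean_space \<Rightarrow> complex"
  assumes h: "h \<in> schwartz"
  shows "((\<lambda>t. h (y, t)) has_derivative (\<lambda>v. \<Sum>c\<in>Basis. of_real (v \<bullet> c) * dird (0, c) h (y, t))) (at t)"
    and "((\<lambda>y. h (y, t)) has_derivative (\<lambda>v. \<Sum>c\<in>Basis. of_real (v \<bullet> c) * dird (c, 0) h (y, t))) (at y)"
proof -
  have "((\<lambda>t. (y, t)) has_derivative (\<lambda>v. (0, v))) (at t)" "((\<lambda>y. (y, t)) has_derivative (\<lambda>v. (v, 0))) (at y)"
    by (auto intro!: derivative_eq_intros)
  from this[THEN has_derivative_compose, OF schwartz_has_derivative[OF h]]
  show "((\<lambda>t. h (y, t)) has_derivative (\<lambda>v. \<Sum>c\<in>Basis. of_real (v \<bullet> c) * dird (0, c) h (y, t))) (at t)"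
    "((\<lambda>y. h (y, t)) has_derivative (\<lambda>v. \<Sum>c\<in>Basis. of_real (v \<bullet> c) * dird (c, 0) h (y, t))) (at y)"
    unfolding sum_Basis_prod_snd sum_Basis_prod_fst .
qed

lemma sum_inner_Basis:
  "b \<in> Basis \<Longrightarrow> (\<Sum>c\<in>Basis. of_real (b \<bullet> c) * G c) = (G b :: complex)"
  by (simp add: inner_Basis if_distrib[of of_real] if_distrib[of "\<lambda>x. x * _"] cong: if_cong)

lemma smooth_slices:
  fixes h :: "'y::euclidean_space \<times> 'a::euclidean_space \<Rightarrow> complex"
  assumes "h \<in> schwartz"
  shows "smooth rapid (\<lambda>y t. h (y, t))"
  unfolding smooth_def
proof
  have base: "rapid (\<lambda>y t. h (y, t))" if h: "h \<in> schwartz" for h :: "'y \<times> 'a \<Rightarrow> complex"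
    unfolding rapid_in_def
  proof
    fix N
    obtain C where C: "\<And>x. bracket x ^ N * norm (h x) \<le> C" using schwartzE[OF h] by metis
    have "bracket t ^ N * norm (h (y, t)) \<le> C" for y t
    proof -
      have "bracket t ^ N \<le> bracket (y, t) ^ N"
        by (intro power_mono add_left_mono norm_snd_le) auto
      hence "bracket t ^ N * norm (h (y, t)) \<le> bracket (y, t) ^ N * norm (h (y, t))"
        by (rule mult_right_mono) simp
      thus ?thesis using C[of "(y, t)"] by simp
    qed
    thus "\<exists>C. \<forall>y t. bracket t ^ N * norm (h (y, t)) \<le> C" by blast
  qed
  fix n show "regular rapid n (\<lambda>y t. h (y, t))" using assms
  proof (induction n arbitrary: h)
    case 0 thus ?case using base by simp
  next
    case (Suc n)
    show ?case
    proof (rule regular_SucI)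
      show "rapid (\<lambda>y t. h (y, t))" by (rule base[OF Suc.prems])
      show "((\<lambda>t. h (y, t)) has_derivative (\<lambda>v. \<Sum>c\<in>Basis. of_real (v \<bullet> c) * dird (0, c) h (y, t))) (at t)" for y t
        by (rule slice_has_derivative[OF Suc.prems])
      fix b :: 'a assume b: "b \<in> Basis"
      show "regular rapid n (\<lambda>y t. \<Sum>c\<in>Basis. of_real (b \<bullet> c) * dird (0, c) h (y, t))"
        unfolding sum_inner_Basis[OF b] by (rule Suc.IH[OF schwartz_dird[OF Suc.prems Pair_Basis(1)[OF b]]])
    qed
  qed
qed

lemma schwartz_slice:
  fixes h :: "'y::euclidean_space \<times> 'a::euclidean_space \<Rightarrow> complex"
  shows "h \<in> schwartz \<Longrightarrow> (\<lambda>t. h (y, t)) \<in> schwartz"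
  using smooth_imp_schwartz[OF smooth_slices] by blast

lemma iter_dd_slice:
  fixes h :: "'y::euclidean_space \<times> 'a::euclidean_space \<Rightarrow> complex"
  assumes "h \<in> schwartz" "set vs \<subseteq> Basis"
  shows "iter_dd (map (Pair 0) vs) h \<in> schwartz"
    and "iter_dd vs (\<lambda>t. h (y, t)) = (\<lambda>t. iter_dd (map (Pair 0) vs) h (y, t))"
proof -
  have S: "iter_dd (map (Pair 0) vs) h \<in> schwartz" if "set vs \<subseteq> Basis" for vs
    by (rule iter_dd_schwartz[OF assms(1)]) (use that Pair_Basis in auto)
  show "iter_dd (map (Pair 0) vs) h \<in> schwartz" by (rule S[OF assms(2)])
  show "iter_dd vs (\<lambda>t. h (y, t)) = (\<lambda>t. iter_dd (map (Pair 0) vs) h (y, t))"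
    using assms(2)
  proof (induction vs)
    case (Cons v vs)
    hence v: "v \<in> Basis" and vs: "set vs \<subseteq> Basis" by auto
    show ?case
      unfolding iter_dd_Cons list.map Cons.IH[OF vs] dird_eq[OF slice_has_derivative(1)[OF S[OF vs]]] sum_inner_Basis[OF v] ..
  qed simp
qed

text \<open>Splits the joint decay: \<open>DIM('y)\<close> powers make slices integrable in
  \<open>y\<close>, uniformly in \<open>t\<close>, and \<open>N\<close> powers remain for the
  seminorm in \<open>t\<close>.\<close>

lemma slice_bound:
  fixes h :: "'y::euclidean_space \<times> 'a::euclidean_space \<Rightarrow> complex"
  assumes "h \<in> schwartz"
  obtains C where "C \<ge> 0" "\<And>y t. bracket y ^ DIM('y) * (bracket t ^ N * norm (h (y, t))) \<le> C"
proof -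
  obtain C where C: "C \<ge> 0" "\<And>x. bracket x ^ (DIM('y) + N) * norm (h x) \<le> C" using schwartzE[OF assms] by metis
  have "bracket y ^ DIM('y) * (bracket t ^ N * norm (h (y, t))) \<le> C" for y t
  proof -
    have "bracket y ^ DIM('y) * bracket t ^ N \<le> bracket (y, t) ^ DIM('y) * bracket (y, t) ^ N"
      by (intro mult_mono power_mono add_left_mono norm_snd_le norm_fst_le) auto
    hence "bracket y ^ DIM('y) * bracket t ^ N * norm (h (y, t)) \<le> bracket (y, t) ^ (DIM('y) + N) * norm (h (y, t))"
      unfolding power_add by (rule mult_right_mono) simp
    thus ?thesis using C(2)[of "(y, t)"] by (simp add: mult.assoc)
  qed
  thus ?thesis using that C(1) by blast
qed

lemma slice_integrable:
  fixes h :: "'y::euclidean_space \<times> 'a::euclidean_space \<Rightarrow> complex"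
  assumes "h \<in> schwartz"
  shows "(\<lambda>y. h (y, t)) \<in> borel_measurable borel" "integrable lborel (\<lambda>y. h (y, t))"
proof -
  have "continuous_on UNIV (\<lambda>y. h (y, t))"
    by (rule continuous_on_compose2[OF schwartz_continuous[OF assms]]) (auto intro!: continuous_intros)
  thus m: "(\<lambda>y. h (y, t)) \<in> borel_measurable borel" by (rule borel_measurable_continuous_onI)
  obtain C where "\<And>y t. bracket y ^ DIM('y) * (bracket t ^ 0 * norm (h (y, t))) \<le> C"
    using slice_bound[OF assms, of 0] by metis
  thus "integrable lborel (\<lambda>y. h (y, t))"
    by (intro integrable_bracket_bound[OF m, of C]) simp
qed

lemma marginal_has_derivative:
  fixes h :: "'y::euclidean_space \<times> 'a::euclidean_space \<Rightarrow> complex"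
  assumes h: "h \<in> schwartz"
  shows "((\<lambda>t. LINT y|lborel. h (y, t)) has_derivative
     (\<lambda>v. LINT y|lborel. (\<Sum>c\<in>Basis. of_real (v \<bullet> c) * dird (0, c) h (y, t)))) (at t)"
proof -
  have "\<exists>C\<ge>0. \<forall>y t. bracket y ^ DIM('y) * (bracket t ^ 0 * norm (dird (0, c) h (y, t))) \<le> C"
    if "c \<in> Basis" for c :: 'a
    using slice_bound[OF schwartz_dird[OF h Pair_Basis(1)[OF that]], of 0] by metis
  then obtain C where C: "\<And>c. c \<in> Basis \<Longrightarrow> C c \<ge> 0"
    "\<And>c y t. c \<in> Basis \<Longrightarrow> bracket y ^ DIM('y) * norm (dird (0, c) h (y, t)) \<le> C c"
    by (simp, metis)
  define K where "K = (\<Sum>c\<in>Basis. C c)"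
  have Kc: "C c \<le> K" if "c \<in> Basis" for c unfolding K_def using member_le_sum[OF that, of C] C(1) by simp
  show ?thesis
  proof (rule has_derivative_lborel_integral[where g = "\<lambda>y. real DIM('a) * K * (1 / bracket y ^ DIM('y))"])
    show "integrable lborel (\<lambda>y::'y. real DIM('a) * K * (1 / bracket y ^ DIM('y)))"
      by (rule integrable_mult_right[OF integrable_inverse_bracket])
    show "((\<lambda>t. h (y, t)) has_derivative (\<lambda>v. \<Sum>c\<in>Basis. of_real (v \<bullet> c) * dird (0, c) h (y, t))) (at t)" for y t
      by (rule slice_has_derivative[OF h])
    show "norm (\<Sum>c\<in>Basis. of_real (v \<bullet> c) * dird (0, c) h (y, t)) \<le> real DIM('a) * K * (1 / bracket y ^ DIM('y)) * norm v" for y t v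
      unfolding mult.assoc[of _ K]
    proof (rule norm_dird_sum_le)
      fix c :: 'a assume c: "c \<in> Basis"
      show "norm (dird (0, c) h (y, t)) \<le> K * (1 / bracket y ^ DIM('y))"
        using order_trans[OF C(2)[OF c] Kc[OF c], of y t] bracket_power_pos[of y "DIM('y)"] by (simp add: pos_le_divide_eq mult.commute)
    qed
    show "integrable lborel (\<lambda>y. h (y, t))" for t by (rule slice_integrable[OF h])
    have "(\<lambda>y. dird (0, c) h (y, t)) \<in> borel_measurable borel" if "c \<in> Basis" for c :: 'a
      by (rule slice_integrable[OF schwartz_dird[OF h Pair_Basis(1)[OF that]]])
    thus "(\<lambda>y. \<Sum>c\<in>Basis. of_real (v \<bullet> c) * dird (0, c) h (y, t)) \<in> borel_measurable lborel" for v by measurable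
  qed
qed

lemma schwartz_marginal:
  fixes h :: "'y::euclidean_space \<times> 'a::euclidean_space \<Rightarrow> complex"
  assumes "h \<in> schwartz"
  shows "(\<lambda>t. LINT y|lborel. h (y, t)) \<in> schwartz"
proof -
  let ?J = "LINT y|(lborel::'y measure). 1 / bracket y ^ DIM('y)"
  have base: "rapid (\<lambda>_::unit. \<lambda>t. LINT y|lborel. h (y, t))" if h: "h \<in> schwartz" for h :: "'y \<times> 'a \<Rightarrow> complex"
    unfolding rapid_in_def
  proof
    fix N
    obtain C where C: "\<And>y t. bracket y ^ DIM('y) * (bracket t ^ N * norm (h (y, t))) \<le> C"
      using slice_bound[OF h, of N] by metis
    have "bracket t ^ N * norm (LINT y|lborel. h (y, t)) \<le> C * ?J" for t
    proof -
      let ?w = "complex_of_real (bracket t ^ N)"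
      have w: "norm ?w = bracket t ^ N" unfolding norm_of_real by simp
      have "norm (LINT y|lborel. ?w * h (y, t)) \<le> C * ?J"
      proof (rule integral_bracket_bound)
        show "(\<lambda>y. ?w * h (y, t)) \<in> borel_measurable borel" using slice_integrable(1)[OF h] by measurable
        show "bracket y ^ DIM('y) * norm (?w * h (y, t)) \<le> C" for y unfolding norm_mult w by (rule C)
      qed
      thus ?thesis unfolding integral_mult_right_zero norm_mult w .
    qed
    thus "\<exists>C. \<forall>(i::unit) t. bracket t ^ N * norm (LINT y|lborel. h (y, t)) \<le> C" by blast
  qed
  have "regular rapid n (\<lambda>_::unit. \<lambda>t. LINT y|lborel. h (y, t))" for n
    using assms
  proof (induction n arbitrary: h)
    case 0 thus ?case using base by simp
  next
    case (Suc n)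
    show ?case
    proof (rule regular_SucI)
      show "rapid (\<lambda>_::unit. \<lambda>t. LINT y|lborel. h (y, t))" by (rule base[OF Suc.prems])
      show "((\<lambda>t. LINT y|lborel. h (y, t)) has_derivative
         (\<lambda>v. LINT y|lborel. (\<Sum>c\<in>Basis. of_real (v \<bullet> c) * dird (0, c) h (y, t)))) (at t)" for t
        by (rule marginal_has_derivative[OF Suc.prems])
      fix b :: 'a assume b: "b \<in> Basis"
      show "regular rapid n (\<lambda>_::unit. \<lambda>t. LINT y|lborel. (\<Sum>c\<in>Basis. of_real (b \<bullet> c) * dird (0, c) h (y, t)))"
        unfolding sum_inner_Basis[OF b] by (rule Suc.IH[OF schwartz_dird[OF Suc.prems Pair_Basis(1)[OF b]]])
    qed
  qed
  thus ?thesis unfolding schwartz_iff_smooth smooth_def by blast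
qed

lemma iter_dd_marginal:
  fixes h :: "'y::euclidean_space \<times> 'a::euclidean_space \<Rightarrow> complex"
  assumes "h \<in> schwartz" "set vs \<subseteq> Basis"
  shows "iter_dd vs (\<lambda>t. LINT y|lborel. h (y, t)) = (\<lambda>t. LINT y|lborel. iter_dd (map (Pair 0) vs) h (y, t))"
  using assms(2)
proof (induction vs)
  case (Cons v vs)
  hence v: "v \<in> Basis" and vs: "set vs \<subseteq> Basis" by auto
  show ?case
    unfolding iter_dd_Cons list.map Cons.IH[OF vs] dird_eq[OF marginal_has_derivative[OF iter_dd_slice(1)[OF assms(1) vs]]] sum_inner_Basis[OF v] ..
qed simp

section \<open>Riemann sums and the exchange of a distribution with an integral\<close>

lemma riemann_sum_error:
  fixes k :: "'y::euclidean_space \<Rightarrow> 'b::euclidean_space"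
  assumes p: "p tagged_division_of cbox a b" and fine: "\<And>x K. (x, K) \<in> p \<Longrightarrow> K \<subseteq> ball x \<delta>"
    and k: "continuous_on (cbox a b) k" and \<eta>: "\<eta> \<ge> 0"
    and e: "\<And>x y. x \<in> cbox a b \<Longrightarrow> y \<in> cbox a b \<Longrightarrow> dist x y < \<delta> \<Longrightarrow> norm (k y - k x) \<le> \<eta>"
  shows "norm (integral (cbox a b) k - (\<Sum>(x, K)\<in>p. measure lborel K *\<^sub>R k x)) \<le> \<eta> * measure lborel (cbox a b)"
proof -
  have ik: "k integrable_on cbox a b" by (rule integrable_continuous[OF k])
  have "integral (cbox a b) k - (\<Sum>(x, K)\<in>p. measure lborel K *\<^sub>R k x) = (\<Sum>(x, K)\<in>p. integral K k - measure lborel K *\<^sub>R k x)"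
    unfolding integral_combine_tagged_division_topdown[OF ik p] by (simp add: sum_subtractf case_prod_unfold)
  also have "norm \<dots> \<le> (\<Sum>(x, K)\<in>p. \<eta> * measure lborel K)"
  proof (rule sum_norm_le)
    fix q assume q: "q \<in> p"
    obtain x K where xK: "q = (x, K)" by (cases q)
    have K: "x \<in> K" "K \<subseteq> cbox a b" "\<exists>c d. K = cbox c d" using tagged_division_ofD[OF p] q xK by auto
    then obtain c d where cd: "K = cbox c d" by blast
    have iK: "k integrable_on cbox c d" using integrable_on_subcbox[OF ik] K(2) cd by simp
    have "((\<lambda>y. k y - k x) has_integral integral K k - measure lborel K *\<^sub>R k x) (cbox c d)"
      unfolding cd by (intro has_integral_diff integrable_integral iK has_integral_const)
    hence "norm (integral K k - measure lborel K *\<^sub>R k x) \<le> \<eta> * measure lborel (cbox c d)"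
    proof (rule has_integral_bound[OF \<eta>])
      fix y assume y: "y \<in> cbox c d"
      hence "y \<in> ball x \<delta>" using fine q xK cd by blast
      thus "norm (k y - k x) \<le> \<eta>" using e[of x y] K y cd by auto
    qed
    thus "norm (case q of (x, K) \<Rightarrow> integral K k - measure lborel K *\<^sub>R k x) \<le> (case q of (x, K) \<Rightarrow> \<eta> * measure lborel K)"
      by (simp add: xK cd)
  qed
  also have "\<dots> = \<eta> * measure lborel (cbox a b)"
    using additive_content_tagged_division[OF p] by (simp add: sum_distrib_left[symmetric] case_prod_unfold)
  finally show ?thesis .
qed

text \<open>Equicontinuity in \<open>y\<close>, uniform in \<open>t\<close> even under the weight;
  this lets a single mesh size control a whole seminorm of the Riemann sum error.\<close>

lemma slice_Lipschitz:
  fixes g :: "'y::euclidean_space \<times> 'a::euclidean_space \<Rightarrow> complex"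
  assumes g: "g \<in> schwartz"
  shows "\<exists>L\<ge>0. \<forall>y y' t. bracket t ^ N * norm (g (y, t) - g (y', t)) \<le> L * norm (y - y')"
proof -
  have "\<exists>C\<ge>0. \<forall>y t. bracket y ^ DIM('y) * (bracket t ^ N * norm (dird (c, 0) g (y, t))) \<le> C"
    if "c \<in> Basis" for c :: 'y
    using slice_bound[OF schwartz_dird[OF g Pair_Basis(2)[OF that]], of N] by metis
  then obtain C where C: "\<And>c. c \<in> Basis \<Longrightarrow> C c \<ge> 0"
    "\<And>c y t. c \<in> Basis \<Longrightarrow> bracket y ^ DIM('y) * (bracket t ^ N * norm (dird (c, 0) g (y, t))) \<le> C c"
    by metis
  define K where "K = (\<Sum>c\<in>Basis. C c)"
  have K0: "K \<ge> 0" unfolding K_def by (intro sum_nonneg C)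
  have Kc: "C c \<le> K" if "c \<in> Basis" for c unfolding K_def using member_le_sum[OF that, of C] C(1) by simp
  have d: "norm (dird (c, 0) g (y, t)) \<le> K / bracket t ^ N" if c: "c \<in> Basis" for c :: 'y and y t
  proof -
    have "1 * (bracket t ^ N * norm (dird (c, 0) g (y, t))) \<le> bracket y ^ DIM('y) * (bracket t ^ N * norm (dird (c, 0) g (y, t)))"
      by (intro mult_right_mono one_le_power one_le_bracket mult_nonneg_nonneg) auto
    hence "bracket t ^ N * norm (dird (c, 0) g (y, t)) \<le> K" using C(2)[OF c, of y t] Kc[OF c] by simp
    thus ?thesis using bracket_power_pos[of t N] by (simp add: pos_le_divide_eq mult.commute)
  qed
  have "bracket t ^ N * norm (g (y, t) - g (y', t)) \<le> (real DIM('y) * K) * norm (y - y')" for y y' t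
  proof -
    have "norm (g (y, t) - g (y', t)) \<le> (real DIM('y) * (K / bracket t ^ N)) * norm (y - y')"
    proof (rule differentiable_bound[of UNIV "\<lambda>y. g (y, t)"])
      show "((\<lambda>y. g (y, t)) has_derivative (\<lambda>v. \<Sum>c\<in>Basis. of_real (v \<bullet> c) * dird (c, 0) g (x, t))) (at x within UNIV)" for x
        by (rule slice_has_derivative[OF g])
      show "onorm (\<lambda>v. \<Sum>c\<in>Basis. of_real (v \<bullet> c) * dird (c, 0) g (x, t)) \<le> real DIM('y) * (K / bracket t ^ N)" for x
        by (rule onorm_le) (rule norm_dird_sum_le[OF d])
    qed auto
    thus ?thesis using bracket_power_pos[of t N] by (simp add: field_simps)
  qed
  thus ?thesis using K0 by (intro exI[of _ "real DIM('y) * K"]) auto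
qed

lemma cbox_exhaust_tail:
  fixes w :: "'y::euclidean_space \<Rightarrow> real"
  assumes w: "integrable lborel w" and e: "e > 0"
  shows "\<exists>a b. (LINT y|lborel. indicator (- cbox a b) y * w y) < e"
proof -
  have [measurable]: "w \<in> borel_measurable borel" using w by simp
  let ?B = "\<lambda>n::nat. cbox (- (real n *\<^sub>R One)) (real n *\<^sub>R One) :: 'y set"
  have "(\<lambda>n. LINT y|lborel. indicator (- ?B n) y * w y) \<longlonglongrightarrow> (LINT y|(lborel::'y measure). 0)"
  proof (rule integral_dominated_convergence[where w = "\<lambda>y. norm (w y)"])
    show "integrable lborel (\<lambda>y. norm (w y))" using w by simp
    show "AE y in lborel. (\<lambda>n. indicator (- ?B n) y * w y) \<longlonglongrightarrow> 0"
    proof (rule AE_I2, rule tendsto_eventually)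
      fix y :: 'y
      obtain m :: nat where m: "norm y \<le> real m" using real_arch_simple by blast
      have "indicator (- ?B n) y * w y = 0" if n: "n \<ge> m" for n
      proof -
        have "- real n \<le> y \<bullet> i \<and> y \<bullet> i \<le> real n" if "i \<in> Basis" for i
          using Basis_le_norm[OF that, of y] m n by linarith
        hence "y \<in> ?B n" by (simp add: mem_box)
        thus ?thesis by simp
      qed
      thus "eventually (\<lambda>n. indicator (- ?B n) y * w y = 0) sequentially"
        unfolding eventually_sequentially by blast
    qed
    show "AE y in lborel. norm (indicator (- ?B n) y * w y) \<le> norm (w y)" for n
      by (intro AE_I2) (auto simp: indicator_def)
  qed measurable
  hence "(\<lambda>n. LINT y|lborel. indicator (- ?B n) y * w y) \<longlonglongrightarrow> 0" by simp
  from eventually_happens'[OF sequentially_bot order_tendstoD(2)[OF this e]]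
  show ?thesis by blast
qed

text \<open>A tempered distribution is moved under the integral sign by Riemann sums that converge in
  the Schwartz seminorms.\<close>

theorem tempered_integral_bound:
  fixes h :: "'y::euclidean_space \<times> 'a::euclidean_space \<Rightarrow> complex"
  assumes u: "tempered_distribution u" and h: "h \<in> schwartz"
    and b: "integrable lborel b" "continuous_on UNIV b"
    and ub: "\<And>y. norm (u (\<lambda>t. h (y, t))) \<le> b y"
  shows "norm (u (\<lambda>t. LINT y|lborel. h (y, t))) \<le> (LINT y|lborel. b y)"
proof -
  obtain Cu N where Cu0: "Cu \<ge> 0" and Cu': "\<forall>f\<in>schwartz. \<forall>K.
       (\<forall>vs x. set vs \<subseteq> Basis \<longrightarrow> length vs \<le> N \<longrightarrow> bracket x ^ N * norm (iter_dd vs f x) \<le> K)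
       \<longrightarrow> norm (u f) \<le> Cu * K"
    using tempered_bound[OF u] by blast
  define G where "G = (\<lambda>t. LINT y|lborel. h (y, t))"
  have G: "G \<in> schwartz" unfolding G_def by (rule schwartz_marginal[OF h])
  let ?V = "{vs. set vs \<subseteq> (Basis::'a set) \<and> length vs \<le> N}"
  have fV: "finite ?V" by (rule finite_lists_length_le[OF finite_Basis])
  define hv where "hv vs = iter_dd (map (Pair 0) vs) h" for vs :: "'a list"
  have hv: "hv vs \<in> schwartz" if "set vs \<subseteq> Basis" for vs unfolding hv_def by (rule iter_dd_slice[OF h that])
  \<comment> \<open>The weighted derivative slices: their suprema over \<open>t\<close> and
    \<open>vs\<close> are what the continuity bound of \<open>u\<close> sees, so all estimates below
    are uniform in \<open>t\<close> and \<open>vs\<close>.\<close>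
  define k where "k vs t y = complex_of_real (bracket t ^ N) * hv vs (y, t)" for vs t y
  have nw: "norm (complex_of_real (bracket t ^ N)) = bracket t ^ N" for t :: 'a
    unfolding norm_of_real by simp
  obtain Cb where Cb: "Cb \<ge> 0" "\<And>vs y t. vs \<in> ?V \<Longrightarrow> bracket y ^ DIM('y) * norm (k vs t y) \<le> Cb"
  proof -
    have "\<forall>vs\<in>?V. \<exists>C. 0 \<le> C \<and> (\<forall>y t. bracket y ^ DIM('y) * (bracket t ^ N * norm (hv vs (y, t))) \<le> C)"
    proof
      fix vs assume "vs \<in> ?V"
      hence "hv vs \<in> schwartz" using hv by simp
      from slice_bound[OF this, of N]
      show "\<exists>C. 0 \<le> C \<and> (\<forall>y t. bracket y ^ DIM('y) * (bracket t ^ N * norm (hv vs (y, t))) \<le> C)"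
        by metis
    qed
    from bchoice[OF this] obtain C where C': "\<forall>vs\<in>?V. 0 \<le> C vs \<and> (\<forall>y t. bracket y ^ DIM('y) * (bracket t ^ N * norm (hv vs (y, t))) \<le> C vs)" ..
    have C: "C vs \<ge> 0" "bracket y ^ DIM('y) * (bracket t ^ N * norm (hv vs (y, t))) \<le> C vs"
      if "vs \<in> ?V" for vs y t using bspec[OF C' that] by blast+
    show ?thesis
    proof (rule that[of "\<Sum>vs\<in>?V. C vs"])
      show "(\<Sum>vs\<in>?V. C vs) \<ge> 0" by (intro sum_nonneg C)
      fix vs and y :: 'y and t :: 'a assume v: "vs \<in> ?V"
      have "C vs \<le> (\<Sum>vs\<in>?V. C vs)" by (rule member_le_sum[OF v _ fV]) (use C(1) in auto)
      thus "bracket y ^ DIM('y) * norm (k vs t y) \<le> (\<Sum>vs\<in>?V. C vs)"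
        unfolding k_def norm_mult nw using C(2)[OF v, of y t] by linarith
    qed
  qed
  obtain L where L: "L \<ge> 0" "\<And>vs y y' t. vs \<in> ?V \<Longrightarrow> norm (k vs t y - k vs t y') \<le> L * norm (y - y')"
  proof -
    have "\<forall>vs\<in>?V. \<exists>C. 0 \<le> C \<and> (\<forall>y y' t. bracket t ^ N * norm (hv vs (y, t) - hv vs (y', t)) \<le> C * norm (y - y'))"
    proof
      fix vs assume "vs \<in> ?V"
      hence "hv vs \<in> schwartz" using hv by simp
      from slice_Lipschitz[OF this, of N]
      show "\<exists>C. 0 \<le> C \<and> (\<forall>y y' t. bracket t ^ N * norm (hv vs (y, t) - hv vs (y', t)) \<le> C * norm (y - y'))" .
    qed
    from bchoice[OF this] obtain C where C': "\<forall>vs\<in>?V. 0 \<le> C vs \<and> (\<forall>y y' t. bracket t ^ N * norm (hv vs (y, t) - hv vs (y', t)) \<le> C vs * norm (y - y'))" ..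
    have C: "C vs \<ge> 0" "bracket t ^ N * norm (hv vs (y, t) - hv vs (y', t)) \<le> C vs * norm (y - y')"
      if "vs \<in> ?V" for vs y y' t using bspec[OF C' that] by blast+
    show ?thesis
    proof (rule that[of "\<Sum>vs\<in>?V. C vs"])
      show "(\<Sum>vs\<in>?V. C vs) \<ge> 0" by (intro sum_nonneg C)
      fix vs and y y' :: 'y and t :: 'a assume v: "vs \<in> ?V"
      have "C vs \<le> (\<Sum>vs\<in>?V. C vs)" by (rule member_le_sum[OF v _ fV]) (use C(1) in auto)
      hence "C vs * norm (y - y') \<le> (\<Sum>vs\<in>?V. C vs) * norm (y - y')" by (rule mult_right_mono) simp
      thus "norm (k vs t y - k vs t y') \<le> (\<Sum>vs\<in>?V. C vs) * norm (y - y')"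
        unfolding k_def right_diff_distrib[symmetric] norm_mult nw using C(2)[OF v, of t y y'] by linarith
    qed
  qed
  have kc: "continuous_on UNIV (k vs t)" if "vs \<in> ?V" for vs t
    unfolding k_def
    by (intro continuous_on_mult continuous_on_const continuous_on_compose2[OF schwartz_continuous[OF hv]])
       (use that in \<open>auto intro!: continuous_intros\<close>)
  have km: "k vs t \<in> borel_measurable borel" if "vs \<in> ?V" for vs t
    by (rule borel_measurable_continuous_onI[OF kc[OF that]])
  have ki: "integrable lborel (k vs t)" if "vs \<in> ?V" for vs t
    by (rule integrable_bracket_bound[OF km[OF that] Cb(2)[OF that]])
  have b0: "b y \<ge> 0" for y using order_trans[OF norm_ge_zero ub] .
  \<comment> \<open>The error has three sources: inside the seminorm, \<open>Cb\<close> times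
    \<open>e\<close> from the tail outside a box and \<open>e\<close> from the Riemann sum of
    \<open>k\<close>, both multiplied by \<open>Cu\<close>; and \<open>e\<close> from the Riemann
    sum of the majorant \<open>b\<close>.\<close>
  have main: "norm (u G) \<le> (LINT y|lborel. b y) + (Cu * (Cb + 1) + 1) * e" if e: "e > 0" for e
  proof -
    define w where "w y = 1 / bracket y ^ DIM('y)" for y :: 'y
    have wi: "integrable lborel w" unfolding w_def by (rule integrable_inverse_bracket)
    obtain a c where ac: "(LINT y|lborel. indicator (- cbox a c) y * w y) < e"
      using cbox_exhaust_tail[OF wi e] by blast
    let ?B = "cbox a c" and ?m = "measure lborel"
    \<comment> \<open>Chosen so that the total error over the box is at most \<open>e\<close>; the
      summand 1 covers a box of volume zero.\<close>
    define \<eta> where "\<eta> = e / (?m ?B + 1)"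
    have \<eta>: "\<eta> > 0" using e by (simp add: \<eta>_def add_nonneg_pos)
    have \<eta>m: "\<eta> * ?m ?B \<le> e"
    proof -
      have "\<eta> * ?m ?B \<le> \<eta> * (?m ?B + 1)" using \<eta> by simp
      also have "\<dots> = e" unfolding \<eta>_def by (simp add: add_nonneg_eq_0_iff)
      finally show ?thesis .
    qed
    have "uniformly_continuous_on ?B b"
      by (rule compact_uniformly_continuous[OF continuous_on_subset[OF b(2)] compact_cbox]) simp
    then obtain \<delta>1 where \<delta>1: "\<delta>1 > 0" "\<And>x y. x \<in> ?B \<Longrightarrow> y \<in> ?B \<Longrightarrow> dist x y < \<delta>1 \<Longrightarrow> dist (b x) (b y) < \<eta>"
      using \<eta> unfolding uniformly_continuous_on_def by (metis dist_commute)
    \<comment> \<open>One mesh size for \<open>b\<close>, by uniform continuity, and for all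
      \<open>k vs t\<close> at once, by the common Lipschitz constant.\<close>
    define \<delta> where "\<delta> = min \<delta>1 (\<eta> / (L + 1))"
    have \<delta>: "\<delta> > 0" using \<delta>1 \<eta> L(1) by (simp add: \<delta>_def)
    obtain p where p: "p tagged_division_of ?B" and pf: "(\<lambda>x. ball x \<delta>) fine p"
      using fine_division_exists[OF gauge_ball[OF \<delta>]] by blast
    have fine: "K \<subseteq> ball x \<delta>" if "(x, K) \<in> p" for x K using pf that unfolding fine_def by blast
    have fp: "finite p" using p by blast
    define S where "S = (\<lambda>t. \<Sum>q\<in>p. complex_of_real (?m (snd q)) * h (fst q, t))"
    have Sq: "(\<lambda>t. complex_of_real (?m (snd q)) * h (fst q, t)) \<in> schwartz" for q
      by (intro schwartz_cmult schwartz_slice h)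
    have S: "S \<in> schwartz" unfolding S_def by (intro schwartz_sum fp Sq)
    have "norm (u S) \<le> (\<Sum>q\<in>p. ?m (snd q) * b (fst q))"
    proof -
      have "u S = (\<Sum>q\<in>p. complex_of_real (?m (snd q)) * u (\<lambda>t. h (fst q, t)))"
        unfolding S_def tempered_sum[OF u fp Sq] by (simp add: tempered_cmult[OF u schwartz_slice[OF h]])
      also have "norm \<dots> \<le> (\<Sum>q\<in>p. ?m (snd q) * b (fst q))"
        by (rule sum_norm_le) (auto simp: norm_mult intro!: mult_left_mono ub)
      finally show ?thesis .
    qed
    \<comment> \<open>The bound on \<open>u S\<close> is itself a Riemann sum of \<open>b\<close>,
      which is why the majorant is taken continuous.\<close>
    also have "\<dots> \<le> integral ?B b + \<eta> * ?m ?B"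
    proof -
      have "norm (integral ?B b - (\<Sum>(x, K)\<in>p. ?m K *\<^sub>R b x)) \<le> \<eta> * ?m ?B"
      proof (rule riemann_sum_error[OF p fine])
        show "continuous_on ?B b" by (rule continuous_on_subset[OF b(2)]) simp
        fix x y assume "x \<in> ?B" "y \<in> ?B" "dist x y < \<delta>"
        thus "norm (b y - b x) \<le> \<eta>" using \<delta>1(2)[of x y] by (simp add: \<delta>_def dist_norm)
      qed (use \<eta> in auto)
      thus ?thesis by (simp add: case_prod_unfold)
    qed
    also have "integral ?B b \<le> (LINT y|lborel. b y)"
    proof -
      have si: "set_integrable lborel ?B b" unfolding set_integrable_def by (rule integrable_mult_indicator[OF _ b(1)]) simp
      have "integral ?B b = (LINT y:?B|lborel. b y)" by (rule set_borel_integral_eq_integral(2)[OF si, symmetric])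
      also have "\<dots> \<le> (LINT y|lborel. b y)" unfolding set_lebesgue_integral_def
      proof (rule integral_mono)
        show "integrable lborel (\<lambda>y. indicator ?B y *\<^sub>R b y)" using si unfolding set_integrable_def .
        show "indicator ?B y *\<^sub>R b y \<le> b y" for y using b0[of y] by (simp add: indicator_def)
      qed (rule b(1))
      finally show ?thesis .
    qed
    finally have uS: "norm (u S) \<le> (LINT y|lborel. b y) + e" using \<eta>m by simp
    have D: "(\<lambda>t. G t + - 1 * S t) \<in> schwartz" by (intro schwartz_add schwartz_cmult G S)
    have "norm (u (\<lambda>t. G t + - 1 * S t)) \<le> Cu * ((Cb + 1) * e)"
    proof (rule Cu'[rule_format, OF D])
      fix vs :: "'a list" and t assume vs: "set vs \<subseteq> Basis" and l: "length vs \<le> N"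
      have V: "vs \<in> ?V" using vs l by simp
      have "iter_dd vs (\<lambda>t. G t + - 1 * S t) t = iter_dd vs G t - iter_dd vs S t"
        unfolding iter_dd_add[OF G schwartz_cmult[OF S] vs] iter_dd_cmult[OF S vs] by simp
      also have "iter_dd vs G t = (LINT y|lborel. hv vs (y, t))"
        unfolding G_def iter_dd_marginal[OF h vs] hv_def ..
      also have "iter_dd vs S t = (\<Sum>q\<in>p. complex_of_real (?m (snd q)) * hv vs (fst q, t))"
        unfolding S_def iter_dd_sum[OF fp Sq vs] iter_dd_cmult[OF schwartz_slice[OF h] vs] iter_dd_slice(2)[OF h vs] hv_def ..
      finally have e1: "iter_dd vs (\<lambda>t. G t + - 1 * S t) t = (LINT y|lborel. hv vs (y, t)) - (\<Sum>q\<in>p. complex_of_real (?m (snd q)) * hv vs (fst q, t))" .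
      have "complex_of_real (bracket t ^ N) * iter_dd vs (\<lambda>t. G t + - 1 * S t) t
         = (LINT y|lborel. k vs t y) - (\<Sum>q\<in>p. ?m (snd q) *\<^sub>R k vs t (fst q))"
        unfolding e1 right_diff_distrib k_def integral_mult_right_zero sum_distrib_left scaleR_conv_of_real
        by (simp only: mult.left_commute)
      hence "bracket t ^ N * norm (iter_dd vs (\<lambda>t. G t + - 1 * S t) t)
         = norm ((LINT y|lborel. k vs t y) - (\<Sum>q\<in>p. ?m (snd q) *\<^sub>R k vs t (fst q)))"
        by (metis norm_mult nw)
      also have "\<dots> \<le> norm ((LINT y|lborel. k vs t y) - integral ?B (k vs t)) + norm (integral ?B (k vs t) - (\<Sum>q\<in>p. ?m (snd q) *\<^sub>R k vs t (fst q)))"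
        by (rule norm_diff_triangle_ineq[of _ "integral ?B (k vs t)" "integral ?B (k vs t)", simplified])
      also have "norm (integral ?B (k vs t) - (\<Sum>q\<in>p. ?m (snd q) *\<^sub>R k vs t (fst q))) \<le> \<eta> * ?m ?B"
      proof -
        have "norm (integral ?B (k vs t) - (\<Sum>(x, K)\<in>p. ?m K *\<^sub>R k vs t x)) \<le> \<eta> * ?m ?B"
        proof (rule riemann_sum_error[OF p fine])
          show "continuous_on ?B (k vs t)" by (rule continuous_on_subset[OF kc[OF V]]) simp
          fix x y :: 'y assume "dist x y < \<delta>"
          hence "norm (y - x) \<le> \<eta> / (L + 1)" by (simp add: \<delta>_def dist_norm norm_minus_commute)
          hence "L * norm (y - x) \<le> (L + 1) * (\<eta> / (L + 1))" using L(1) by (intro mult_mono) auto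
          also have "\<dots> = \<eta>" using L(1) by simp
          finally show "norm (k vs t y - k vs t x) \<le> \<eta>" using L(2)[OF V, of t y x] by simp
        qed (use \<eta> in auto)
        thus ?thesis by (simp add: case_prod_unfold)
      qed
      also have "norm ((LINT y|lborel. k vs t y) - integral ?B (k vs t)) \<le> Cb * e"
      proof -
        have si: "set_integrable lborel ?B (k vs t)" unfolding set_integrable_def by (rule integrable_mult_indicator[OF _ ki[OF V]]) simp
        have si': "integrable lborel (\<lambda>y. indicator (- ?B) y *\<^sub>R k vs t y)" by (rule integrable_mult_indicator[OF _ ki[OF V]]) simp
        have wi': "integrable lborel (\<lambda>y. indicator (- ?B) y * w y)"
          using integrable_mult_indicator[OF _ wi, of "- ?B"] by simp
        have "(LINT y|lborel. k vs t y) - integral ?B (k vs t) = (LINT y|lborel. k vs t y) - (LINT y:?B|lborel. k vs t y)"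
          by (simp only: set_borel_integral_eq_integral(2)[OF si])
        also have "\<dots> = (LINT y|lborel. k vs t y - indicator ?B y *\<^sub>R k vs t y)"
          unfolding set_lebesgue_integral_def
          by (rule Bochner_Integration.integral_diff[symmetric, OF ki[OF V] si[unfolded set_integrable_def]])
        also have "\<dots> = (LINT y|lborel. indicator (- ?B) y *\<^sub>R k vs t y)"
          by (rule Bochner_Integration.integral_cong) (auto simp: indicator_def)
        also have "norm \<dots> \<le> (LINT y|lborel. norm (indicator (- ?B) y *\<^sub>R k vs t y))" by (rule integral_norm_bound)
        also have "\<dots> \<le> (LINT y|lborel. Cb * (indicator (- ?B) y * w y))"
        proof (rule integral_mono)
          show "integrable lborel (\<lambda>y. norm (indicator (- ?B) y *\<^sub>R k vs t y))" using si' by (rule integrable_norm)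
          show "integrable lborel (\<lambda>y. Cb * (indicator (- ?B) y * w y))" using wi' by (rule integrable_mult_right)
          show "norm (indicator (- ?B) y *\<^sub>R k vs t y) \<le> Cb * (indicator (- ?B) y * w y)" for y
            using Cb(2)[OF V, of y t] bracket_power_pos[of y "DIM('y)"] by (auto simp: indicator_def w_def pos_le_divide_eq mult.commute)
        qed
        also have "\<dots> = Cb * (LINT y|lborel. indicator (- ?B) y * w y)" by (rule integral_mult_right_zero)
        also have "\<dots> \<le> Cb * e" using ac Cb(1) by (intro mult_left_mono) auto
        finally show ?thesis .
      qed
      finally show "bracket t ^ N * norm (iter_dd vs (\<lambda>t. G t + - 1 * S t) t) \<le> (Cb + 1) * e"
        using \<eta>m by (simp add: distrib_right)
    qed
    moreover have "u G = u (\<lambda>t. G t + - 1 * S t) + u S"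
      using tempered_add[OF u D S] by simp
    ultimately have "norm (u G) \<le> Cu * ((Cb + 1) * e) + ((LINT y|lborel. b y) + e)"
      using norm_triangle_mono[OF _ uS] by (simp only:)
    thus ?thesis by (simp add: algebra_simps)
  qed
  let ?M = "Cu * (Cb + 1) + 1"
  have M: "?M > 0" using Cu0 Cb(1) by (simp add: add_nonneg_pos)
  have "norm (u G) \<le> (LINT y|lborel. b y)"
  proof (rule field_le_epsilon)
    fix e :: real assume "e > 0"
    thus "norm (u G) \<le> (LINT y|lborel. b y) + e" using main[of "e / ?M"] M by simp
  qed
  thus ?thesis unfolding G_def .
qed

section \<open>Pointwise Fourier inversion for Schwartz functions\<close>

lemma AE_continuous_eq:
  fixes f g :: "'a::euclidean_space \<Rightarrow> 'b::euclidean_space"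
  assumes f: "continuous_on UNIV f" and g: "continuous_on UNIV g" and ae: "AE x in lborel. f x = g x"
  shows "f x = g x"
proof -
  have o: "open {x. f x \<noteq> g x}" by (rule open_Collect_neq[OF f g])
  have "{x. f x \<noteq> g x} \<in> null_sets lborel"
    using ae o by (subst AE_iff_null_sets) auto
  hence "negligible {x. f x \<noteq> g x}"
    by (metis negligible_iff_null_sets null_sets_completionI)
  hence "{x. f x \<noteq> g x} = {}" using open_not_negligible[OF o] by blast
  thus ?thesis by blast
qed

lemma continuous_on_chr_integral:
  fixes g :: "'a::euclidean_space \<Rightarrow> complex"
  assumes g: "integrable lborel g"
  shows "continuous_on UNIV (\<lambda>t. LINT \<omega>|lborel. g \<omega> * chr (t \<bullet> \<omega>))"
proof -
  have [measurable]: "g \<in> borel_measurable borel" using g by simp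
  have "isCont (\<lambda>t. LINT \<omega>|lborel. g \<omega> * chr (t \<bullet> \<omega>)) t" for t
    unfolding continuous_within tendsto_at_iff_sequentially comp_def
  proof (intro allI impI)
    fix X :: "nat \<Rightarrow> 'a" assume X: "X \<longlonglongrightarrow> t"
    show "(\<lambda>n. LINT \<omega>|lborel. g \<omega> * chr (X n \<bullet> \<omega>)) \<longlonglongrightarrow> (LINT \<omega>|lborel. g \<omega> * chr (t \<bullet> \<omega>))"
    proof (rule integral_dominated_convergence[where w = "\<lambda>\<omega>. norm (g \<omega>)"])
      show "AE \<omega> in lborel. (\<lambda>n. g \<omega> * chr (X n \<bullet> \<omega>)) \<longlonglongrightarrow> g \<omega> * chr (t \<bullet> \<omega>)"
        unfolding chr_def by (intro AE_I2 tendsto_intros X)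
      show "AE \<omega> in lborel. norm (g \<omega> * chr (X n \<bullet> \<omega>)) \<le> norm (g \<omega>)" for n
        by (simp add: norm_mult)
    qed (use g in auto)
  qed
  thus ?thesis by (simp add: continuous_at_imp_continuous_on)
qed

lemma fourier_inversion_schwartz:
  fixes q :: "'a::euclidean_space \<Rightarrow> complex"
  assumes q: "q \<in> schwartz"
  shows "q t = (LINT \<omega>|lborel. fourier q \<omega> * chr (t \<bullet> \<omega>))"
proof -
  obtain C where C: "\<And>\<omega>. bracket \<omega> ^ DIM('a) * norm (fourier q \<omega>) \<le> C"
    using rapid_inE[OF fourier_rapid[OF schwartz_imp_smooth[OF q]], of "DIM('a)"] by metis
  have [measurable]: "q \<in> borel_measurable borel" by (rule schwartz_measurable[OF q])
  have "fourier q \<in> borel_measurable borel" unfolding fourier_def by measurable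
  hence fi: "integrable lborel (fourier q)" by (rule integrable_bracket_bound[OF _ C])
  show ?thesis
    by (rule AE_continuous_eq[OF schwartz_continuous[OF q] continuous_on_chr_integral[OF fi]
          fourier_inversion[OF schwartz_integrable[OF q] fi]])
qed

subsection \<open>Weights\<close>

lemma v_weight_pos: "v_weight s z > 0"
  unfolding v_weight_def using bracket_pos[of z] by simp

lemma v_weight_add: "v_weight (r + s) z = v_weight r z * v_weight s z"
  unfolding v_weight_def by (simp add: powr_add add_divide_distrib)

lemma v_weight_le_power:
  assumes "s / 2 \<le> real M" shows "v_weight s z \<le> bracket z ^ M"
proof -
  have "v_weight s z \<le> bracket z powr real M"
    unfolding v_weight_def by (rule powr_mono[OF assms one_le_bracket])
  thus ?thesis using bracket_pos[of z] by (simp add: powr_realpow)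
qed

lemma v_weight_triangle:
  assumes "s \<ge> 0"
  shows "v_weight s (x + y) \<le> 2 powr (s / 2) * v_weight s x * v_weight s y"
proof -
  have "v_weight s (x + y) \<le> (2 * bracket x * bracket y) powr (s / 2)"
    unfolding v_weight_def using assms bracket_pos[of "x + y"]
    by (intro powr_mono2 bracket_add_le) auto
  also have "\<dots> = 2 powr (s / 2) * v_weight s x * v_weight s y"
    unfolding v_weight_def by (simp add: powr_mult del: distrib_left_numeral)
  finally show ?thesis .
qed

subsection \<open>Translates of a bounded family against a symbol in the weighted modulation space\<close>

lemma stft_distr_gauss_eq:
  "stft_distr gauss_window u (z, \<zeta>) = u (\<lambda>t. gauss_window (t - z) * chr (t \<bullet> - \<zeta>))"
proof -
  have "cnj (modul \<zeta> (transl z gauss_window) t) = gauss_window (t - z) * chr (t \<bullet> - \<zeta>)" for t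
    unfolding modul_def transl_def chr_def[symmetric]
    by (simp add: gauss_window_simps cnj_chr mult.commute)
  thus ?thesis by (simp add: stft_distr_def)
qed

text \<open>The squared L2 norm of \<open>gauss_window\<close>, the normalising constant of the
  reproducing formula. Only its positivity is used, not its value.\<close>

definition gauss_mass :: "'a::euclidean_space itself \<Rightarrow> real" where
  "gauss_mass _ = (LINT z|lborel. exp (- pi * norm (z::'a) ^ 2) ^ 2)"

lemma gauss_mass_pos: "gauss_mass TYPE('a::euclidean_space) > 0"
proof -
  have i: "integrable lborel (\<lambda>z::'a. exp (- pi * norm z ^ 2) ^ 2)"
    using square_integrableD(2)[OF schwartz_square_integrable[OF gauss_schwartz]] by (simp add: gauss_window_simps)
  have "gauss_mass TYPE('a) \<ge> 0" unfolding gauss_mass_def by (rule Bochner_Integration.integral_nonneg) simp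
  moreover have "gauss_mass TYPE('a) \<noteq> 0"
  proof
    assume "gauss_mass TYPE('a) = 0"
    hence "AE z::'a in lborel. exp (- pi * norm z ^ 2) ^ 2 = 0"
      unfolding gauss_mass_def by (subst (asm) integral_nonneg_eq_0_iff_AE[OF i]) auto
    hence "AE z::'a in lborel. False" by simp
    hence "ae_filter (lborel :: 'a measure) = bot" by (simp only: eventually_False)
    hence "emeasure lborel (UNIV :: 'a set) = 0" by (simp add: ae_filter_eq_bot_iff)
    thus False by (simp add: emeasure_lborel_UNIV)
  qed
  ultimately show ?thesis by simp
qed

text \<open>Reproducing formula of the short-time Fourier transform. Integrating over frequency
  first is Fourier inversion for \<open>G\<close> times the window at \<open>z\<close> and leaves
  \<open>G t\<close> times the squared Gaussian at t - z; the integral over \<open>z\<close> then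
  gives \<open>gauss_mass\<close>. Joint membership in \<open>schwartz\<close> is what
  \<open>tempered_integral_bound\<close> asks for.\<close>

lemma reproducing_schwartz:
  fixes G :: "'a::euclidean_space \<Rightarrow> complex"
  assumes G: "G \<in> schwartz"
  defines "h \<equiv> \<lambda>p :: ('a \<times> 'a) \<times> 'a. stft gauss_window G (fst p) * gauss_window (snd p - fst (fst p)) * chr (snd p \<bullet> snd (fst p))"
  shows "h \<in> schwartz"
    and "(LINT y|lborel. h (y, t)) = of_real (gauss_mass TYPE('a)) * G t"
proof -
  let ?V = "stft gauss_window G"
  have V: "?V \<in> schwartz" by (rule stft_schwartz[OF G gauss_schwartz])
  have vf: "regular (rapid_in fst) n (\<lambda>(_::unit) (p :: ('a \<times> 'a) \<times> 'a). ?V (fst p))" for n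
  proof (rule regular_compose_linear[OF bounded_linear_fst additive_growth_rapid_in])
    show "regular rapid n (\<lambda>_::unit. ?V)" using V unfolding schwartz_iff_smooth smooth_def by blast
    show "rapid_in fst (\<lambda>i x. F i (fst x))" if "rapid F" for F :: "unit \<Rightarrow> 'a \<times> 'a \<Rightarrow> complex"
      using rapid_in_compose[OF that, of fst] .
  qed
  have gs: "regular (rapid_in snd) n (\<lambda>(_::unit) (p :: ('a \<times> 'a) \<times> 'a). gauss_window (snd p))" for n
  proof (rule regular_compose_linear[OF bounded_linear_snd additive_growth_rapid_in])
    show "regular rapid n (\<lambda>_::unit. gauss_window :: 'a \<Rightarrow> complex)" using gauss_schwartz unfolding schwartz_iff_smooth smooth_def by blast
    show "rapid_in snd (\<lambda>i x. F i (snd x))" if "rapid F" for F :: "unit \<Rightarrow> 'a \<Rightarrow> complex"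
      using rapid_in_compose[OF that, of snd] .
  qed
  \<comment> \<open>The shear that replaces t by t - z turns \<open>h\<close>, up to its character,
    into a tensor product of the transform and the Gaussian.\<close>
  let ?L = "\<lambda>p :: ('a \<times> 'a) \<times> 'a. (fst p, snd p - fst (fst p))"
  have bl: "bounded_linear ?L"
    by (intro bounded_linear_Pair bounded_linear_sub bounded_linear_fst bounded_linear_snd
        bounded_linear_compose[OF bounded_linear_fst bounded_linear_fst])
  have T: "regular rapid n (\<lambda>(_::unit) (p :: ('a \<times> 'a) \<times> 'a). ?V (fst p) * gauss_window (snd p))" for n
    by (rule regular_mult[OF additive_growth_rapid_in rapid_tensor vf gs])
  have TL: "regular (rapid_in ?L) n (\<lambda>(_::unit) p. ?V (fst (?L p)) * gauss_window (snd (?L p)))" for n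
  proof (rule regular_compose_linear[OF bl additive_growth_rapid_in _ T])
    show "rapid_in ?L (\<lambda>i x. F i (?L x))" if "rapid F" for F :: "unit \<Rightarrow> ('a \<times> 'a) \<times> 'a \<Rightarrow> complex"
      using rapid_in_compose[OF that, of ?L] .
  qed
  \<comment> \<open>Since |t|^2 <= 2 |t - z|^2 + 2 |z|^2, the coefficient of |z|^2 becomes 1 +
    2.\<close>
  have LB: "1 + norm p ^ 2 \<le> 3 * bracket (?L p)" for p
  proof -
    obtain z \<zeta> t where p: "p = ((z, \<zeta>), t)" by (metis prod.collapse)
    have "norm t ^ 2 = norm ((t - z) + z) ^ 2" by simp
    also have "\<dots> \<le> 2 * norm (t - z) ^ 2 + 2 * norm z ^ 2" by (rule norm_add_square_le)
    finally have "norm t ^ 2 \<le> 2 * norm (t - z) ^ 2 + 2 * norm z ^ 2" .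
    moreover have "a \<le> 2 * d + 2 * b \<Longrightarrow> 0 \<le> c \<Longrightarrow> 0 \<le> d \<Longrightarrow> 1 + (b + c + a) \<le> 3 * (1 + (b + c + d))" for a b c d :: real
      by argo
    ultimately have "1 + (norm z ^ 2 + norm \<zeta> ^ 2 + norm t ^ 2) \<le> 3 * (1 + (norm z ^ 2 + norm \<zeta> ^ 2 + norm (t - z) ^ 2))"
      by (metis zero_le_power2)
    thus ?thesis by (simp add: p norm_Pair)
  qed
  have R1: "smooth rapid (\<lambda>(_::unit) p. ?V (fst (?L p)) * gauss_window (snd (?L p)))"
    unfolding smooth_def
  proof
    fix n show "regular rapid n (\<lambda>(_::unit) p. ?V (fst (?L p)) * gauss_window (snd (?L p)))"
      by (rule regular_mono[OF _ TL]) (erule rapid_in_change[OF _ LB], simp)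
  qed
  have R2: "smooth poly_growth (\<lambda>(_::unit) p :: ('a \<times> 'a) \<times> 'a. chr (snd p \<bullet> snd (fst p)))"
  proof (rule smooth_chr)
    have "smooth poly_growth (\<lambda>(_::unit) p :: ('a \<times> 'a) \<times> 'a. \<Sum>b\<in>Basis. complex_of_real (snd p \<bullet> b) * complex_of_real (snd (fst p) \<bullet> b))"
      by (intro smooth_sum smooth_poly_mult additive_growth_poly finite_Basis smooth_linear
          bounded_linear_compose[OF bounded_linear_inner_left] bounded_linear_snd
          bounded_linear_compose[OF bounded_linear_snd bounded_linear_fst])
    moreover have "(\<Sum>b\<in>Basis. complex_of_real (snd p \<bullet> b) * complex_of_real (snd (fst p) \<bullet> b)) = complex_of_real (snd p \<bullet> snd (fst p))" for p :: "('a \<times> 'a) \<times> 'a"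
      by (subst euclidean_inner) simp
    ultimately show "smooth poly_growth (\<lambda>(_::unit) p :: ('a \<times> 'a) \<times> 'a. complex_of_real (snd p \<bullet> snd (fst p)))" by simp
  qed
  from smooth_rapid_mult[OF R2 R1]
  show hS: "h \<in> schwartz" unfolding schwartz_iff_smooth h_def by (simp add: mult_ac)
  have "(LINT y|lborel. h (y, t)) = (LINT y|(lborel \<Otimes>\<^sub>M lborel). h (y, t))"
    by (simp add: lborel_prod)
  also have "\<dots> = (LINT z|lborel. (LINT \<zeta>|lborel. h ((z, \<zeta>), t)))"
    by (rule lborel_pair.integral_fst'[symmetric]) (use slice_integrable(2)[OF hS, of t] in \<open>simp add: lborel_prod\<close>)
  also have "\<dots> = (LINT z|lborel. G t * of_real (exp (- pi * norm (z - t) ^ 2) ^ 2))"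
  proof (rule Bochner_Integration.integral_cong[OF refl])
    fix z
    let ?q = "\<lambda>y. G y * cnj (gauss_window (y - z))"
    have q: "?q \<in> schwartz" by (intro schwartz_mult G schwartz_conj_shift gauss_schwartz)
    have "(LINT \<zeta>|lborel. h ((z, \<zeta>), t)) = gauss_window (t - z) * (LINT \<zeta>|lborel. fourier ?q \<zeta> * chr (t \<bullet> \<zeta>))"
      unfolding h_def integral_mult_right_zero[symmetric]
      by (rule Bochner_Integration.integral_cong) (simp_all add: stft_eq fourier_def mult_ac)
    also have "\<dots> = gauss_window (t - z) * (G t * cnj (gauss_window (t - z)))"
      unfolding fourier_inversion_schwartz[OF q, symmetric] ..
    also have "\<dots> = G t * of_real (exp (- pi * norm (z - t) ^ 2) ^ 2)"
      by (simp add: gauss_window_def power2_eq_square norm_minus_commute)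
    finally show "(LINT \<zeta>|lborel. h ((z, \<zeta>), t)) = G t * of_real (exp (- pi * norm (z - t) ^ 2) ^ 2)" .
  qed
  also have "\<dots> = G t * of_real (LINT z|lborel. exp (- pi * norm (z - t) ^ 2) ^ 2)"
    by (simp only: integral_mult_right_zero integral_complex_of_real)
  also have "(LINT z|lborel. exp (- pi * norm (z - t) ^ 2) ^ 2) = gauss_mass TYPE('a)"
    unfolding gauss_mass_def
    using lborel_integral_translate[of "\<lambda>z. exp (- pi * norm z ^ 2) ^ 2" "- t"] by simp
  finally show "(LINT y|lborel. h (y, t)) = of_real (gauss_mass TYPE('a)) * G t" by (simp add: mult.commute)
qed

text \<open>A translation moves the transform of \<open>F i\<close> only in position, hence
  concentrates it near (w, 0) in phase space, where the transform of \<open>u\<close> is of order 1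
  / v_s(w). Trading v_s(w) for v_s(z) costs v_s(z - w), which the rapid decay of the transform of
  \<open>F i\<close> pays.\<close>

theorem translates_bound:
  fixes F :: "'i \<Rightarrow> 'a::euclidean_space \<Rightarrow> complex"
  assumes u: "tempered_distribution u" and s: "s \<ge> 0"
    and B: "\<And>z \<zeta>. norm (stft_distr gauss_window u (z, \<zeta>)) * v_weight s z \<le> C0"
    and F: "smooth rapid F"
  shows "\<exists>C. \<forall>i w. norm (u (\<lambda>t. F i (t - w))) * v_weight s w \<le> C"
proof -
  obtain M :: nat where M: "s / 2 \<le> real M" using real_arch_simple by blast
  let ?D = "DIM('a \<times> 'a)"
  \<comment> \<open>\<open>M\<close> powers absorb the weight at z - w; the other \<open>?D\<close>
    powers make the bound integrable over phase space.\<close>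
  obtain C1 where C1: "C1 \<ge> 0" "\<And>i y. bracket y ^ (M + ?D) * norm (stft gauss_window (F i) y) \<le> C1"
    using rapid_inE[OF stft_rapid[OF F gauss_schwartz], of "M + ?D"] by metis
  have C0: "C0 \<ge> 0"
    using B[of 0 0] v_weight_pos[of s "0::'a"] by (meson mult_nonneg_nonneg norm_ge_zero less_imp_le order_trans)
  let ?\<kappa> = "gauss_mass TYPE('a)"
  define J where "J = (LINT y|lborel. 1 / bracket (y::'a \<times> 'a) ^ ?D)"
  define K where "K = C0 * 2 powr (s / 2) * C1"
  have "norm (u (\<lambda>t. F i (t - w))) * v_weight s w \<le> K * J / ?\<kappa>" for i w
  proof -
    let ?G = "\<lambda>t. F i (t - w)"
    have Fi: "F i \<in> schwartz" by (rule smooth_imp_schwartz[OF F])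
    have G: "?G \<in> schwartz" using schwartz_translate[OF Fi, of "- w"] by simp
    define h where "h = (\<lambda>p :: ('a \<times> 'a) \<times> 'a. stft gauss_window ?G (fst p) * gauss_window (snd p - fst (fst p)) * chr (snd p \<bullet> snd (fst p)))"
    have hS: "h \<in> schwartz" unfolding h_def by (rule reproducing_schwartz(1)[OF G])
    have hI: "(LINT y|lborel. h (y, t)) = of_real ?\<kappa> * ?G t" for t
      unfolding h_def by (rule reproducing_schwartz(2)[OF G])
    define b where "b y = K / v_weight s w * (1 / bracket (y - (w, 0)) ^ ?D)" for y :: "'a \<times> 'a"
    have ib0: "integrable lborel (\<lambda>y::'a \<times> 'a. 1 / bracket (y - (w, 0)) ^ ?D)"
      using lborel_integrable_translate[OF integrable_inverse_bracket[where 'a="'a \<times> 'a"], of "- (w, 0)"]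
      unfolding diff_conv_add_uminus .
    have ib: "integrable lborel b" unfolding b_def by (rule integrable_mult_right[OF ib0])
    have "(LINT y|lborel. 1 / bracket (y - (w, 0) :: 'a \<times> 'a) ^ ?D) = J"
      unfolding J_def diff_conv_add_uminus
      by (rule lborel_integral_translate[of "\<lambda>y. 1 / bracket y ^ ?D"]) measurable
    hence Ib: "(LINT y|lborel. b y) = K / v_weight s w * J"
      unfolding b_def integral_mult_right_zero by (simp only:)
    have cb: "continuous_on UNIV b"
      unfolding b_def by (intro continuous_intros) (auto simp: add_nonneg_eq_0_iff)
    have ub: "norm (u (\<lambda>t. h (y, t))) \<le> b y" for y
    proof -
      obtain z \<zeta> where y: "y = (z, \<zeta>)" by (cases y)
      let ?V = "stft gauss_window ?G y"
      have S: "(\<lambda>t. gauss_window (t - z) * chr (t \<bullet> \<zeta>)) \<in> schwartz"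
        using schwartz_chr_mult[OF schwartz_translate[OF gauss_schwartz, of "- z"], of \<zeta>] by (simp add: mult.commute)
      \<comment> \<open>\<open>stft_distr\<close> pairs with the conjugated time-frequency shift,
        which reflects the frequency; this is harmless because the bound \<open>B\<close> is uniform
        in it.\<close>
      have "u (\<lambda>t. h (y, t)) = ?V * stft_distr gauss_window u (z, - \<zeta>)"
        unfolding h_def stft_distr_gauss_eq using tempered_cmult[OF u S, of ?V] by (simp add: y mult.assoc)
      hence e: "norm (u (\<lambda>t. h (y, t))) = norm ?V * norm (stft_distr gauss_window u (z, - \<zeta>))" by (simp add: norm_mult)
      have "norm ?V = norm (stft gauss_window (F i) (z - w, \<zeta>))"
        using stft_shift[OF schwartz_measurable[OF G] gauss_schwartz, of "z - w" w \<zeta> 0] by (simp add: y norm_mult)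
      hence V: "bracket (z - w, \<zeta>) ^ M * (bracket (z - w, \<zeta>) ^ ?D * norm ?V) \<le> C1"
        using C1(2)[of "(z - w, \<zeta>)" i] by (simp add: power_add mult.assoc)
      have st: "norm (stft_distr gauss_window u (z, - \<zeta>)) \<le> C0 / v_weight s z"
        using B[of z "- \<zeta>"] v_weight_pos[of s z] by (simp add: pos_le_divide_eq)
      have "v_weight s w \<le> 2 powr (s / 2) * v_weight s z * v_weight s (w - z)"
        using v_weight_triangle[OF s, of z "w - z"] by simp
      also have "v_weight s (w - z) = v_weight s (z - w)" by (simp add: v_weight_def norm_minus_commute)
      also have "\<dots> \<le> bracket (z - w) ^ M" by (rule v_weight_le_power[OF M])
      also have "\<dots> \<le> bracket (z - w, \<zeta>) ^ M" by (intro power_mono add_left_mono norm_fst_le) auto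
      finally have P: "v_weight s w \<le> 2 powr (s / 2) * v_weight s z * bracket (z - w, \<zeta>) ^ M"
        using v_weight_pos[of s z] by simp
      let ?X = "bracket (z - w, \<zeta>) ^ ?D" and ?Y = "bracket (z - w, \<zeta>) ^ M"
      have "norm (u (\<lambda>t. h (y, t))) * v_weight s w * ?X \<le> (norm ?V * (C0 / v_weight s z)) * (2 powr (s / 2) * v_weight s z * ?Y) * ?X"
        unfolding e using v_weight_pos[of s z] v_weight_pos[of s w] C0
        by (intro mult_right_mono mult_mono mult_left_mono st P) (auto intro!: mult_nonneg_nonneg)
      also have "\<dots> = C0 * 2 powr (s / 2) * (?Y * (?X * norm ?V))"
        using v_weight_pos[of s z] by (simp add: field_simps)
      also have "\<dots> \<le> C0 * 2 powr (s / 2) * C1" using C0 by (intro mult_left_mono V) auto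
      finally have "norm (u (\<lambda>t. h (y, t))) * v_weight s w * ?X \<le> K" by (simp add: K_def)
      hence "norm (u (\<lambda>t. h (y, t))) \<le> K / (v_weight s w * ?X)"
        using v_weight_pos[of s w] bracket_power_pos[of "(z - w, \<zeta>)" ?D] by (simp add: pos_le_divide_eq mult.assoc)
      thus ?thesis by (simp add: b_def y)
    qed
    have "?\<kappa> * norm (u ?G) = norm (u (\<lambda>t. of_real ?\<kappa> * ?G t))"
      using tempered_cmult[OF u G, of "of_real ?\<kappa>"] gauss_mass_pos[where 'a='a] by (simp add: norm_mult)
    also have "\<dots> = norm (u (\<lambda>t. LINT y|lborel. h (y, t)))" unfolding hI ..
    also have "\<dots> \<le> K / v_weight s w * J" unfolding Ib[symmetric] by (rule tempered_integral_bound[OF u hS ib cb ub])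
    finally show ?thesis using v_weight_pos[of s w] gauss_mass_pos[where 'a='a] by (simp add: field_simps)
  qed
  thus ?thesis by blast
qed

subsection \<open>The localization operator on square integrable functions\<close>

text \<open>Only the finitely many derivatives of order at most \<open>N\<close> enter the
  continuity bound, so their uniform constants can be summed.\<close>

lemma tempered_family_bound:
  fixes F :: "'i \<Rightarrow> 'a::euclidean_space \<Rightarrow> complex"
  assumes u: "tempered_distribution u" and F: "smooth rapid F"
  shows "\<exists>C. \<forall>i. norm (u (F i)) \<le> C"
proof -
  obtain Cu N where Cu: "Cu \<ge> 0" and Cu': "\<forall>f\<in>schwartz. \<forall>K.
       (\<forall>vs x. set vs \<subseteq> Basis \<longrightarrow> length vs \<le> N \<longrightarrow> bracket x ^ N * norm (iter_dd vs f x) \<le> K)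
       \<longrightarrow> norm (u f) \<le> Cu * K"
    using tempered_bound[OF u] by blast
  let ?V = "{vs. set vs \<subseteq> (Basis::'a set) \<and> length vs \<le> N}"
  have fV: "finite ?V" by (rule finite_lists_length_le[OF finite_Basis])
  have "\<forall>vs\<in>?V. \<exists>C. 0 \<le> C \<and> (\<forall>i x. bracket x ^ N * norm (iter_dd vs (F i) x) \<le> C)"
  proof
    fix vs assume "vs \<in> ?V"
    hence "set vs \<subseteq> Basis" by simp
    from rapid_inE[OF smoothD(1)[OF smooth_iter_dd[OF F this]], of N]
    show "\<exists>C. 0 \<le> C \<and> (\<forall>i x. bracket x ^ N * norm (iter_dd vs (F i) x) \<le> C)" by metis
  qed
  from bchoice[OF this] obtain C where C: "\<forall>vs\<in>?V. 0 \<le> C vs \<and> (\<forall>i x. bracket x ^ N * norm (iter_dd vs (F i) x) \<le> C vs)" ..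
  have "norm (u (F i)) \<le> Cu * (\<Sum>vs\<in>?V. C vs)" for i
  proof (rule Cu'[rule_format, OF smooth_imp_schwartz[OF F]])
    fix vs :: "'a list" and x assume "set vs \<subseteq> Basis" "length vs \<le> N"
    hence v: "vs \<in> ?V" by simp
    have "C vs \<le> (\<Sum>vs\<in>?V. C vs)" by (rule member_le_sum[OF v _ fV]) (use C in auto)
    thus "bracket x ^ N * norm (iter_dd vs (F i) x) \<le> (\<Sum>vs\<in>?V. C vs)"
      using bspec[OF C v] by (meson order_trans)
  qed
  thus ?thesis by blast
qed

lemma smooth_stft_product:
  fixes f :: "'i \<Rightarrow> 'a::euclidean_space \<Rightarrow> complex"
  assumes "\<And>i. square_integrable (f i)" "\<And>\<psi>. \<psi> \<in> schwartz \<Longrightarrow> poly_growth (\<lambda>i. stft \<psi> (f i))"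
    and "\<psi> \<in> schwartz" "\<theta> \<in> schwartz" "g \<in> schwartz"
  shows "smooth rapid (\<lambda>i z. stft \<psi> (f i) z * cnj (stft \<theta> g z))"
proof (rule smooth_rapid_mult)
  show "smooth poly_growth (\<lambda>i. stft \<psi> (f i))" by (rule smooth_stft_poly) (use assms in auto)
  show "smooth rapid (\<lambda>(i::'i) z. cnj (stft \<theta> g z))"
    by (intro smooth_rapid_cnj schwartz_imp_smooth stft_schwartz assms)
qed

lemma poly_growth_stft_bounded:
  fixes f :: "'i \<Rightarrow> 'a::euclidean_space \<Rightarrow> complex"
  assumes "\<And>i. square_integrable (f i)" "\<And>i. norm2 (f i) \<le> K" "\<psi> \<in> schwartz"
  shows "poly_growth (\<lambda>i. stft \<psi> (f i))"
proof -
  have "norm (stft \<psi> (f i) z) \<le> (K + norm2 \<psi>) / 2 * bracket z ^ 0" for i z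
    using norm_stft_le[OF assms(1,3), of i z] assms(2)[of i] by simp
  thus ?thesis unfolding poly_growth_def by blast
qed

lemma square_integrable_conj: "square_integrable g \<Longrightarrow> square_integrable (\<lambda>x. cnj (g x))"
  unfolding square_integrable_def by (auto intro: measurable_compose[OF _ measurable_cnj])

lemma norm2_conj: "norm2 (\<lambda>x. cnj (g x)) = norm2 g"
  by (simp add: norm2_def)

text \<open>The defect \<open>l\<close> of the identity is linear, vanishes on Schwartz functions
  and is bounded on norm-bounded sets: the operator is bounded, and the products fed into
  \<open>a\<close> then form a bounded Schwartz family. Density forces it to vanish.\<close>

theorem loc_op_square_integrable:
  fixes a :: "((real^'d::finite) \<times> (real^'d) \<Rightarrow> complex) \<Rightarrow> complex"
  assumes a: "tempered_distribution a" and \<phi>: "\<phi>1 \<in> schwartz" "\<phi>2 \<in> schwartz"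
    and T: "is_loc_op a \<phi>1 \<phi>2 T" and f: "square_integrable f" and g: "g \<in> schwartz"
  shows "L2_inner (T f) g = a (\<lambda>z. stft \<phi>1 f z * cnj (stft \<phi>2 g z))"
proof -
  have Tsq: "square_integrable (T f)" if "square_integrable f" for f
    using T that unfolding is_loc_op_def by blast
  have Tadd: "AE x in lborel. T (\<lambda>y. f y + g y) x = T f x + T g x" if "square_integrable f" "square_integrable g" for f g
    using T that unfolding is_loc_op_def by blast
  have Tmul: "AE x in lborel. T (\<lambda>y. c * f y) x = c * T f x" if "square_integrable f" for f c
    using T that unfolding is_loc_op_def by blast
  have TS: "L2_inner (T f) g = a (\<lambda>z. stft \<phi>1 f z * cnj (stft \<phi>2 g z))" if "f \<in> schwartz" for f
    using T that g unfolding is_loc_op_def by blast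
  obtain CT where CT: "\<And>f. square_integrable f \<Longrightarrow> norm2 (T f) \<le> CT * norm2 f"
    using T unfolding is_loc_op_def norm2_def by blast
  have gs: "square_integrable (\<lambda>x. cnj (g x))" by (intro square_integrable_conj schwartz_square_integrable g)
  define \<Phi> where "\<Phi> h = (\<lambda>z. stft \<phi>1 h z * cnj (stft \<phi>2 g z))" for h
  have \<Phi>S: "\<Phi> h \<in> schwartz" if "square_integrable h" for h
    unfolding \<Phi>_def using smooth_imp_schwartz[OF smooth_stft_product[of "\<lambda>_::unit. h", OF that poly_growth_stft_bounded[OF that order_refl] \<phi> g]] .
  define l where "l h = L2_inner (T h) g - a (\<Phi> h)" for h
  have l_add: "l (\<lambda>x. h x + k x) = l h + l k" if h: "square_integrable h" and k: "square_integrable k" for h k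
  proof -
    note [measurable] = square_integrableD(1)[OF Tsq[OF h]] square_integrableD(1)[OF Tsq[OF k]]
      square_integrableD(1)[OF Tsq[OF square_integrable_add(1)[OF h k]]] schwartz_measurable[OF g]
    have "L2_inner (T (\<lambda>x. h x + k x)) g = (LINT x|lborel. T h x * cnj (g x) + T k x * cnj (g x))"
      unfolding L2_inner_def
      by (rule integral_cong_AE) (use Tadd[OF h k] in \<open>auto simp: distrib_right\<close>)
    also have "\<dots> = L2_inner (T h) g + L2_inner (T k) g"
      unfolding L2_inner_def
      by (intro Bochner_Integration.integral_add square_integrable_mult Tsq h k gs)
    finally have 1: "L2_inner (T (\<lambda>x. h x + k x)) g = L2_inner (T h) g + L2_inner (T k) g" .
    have "\<Phi> (\<lambda>x. h x + k x) = (\<lambda>z. \<Phi> h z + \<Phi> k z)"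
      by (simp add: \<Phi>_def stft_add[OF h k \<phi>(1)] distrib_right)
    thus ?thesis using 1 tempered_add[OF a \<Phi>S[OF h] \<Phi>S[OF k]] by (simp add: l_def)
  qed
  have l_mul: "l (\<lambda>x. c * h x) = c * l h" if h: "square_integrable h" for h c
  proof -
    note [measurable] = square_integrableD(1)[OF Tsq[OF h]]
      square_integrableD(1)[OF Tsq[OF square_integrable_cmult(1)[OF h]]] schwartz_measurable[OF g]
    have "L2_inner (T (\<lambda>x. c * h x)) g = (LINT x|lborel. c * (T h x * cnj (g x)))"
      unfolding L2_inner_def
      by (rule integral_cong_AE) (use Tmul[OF h, of c] in \<open>auto simp: mult.assoc\<close>)
    also have "\<dots> = c * L2_inner (T h) g" unfolding L2_inner_def by (rule integral_mult_right_zero)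
    finally have 1: "L2_inner (T (\<lambda>x. c * h x)) g = c * L2_inner (T h) g" .
    have "\<Phi> (\<lambda>x. c * h x) = (\<lambda>z. c * \<Phi> h z)" by (simp add: \<Phi>_def stft_cmult mult.assoc)
    thus ?thesis using 1 tempered_cmult[OF a \<Phi>S[OF h]] by (simp add: l_def right_diff_distrib)
  qed
  have "\<exists>p. p \<in> schwartz \<and> norm2 (\<lambda>x. f x - p x) < 1 / real (Suc n) ^ 2" for n
    using schwartz_dense[OF f, of "1 / real (Suc n) ^ 2"] by (metis zero_less_divide_1_iff of_nat_0_less_iff zero_less_Suc zero_less_power)
  then obtain p where p: "\<And>n. p n \<in> schwartz" "\<And>n. norm2 (\<lambda>x. f x - p n x) < 1 / real (Suc n) ^ 2" by metis
  \<comment> \<open>The rate 1 / (n + 1)^2 for the squared norm is just what scaling by n + 1 uses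
    up: \<open>v n\<close> stays in the unit ball, \<open>l (v n)\<close> stays bounded, and undoing
    the scaling sends \<open>l f\<close> to 0.\<close>
  define v where "v n = (\<lambda>x. of_nat (Suc n) * (f x - p n x))" for n
  have dsq: "square_integrable (\<lambda>x. f x - p n x)" for n
    by (intro square_integrable_diff f schwartz_square_integrable p)
  have vsq: "square_integrable (v n)" for n unfolding v_def by (rule square_integrable_cmult(1)[OF dsq])
  have v1: "norm2 (v n) \<le> 1" for n
  proof -
    have "norm2 (v n) = real (Suc n) ^ 2 * norm2 (\<lambda>x. f x - p n x)"
      unfolding v_def square_integrable_cmult(2)[OF dsq] norm_of_nat ..
    also have "\<dots> \<le> real (Suc n) ^ 2 * (1 / real (Suc n) ^ 2)" using p(2)[of n] by (intro mult_left_mono) auto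
    finally show ?thesis by simp
  qed
  have "smooth rapid (\<lambda>n. \<Phi> (v n))"
    unfolding \<Phi>_def by (rule smooth_stft_product[OF vsq poly_growth_stft_bounded[OF vsq v1] \<phi> g])
  from tempered_family_bound[OF a this] obtain Ca where Ca: "\<And>n. norm (a (\<Phi> (v n))) \<le> Ca" by blast
  define K where "K = (\<bar>CT\<bar> + norm2 g) / 2 + Ca"
  have lv: "norm (l (v n)) \<le> K" for n
  proof -
    have "norm2 (T (v n)) \<le> CT * norm2 (v n)" by (rule CT[OF vsq])
    also have "\<dots> \<le> \<bar>CT\<bar> * 1" using v1[of n] norm2_nonneg[of "v n"] by (intro mult_mono) auto
    finally have t: "norm2 (T (v n)) \<le> \<bar>CT\<bar>" by simp
    have "norm (L2_inner (T (v n)) g) \<le> (norm2 (T (v n)) + norm2 (\<lambda>x. cnj (g x))) / 2"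
      unfolding L2_inner_def by (rule square_integrable_mult(2)[OF Tsq[OF vsq] gs])
    also have "\<dots> \<le> (\<bar>CT\<bar> + norm2 g) / 2" using t by (simp add: norm2_conj)
    finally show ?thesis unfolding l_def K_def using norm_triangle_ineq4[of "L2_inner (T (v n)) g" "a (\<Phi> (v n))"] Ca[of n] by linarith
  qed
  have lf: "norm (l f) \<le> K * inverse (real (Suc n))" for n
  proof -
    have "f = (\<lambda>x. p n x + inverse (of_nat (Suc n)) * v n x)"
      by (rule ext) (simp add: v_def mult.assoc[symmetric] del: of_nat_Suc)
    hence "l f = l (\<lambda>x. p n x + inverse (of_nat (Suc n)) * v n x)" by simp
    also have "\<dots> = l (p n) + inverse (of_nat (Suc n)) * l (v n)"
      using l_add[OF schwartz_square_integrable[OF p(1)] square_integrable_cmult(1)[OF vsq]] l_mul[OF vsq] by simp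
    also have "l (p n) = 0" unfolding l_def \<Phi>_def using TS[OF p(1)] by simp
    finally have "norm (l f) = inverse (real (Suc n)) * norm (l (v n))"
      by (simp add: norm_mult norm_inverse del: of_nat_Suc)
    also have "\<dots> \<le> inverse (real (Suc n)) * K" by (intro mult_left_mono lv) simp
    finally show ?thesis by (simp add: mult.commute)
  qed
  have "(\<lambda>n. K * inverse (real (Suc n))) \<longlonglongrightarrow> K * 0" by (intro tendsto_intros LIMSEQ_inverse_real_of_nat)
  hence "norm (l f) \<le> 0" by (intro LIMSEQ_le_const[of "\<lambda>n. K * inverse (real (Suc n))"]) (use lf in auto)
  thus ?thesis by (simp add: l_def \<Phi>_def)
qed

subsection \<open>Bootstrapping the decay of the eigenfunction\<close>

text \<open>All Schwartz windows are required, with constants that may depend on the window, because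
  derivatives of the transform change the window.\<close>

definition stft_decay :: "real \<Rightarrow> ('a::euclidean_space \<Rightarrow> complex) \<Rightarrow> bool" where
  "stft_decay r f \<longleftrightarrow> (\<forall>\<psi>\<in>schwartz. \<exists>C. \<forall>w. norm (stft \<psi> f w) * v_weight r w \<le> C)"

lemma stft_decay_0:
  fixes f :: "'a::euclidean_space \<Rightarrow> complex"
  assumes "square_integrable f" shows "stft_decay 0 f"
proof -
  have "v_weight 0 w = 1" for w :: "'a \<times> 'a" using bracket_pos[of w] by (simp add: v_weight_def)
  hence "norm (stft \<psi> f w) * v_weight 0 w \<le> (norm2 f + norm2 \<psi>) / 2" if "\<psi> \<in> schwartz" for \<psi> w
    using norm_stft_le[OF assms that, of w] by simp
  thus ?thesis unfolding stft_decay_def by blast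
qed

lemma pair_add: "z + w = (fst z + fst w, snd z + snd w)"
  by (simp add: prod_eq_iff)

text \<open>The gain \<open>s\<close> comes from \<open>translates_bound\<close> alone; the old rate
  \<open>r\<close> is preserved because it is used to normalise the family \<open>F\<close>.\<close>

lemma eigenfunction_decay_step:
  fixes a :: "((real^'d::finite) \<times> (real^'d) \<Rightarrow> complex) \<Rightarrow> complex"
  assumes s: "s > 0" and a: "a \<in> Minf_vs s" and \<phi>: "\<phi>1 \<in> schwartz" "\<phi>2 \<in> schwartz"
    and T: "is_loc_op a \<phi>1 \<phi>2 T" and f: "square_integrable f" and l: "lam \<noteq> 0"
    and eig: "AE x in lborel. T f x = lam * f x" and r: "r \<ge> 0" and dec: "stft_decay r f"
  shows "stft_decay (r + s) f"
  unfolding stft_decay_def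
proof
  fix \<phi> :: "(real^'d) \<Rightarrow> complex" assume p: "\<phi> \<in> schwartz"
  have at: "tempered_distribution a" using a unfolding Minf_vs_def by blast
  obtain C0 where C0: "\<And>z \<zeta>. norm (stft_distr gauss_window a (z, \<zeta>)) * v_weight s z \<le> C0"
    using a unfolding Minf_vs_def by blast
  note [measurable] = square_integrableD(1)[OF f]
  \<comment> \<open>Up to a phase, the adjoint time-frequency shift of \<open>f\<close> by
    \<open>w\<close>; \<open>F w\<close> below is its rescaling by the decay already known.\<close>
  define fw where "fw w = (\<lambda>y. f (y + fst w) * chr (- (y \<bullet> snd w)))" for w :: "(real^'d) \<times> (real^'d)"
  define F where "F w = (\<lambda>y. of_real (v_weight r w) * fw w y)" for w
  have fwsq: "square_integrable (fw w)" for w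
    using square_integrable_mult_bounded(1)[OF square_integrable_translate(1)[OF f, of "fst w"], of "\<lambda>y. chr (- (y \<bullet> snd w))" 1]
    by (simp add: fw_def mult.commute)
  have Fsq: "square_integrable (F w)" for w unfolding F_def by (rule square_integrable_cmult(1)[OF fwsq])
  \<comment> \<open>3657 holds by covariance: the transform of \<open>fw w\<close> at
    \<open>z\<close> is, up to a phase, that of \<open>f\<close> at \<open>z + w\<close>, so decay
    of \<open>f\<close> carries over to the family.\<close>
  have shift: "stft \<psi> f (z + w) = chr (- (fst w \<bullet> (snd z + snd w))) * stft \<psi> (fw w) z" if "\<psi> \<in> schwartz" for \<psi> z w
    unfolding pair_add[of z w] stft_shift[OF square_integrableD(1)[OF f] that] fw_def prod.collapse ..
  have poly: "poly_growth (\<lambda>w. stft \<psi> (F w))" if psi: "\<psi> \<in> schwartz" for \<psi>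
  proof -
    obtain C where C: "\<And>w. norm (stft \<psi> f w) * v_weight r w \<le> C" using dec psi unfolding stft_decay_def by blast
    have Cn: "C \<ge> 0"
      by (rule order_trans[OF _ C[of 0]]) (intro mult_nonneg_nonneg norm_ge_zero less_imp_le[OF v_weight_pos])
    obtain M :: nat where M: "r / 2 \<le> real M" using real_arch_simple by blast
    have "norm (stft \<psi> (F w) z) \<le> C * 2 powr (r / 2) * bracket z ^ M" for w z
    proof -
      have "norm (stft \<psi> (F w) z) = norm (stft \<psi> f (z + w)) * v_weight r w"
        unfolding F_def stft_cmult shift[OF that] using v_weight_pos[of r w] by (simp add: norm_mult)
      also have "v_weight r w \<le> 2 powr (r / 2) * v_weight r (z + w) * v_weight r (- z)"
        using v_weight_triangle[OF r, of "z + w" "- z"] by simp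
      also have "v_weight r (- z) = v_weight r z" by (simp add: v_weight_def)
      finally have "norm (stft \<psi> (F w) z) \<le> norm (stft \<psi> f (z + w)) * (2 powr (r / 2) * v_weight r (z + w) * v_weight r z)"
        by (simp add: mult_left_mono)
      also have "\<dots> = (norm (stft \<psi> f (z + w)) * v_weight r (z + w)) * (2 powr (r / 2) * v_weight r z)" by (simp add: mult_ac)
      also have "\<dots> \<le> C * (2 powr (r / 2) * bracket z ^ M)"
        using Cn v_weight_pos[of r z] by (intro mult_mono C v_weight_le_power[OF M]) (auto intro: less_imp_le)
      finally show ?thesis by (simp add: mult.assoc)
    qed
    thus ?thesis unfolding poly_growth_def by blast
  qed
  define G where "G w = (\<lambda>z. stft \<phi>1 (F w) z * cnj (stft \<phi>2 \<phi> z))" for w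
  have Gs: "smooth rapid G" unfolding G_def by (rule smooth_stft_product[OF Fsq poly \<phi> p])
  from translates_bound[OF at less_imp_le[OF s] C0 Gs]
  obtain C where C: "\<And>w. norm (a (\<lambda>z. G w (z - w))) * v_weight s w \<le> C" by blast
  have "norm (stft \<phi> f w) * v_weight (r + s) w \<le> C / norm lam" for w
  proof -
    \<comment> \<open>The time-frequency shift of \<open>\<phi>\<close> by \<open>w\<close>; testing
      the eigenvalue equation against it produces \<open>lam * stft \<phi> f w\<close>.\<close>
    define g where "g = (\<lambda>y. chr (y \<bullet> snd w) * \<phi> (y - fst w))"
    have gS: "g \<in> schwartz" unfolding g_def using schwartz_chr_mult[OF schwartz_translate[OF p, of "- fst w"]] by simp
    note [measurable] = schwartz_measurable[OF gS]
    have "square_integrable (T f)" using T f unfolding is_loc_op_def by blast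
    hence [measurable]: "T f \<in> borel_measurable borel" by (rule square_integrableD)
    have "L2_inner (T f) g = (LINT y|lborel. lam * (f y * cnj (g y)))"
      unfolding L2_inner_def by (rule integral_cong_AE) (use eig in \<open>auto simp: mult.assoc\<close>)
    also have "\<dots> = lam * stft \<phi> f w"
      unfolding stft_eq integral_mult_right_zero
      by (rule arg_cong[where f = "\<lambda>x. lam * x"], rule Bochner_Integration.integral_cong) (simp_all add: g_def cnj_chr mult_ac)
    finally have 1: "lam * stft \<phi> f w = a (\<lambda>z. stft \<phi>1 f z * cnj (stft \<phi>2 g z))"
      using loc_op_square_integrable[OF at \<phi> T f gS] by simp
    define c where "c = cnj (chr (fst w \<bullet> snd w)) * inverse (of_real (v_weight r w))"
    have e: "stft \<phi>1 f z * cnj (stft \<phi>2 g z) = c * G w (z - w)" for z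
    proof -
      define z' where "z' = z - w"
      have z: "z = z' + w" by (simp add: z'_def)
      let ?u = "chr (- (fst w \<bullet> (snd z' + snd w)))"
      have "stft \<phi>2 g (z' + w) = ?u * stft \<phi>2 (\<lambda>y. g (y + fst w) * chr (- (y \<bullet> snd w))) z'"
        unfolding pair_add[of z' w] stft_shift[OF schwartz_measurable[OF gS] \<phi>(2)] prod.collapse ..
      also have "(\<lambda>y. g (y + fst w) * chr (- (y \<bullet> snd w))) = (\<lambda>y. chr (fst w \<bullet> snd w) * \<phi> y)"
      proof
        fix y
        have "g (y + fst w) * chr (- (y \<bullet> snd w)) = (chr (y \<bullet> snd w) * chr (- (y \<bullet> snd w))) * (chr (fst w \<bullet> snd w) * \<phi> y)"
          by (simp only: g_def inner_add_left chr_add add_diff_cancel_right' mult_ac)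
        thus "g (y + fst w) * chr (- (y \<bullet> snd w)) = chr (fst w \<bullet> snd w) * \<phi> y" by simp
      qed
      finally have 2: "stft \<phi>2 g (z' + w) = ?u * (chr (fst w \<bullet> snd w) * stft \<phi>2 \<phi> z')" by (simp only: stft_cmult)
      \<comment> \<open>The only phase that depends on \<open>z'\<close> cancels between the two
        factors. Hence \<open>G w\<close> is merely translated, and the constant \<open>c\<close>
        collects the remaining phase and the normalisation.\<close>
      have uu: "?u * cnj ?u = 1" by (simp add: cnj_chr)
      have "stft \<phi>1 f (z' + w) * cnj (stft \<phi>2 g (z' + w)) = (?u * cnj ?u) * (cnj (chr (fst w \<bullet> snd w)) * (stft \<phi>1 (fw w) z' * cnj (stft \<phi>2 \<phi> z')))"
        unfolding 2 shift[OF \<phi>(1)] by (simp only: complex_cnj_mult mult_ac)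
      also have "\<dots> = c * G w z'"
        unfolding uu c_def G_def F_def stft_cmult using v_weight_pos[of r w] by simp
      finally show ?thesis unfolding z by simp
    qed
    have "(\<lambda>z. G w (z - w)) \<in> schwartz" using schwartz_translate[OF smooth_imp_schwartz[OF Gs, of w], of "- w"] by simp
    hence "lam * stft \<phi> f w = c * a (\<lambda>z. G w (z - w))" unfolding 1 e by (rule tempered_cmult[OF at])
    hence "norm lam * norm (stft \<phi> f w) = norm c * norm (a (\<lambda>z. G w (z - w)))" by (metis norm_mult)
    also have "norm c = inverse (v_weight r w)" using v_weight_pos[of r w] by (simp add: c_def norm_mult norm_inverse)
    finally have "norm lam * norm (stft \<phi> f w) * v_weight r w = norm (a (\<lambda>z. G w (z - w)))"
      using v_weight_pos[of r w] by (simp add: field_simps)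
    hence "norm lam * norm (stft \<phi> f w) * v_weight r w * v_weight s w \<le> C" using C[of w] by simp
    thus ?thesis using l by (simp add: v_weight_add pos_le_divide_eq mult_ac)
  qed
  thus "\<exists>C. \<forall>w. norm (stft \<phi> f w) * v_weight (r + s) w \<le> C" by blast
qed

subsection \<open>Rapid decay of the short-time Fourier transform implies smoothness\<close>

definition stft_rapid_decay :: "('a::euclidean_space \<Rightarrow> complex) \<Rightarrow> bool" where
  "stft_rapid_decay f \<longleftrightarrow> square_integrable f \<and> (\<forall>\<psi>\<in>schwartz. rapid (\<lambda>_::unit. stft \<psi> f))"

lemma stft_cong_AE:
  fixes f :: "'a::euclidean_space \<Rightarrow> complex"
  assumes "f \<in> borel_measurable borel" "h \<in> borel_measurable borel" "AE x in lborel. f x = h x" "\<psi> \<in> schwartz"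
  shows "stft \<psi> f z = stft \<psi> h z"
proof -
  note [measurable] = assms(1,2) schwartz_measurable[OF assms(4)]
  show ?thesis unfolding stft_eq by (rule integral_cong_AE) (use assms(3) in auto)
qed

lemma exp_square_has_derivative:
  fixes t :: "'a::euclidean_space"
  shows "((\<lambda>t. complex_of_real (exp (c * norm t ^ 2))) has_derivative (\<lambda>v. of_real (2 * c * (t \<bullet> v) * exp (c * norm t ^ 2)))) (at t)"
proof -
  have "((\<lambda>t. exp (c * (t \<bullet> t))) has_derivative (\<lambda>v. 2 * c * (t \<bullet> v) * exp (c * (t \<bullet> t)))) (at t)"
    by (auto intro!: derivative_eq_intros simp: inner_commute algebra_simps)
  thus ?thesis unfolding power2_norm_eq_inner by (rule bounded_linear.has_derivative[OF bounded_linear_of_real])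
qed

lemma chr_inner_has_derivative:
  fixes t :: "'a::euclidean_space"
  shows "((\<lambda>t. chr (t \<bullet> \<omega>)) has_derivative (\<lambda>v. 2 * pi * \<i> * of_real (v \<bullet> \<omega>) * chr (t \<bullet> \<omega>))) (at t)"
proof -
  have "((\<lambda>t. t \<bullet> \<omega>) has_derivative (\<lambda>v. v \<bullet> \<omega>)) (at t)" by (auto intro!: derivative_eq_intros)
  from has_derivative_compose[OF this chr_has_derivative] show ?thesis .
qed

text \<open>Slicing the transform at the diagonal point \<open>t = x\<close>, where the Gaussian window equals one
  and has vanishing derivative, recovers both the function and its derivatives.\<close>

lemma stft_rapid_decay_representative:
  fixes f :: "'a::euclidean_space \<Rightarrow> complex"
  assumes f: "stft_rapid_decay f"
  shows "\<exists>h. (AE x in lborel. f x = h x) \<and> (\<forall>x. h differentiable (at x)) \<and> rapid (\<lambda>_::unit. h)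
    \<and> (\<forall>b\<in>Basis. continuous_on UNIV (dird b h)) \<and> (\<forall>b\<in>Basis. rapid (\<lambda>_::unit. dird b h))"
proof -
  have sq: "square_integrable f" using f unfolding stft_rapid_decay_def by blast
  note [measurable] = square_integrableD(1)[OF sq]
  define W where "W = stft gauss_window f"
  let ?D = "DIM('a)"
  have Wr: "rapid (\<lambda>_::unit. W)" using f gauss_schwartz unfolding stft_rapid_decay_def W_def by blast
  \<comment> \<open>The powers are split by purpose: \<open>N\<close> for decay in \<open>x\<close>,
    \<open>?D\<close> for integrability in \<open>\<omega>\<close>, and one more for the factor
    \<open>\<omega>\<close> of a first derivative.\<close>
  have Wb: "\<exists>C\<ge>0. \<forall>x \<omega>. bracket x ^ N * (bracket \<omega> ^ ?D * (bracket \<omega> * norm (W (x, \<omega>)))) \<le> C" for N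
  proof -
    obtain C where C: "C \<ge> 0" "\<And>z. bracket z ^ (N + (?D + 1)) * norm (W z) \<le> C"
      using rapid_inE[OF Wr, of "N + (?D + 1)"] by metis
    have "bracket x ^ N * (bracket \<omega> ^ ?D * (bracket \<omega> * norm (W (x, \<omega>)))) \<le> C" for x \<omega>
    proof -
      have "bracket x ^ N * bracket \<omega> ^ (?D + 1) \<le> bracket (x, \<omega>) ^ N * bracket (x, \<omega>) ^ (?D + 1)"
        by (intro mult_mono power_mono add_left_mono norm_snd_le norm_fst_le) auto
      hence "bracket x ^ N * bracket \<omega> ^ (?D + 1) * norm (W (x, \<omega>)) \<le> bracket (x, \<omega>) ^ (N + (?D + 1)) * norm (W (x, \<omega>))"
        unfolding power_add[of _ N] by (rule mult_right_mono) simp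
      thus ?thesis using C(2)[of "(x, \<omega>)"] by (simp add: mult_ac)
    qed
    thus ?thesis using C(1) by blast
  qed
  have Wc: "continuous_on UNIV W"
  proof -
    have "W differentiable (at z)" for z
      unfolding W_def using stft_has_derivative[OF sq gauss_schwartz] differentiableI by blast
    thus ?thesis by (simp add: continuous_at_imp_continuous_on differentiable_imp_continuous_within)
  qed
  have Wm [measurable]: "(\<lambda>\<omega>. W (x, \<omega>)) \<in> borel_measurable borel" for x
    by (rule borel_measurable_continuous_onI, rule continuous_on_compose2[OF Wc]) (auto intro!: continuous_intros)
  let ?J = "LINT \<omega>|lborel. 1 / bracket (\<omega>::'a) ^ ?D"
  \<comment> \<open>The multiplier \<open>q\<close> stands for a character, or for a character times
    the linear factor that differentiation produces.\<close>
  have key: "integrable lborel (\<lambda>\<omega>. q \<omega> * W (x, \<omega>))"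
    "bracket x ^ N * norm (LINT \<omega>|lborel. q \<omega> * W (x, \<omega>)) \<le> K * C * ?J"
    if C: "\<And>x \<omega>. bracket x ^ N * (bracket \<omega> ^ ?D * (bracket \<omega> * norm (W (x, \<omega>)))) \<le> C"
      and q: "q \<in> borel_measurable borel" "\<And>\<omega>. norm (q \<omega>) \<le> K * bracket \<omega>" and K: "K \<ge> 0" for N C q x K
  proof -
    note [measurable] = q(1)
    let ?w = "complex_of_real (bracket x ^ N)"
    have w: "norm ?w = bracket x ^ N" unfolding norm_of_real by simp
    have m: "(\<lambda>\<omega>. ?w * (q \<omega> * W (x, \<omega>))) \<in> borel_measurable borel" by measurable
    have b: "bracket \<omega> ^ ?D * norm (?w * (q \<omega> * W (x, \<omega>))) \<le> K * C" for \<omega>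
    proof -
      have "bracket \<omega> ^ ?D * norm (?w * (q \<omega> * W (x, \<omega>))) = (bracket x ^ N * bracket \<omega> ^ ?D * norm (W (x, \<omega>))) * norm (q \<omega>)"
        unfolding norm_mult w by (simp only: mult_ac)
      also have "\<dots> \<le> (bracket x ^ N * bracket \<omega> ^ ?D * norm (W (x, \<omega>))) * (K * bracket \<omega>)"
        by (intro mult_left_mono q) (auto intro!: mult_nonneg_nonneg)
      also have "\<dots> = K * (bracket x ^ N * (bracket \<omega> ^ ?D * (bracket \<omega> * norm (W (x, \<omega>)))))"
        by (simp only: mult_ac)
      also have "\<dots> \<le> K * C" by (intro mult_left_mono C K)
      finally show ?thesis .
    qed
    have "integrable lborel (\<lambda>\<omega>. inverse ?w * (?w * (q \<omega> * W (x, \<omega>))))"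
      by (rule integrable_mult_right[OF integrable_bracket_bound[OF m b]])
    moreover have "inverse ?w * (?w * z) = z" for z
      using bracket_power_pos[of x N] by (metis left_inverse mult.assoc mult_1 norm_zero w less_irrefl)
    ultimately show "integrable lborel (\<lambda>\<omega>. q \<omega> * W (x, \<omega>))" by (simp only:)
    show "bracket x ^ N * norm (LINT \<omega>|lborel. q \<omega> * W (x, \<omega>)) \<le> K * C * ?J"
      using integral_bracket_bound[OF m b] unfolding integral_mult_right_zero norm_mult w .
  qed
  define k where "k x t = (LINT \<omega>|lborel. W (x, \<omega>) * chr (t \<bullet> \<omega>))" for x t
  define k' where "k' x t v = (LINT \<omega>|lborel. W (x, \<omega>) * (2 * pi * \<i> * of_real (v \<bullet> \<omega>) * chr (t \<bullet> \<omega>)))" for x t v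
  have nb: "norm (2 * pi * \<i> * of_real (v \<bullet> \<omega>) * chr (t \<bullet> \<omega>)) \<le> (2 * pi * norm v) * bracket \<omega>" for v \<omega> t :: 'a
  proof -
    have "norm \<omega> \<le> 1 + norm \<omega> ^ 2" using zero_le_power2[of "norm \<omega> - 1/2"] by (simp add: power2_eq_square algebra_simps)
    hence "\<bar>v \<bullet> \<omega>\<bar> \<le> norm v * bracket \<omega>"
      using Cauchy_Schwarz_ineq2[of v \<omega>] by (meson mult_left_mono norm_ge_zero order_trans)
    hence "2 * pi * \<bar>v \<bullet> \<omega>\<bar> \<le> 2 * pi * (norm v * bracket \<omega>)" by (intro mult_left_mono) auto
    thus ?thesis by (simp add: norm_mult mult.assoc)
  qed
  obtain C0 where C0: "\<And>x \<omega>. bracket x ^ 0 * (bracket \<omega> ^ ?D * (bracket \<omega> * norm (W (x, \<omega>)))) \<le> C0"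
    using Wb[of 0] by metis
  have Wi: "integrable lborel (\<lambda>\<omega>. W (x, \<omega>))" for x
    using key(1)[OF C0, of "\<lambda>_. 1" 1 x] by simp
  have kc: "continuous_on UNIV (k x)" for x unfolding k_def by (rule continuous_on_chr_integral[OF Wi])
  have k'i: "integrable lborel (\<lambda>\<omega>. 2 * pi * \<i> * of_real (v \<bullet> \<omega>) * W (x, \<omega>))" for v x
    using key(1)[OF C0, of "\<lambda>\<omega>. 2 * pi * \<i> * of_real (v \<bullet> \<omega>)" "2 * pi * norm v" x] nb[of v _ 0] by simp
  have k'c: "continuous_on UNIV (\<lambda>t. k' x t v)" for x v
    using continuous_on_chr_integral[OF k'i, of v x] unfolding k'_def by (simp add: mult_ac)
  have kd: "(k x has_derivative k' x t) (at t)" for x t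
    unfolding k_def k'_def
  proof (rule has_derivative_lborel_integral[where g = "\<lambda>\<omega>. 2 * pi * norm (bracket \<omega> * W (x, \<omega>))"])
    show "((\<lambda>t. W (x, \<omega>) * chr (t \<bullet> \<omega>)) has_derivative (\<lambda>v. W (x, \<omega>) * (2 * pi * \<i> * of_real (v \<bullet> \<omega>) * chr (t \<bullet> \<omega>)))) (at t)" for \<omega> t
      by (intro has_derivative_mult_right chr_inner_has_derivative)
    show "norm (W (x, \<omega>) * (2 * pi * \<i> * of_real (v \<bullet> \<omega>) * chr (t \<bullet> \<omega>))) \<le> 2 * pi * norm (complex_of_real (bracket \<omega>) * W (x, \<omega>)) * norm v" for \<omega> t v
    proof -
      have "norm (W (x, \<omega>)) * norm (2 * pi * \<i> * of_real (v \<bullet> \<omega>) * chr (t \<bullet> \<omega>)) \<le> norm (W (x, \<omega>)) * ((2 * pi * norm v) * bracket \<omega>)"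
        by (intro mult_left_mono nb) simp
      moreover have m: "norm (complex_of_real (bracket \<omega>)) = 1 + norm \<omega> ^ 2" unfolding norm_of_real by simp
      have "2 * pi * norm (complex_of_real (bracket \<omega>) * W (x, \<omega>)) * norm v = norm (W (x, \<omega>)) * ((2 * pi * norm v) * bracket \<omega>)"
        unfolding norm_mult m by (simp only: mult_ac)
      ultimately show ?thesis by (simp only: norm_mult[of "W (x, \<omega>)"])
    qed
    have "norm (complex_of_real (bracket \<omega>)) \<le> 1 * bracket \<omega>" for \<omega> :: 'a unfolding norm_of_real by simp
    from key(1)[OF C0 _ this, of x]
    show "integrable lborel (\<lambda>\<omega>. 2 * pi * norm (complex_of_real (bracket \<omega>) * W (x, \<omega>)))"
      by (intro integrable_mult_right integrable_norm) simp
    show "integrable lborel (\<lambda>\<omega>. W (x, \<omega>) * chr (t \<bullet> \<omega>))" for t by (rule integrable_mult_chr[OF Wi]) measurable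
    show "(\<lambda>\<omega>. W (x, \<omega>) * (2 * pi * \<i> * of_real (v \<bullet> \<omega>) * chr (t \<bullet> \<omega>))) \<in> borel_measurable lborel" for v by measurable
  qed
  have inv: "AE t in lborel. f t * gauss_window (t - x) = k x t" for x
  proof -
    let ?g = "\<lambda>y. f y * cnj (gauss_window (y - x))"
    have g: "integrable lborel ?g"
      by (intro square_integrable_mult sq schwartz_square_integrable schwartz_conj_shift gauss_schwartz)
    have fg: "fourier ?g = (\<lambda>\<omega>. W (x, \<omega>))" unfolding fourier_def W_def stft_eq by simp
    show ?thesis using fourier_inversion[OF g] Wi unfolding fg k_def by (simp add: gauss_window_simps)
  qed
  define E where "E t = complex_of_real (exp (pi * norm t ^ 2))" for t :: 'a
  have Eg: "gauss_window t * E t = 1" for t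
    unfolding gauss_window_def E_def by (simp only: of_real_mult[symmetric] exp_add[symmetric]) simp
  \<comment> \<open>The slice at 0 divided by the Gaussian is differentiable, but the growth of
    \<open>E\<close> hides all decay; decay has to be read off from the slices at the other
    points.\<close>
  define h where "h t = k 0 t * E t" for t
  define h' where "h' t v = k 0 t * of_real (2 * pi * (t \<bullet> v) * exp (pi * norm t ^ 2)) + k' 0 t v * E t" for t v
  have hd: "(h has_derivative h' t) (at t)" for t
    unfolding h_def h'_def E_def by (intro has_derivative_mult kd exp_square_has_derivative)
  have hdiff: "h differentiable (at t)" for t using hd differentiableI by blast
  have hc: "continuous_on UNIV h" using hdiff by (simp add: continuous_at_imp_continuous_on differentiable_imp_continuous_within)
  have fh: "AE t in lborel. f t = h t"
    using inv[of 0] 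
  proof (rule AE_mp, intro AE_I2 impI)
    fix t assume "f t * gauss_window (t - 0) = k 0 t"
    hence "h t = f t * (gauss_window t * E t)" by (simp add: h_def)
    thus "f t = h t" unfolding Eg by simp
  qed
  \<comment> \<open>Inversion gives this almost everywhere for each \<open>x\<close>; continuity of
    both sides makes it hold everywhere, in particular at \<open>t = x\<close>.\<close>
  have hk: "h t * gauss_window (t - x) = k x t" for x t
  proof (rule AE_continuous_eq[OF _ kc])
    show "continuous_on UNIV (\<lambda>t. h t * gauss_window (t - x))"
      by (intro continuous_intros hc continuous_on_compose2[OF schwartz_continuous[OF gauss_schwartz]]) auto
    show "AE t in lborel. h t * gauss_window (t - x) = k x t"
      using inv[of x] fh by eventually_elim simp
  qed
  have hx: "h x = k x x" for x using hk[of x x] by (simp add: gauss_window_simps)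
  have h'x: "h' x v = k' x x v" for x v
  proof -
    have sh: "((\<lambda>t. t - x) has_derivative (\<lambda>v. v)) (at x)" by (auto intro!: derivative_eq_intros)
    have "((\<lambda>t. gauss_window t) has_derivative (\<lambda>v. of_real (2 * - pi * ((x - x) \<bullet> v) * exp (- pi * norm (x - x) ^ 2)))) (at (x - x))"
      unfolding gauss_window_def by (rule exp_square_has_derivative)
    from has_derivative_mult[OF hd has_derivative_compose[OF sh this]]
    have "((\<lambda>t. h t * gauss_window (t - x)) has_derivative (\<lambda>v. h' x v)) (at x)"
      by (simp add: gauss_window_simps)
    hence "(k x has_derivative h' x) (at x)" unfolding hk by simp
    from has_derivative_unique[OF this kd] show ?thesis by simp
  qed
  have hb: "dird b h = (\<lambda>x. h' x b)" for b by (rule dird_eq[OF hd])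
  show ?thesis
  proof (intro exI conjI allI ballI)
    show "AE x in lborel. f x = h x" by (rule fh)
    show "h differentiable (at x)" for x by (rule hdiff)
    show "rapid (\<lambda>_::unit. h)" unfolding rapid_in_def
    proof
      fix N
      obtain C where C: "\<And>x \<omega>. bracket x ^ N * (bracket \<omega> ^ ?D * (bracket \<omega> * norm (W (x, \<omega>)))) \<le> C" using Wb[of N] by metis
      have "bracket x ^ N * norm (h x) \<le> 1 * C * ?J" for x
        using key(2)[OF C, of "\<lambda>\<omega>. chr (x \<bullet> \<omega>)" 1 x] unfolding hx k_def by (simp add: mult.commute[of "W _"])
      thus "\<exists>C. \<forall>(i::unit) x. bracket x ^ N * norm (h x) \<le> C" by blast
    qed
    fix b :: 'a assume b: "b \<in> Basis"
    show "continuous_on UNIV (dird b h)"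
      unfolding hb h'_def E_def by (intro continuous_intros kc k'c)
    show "rapid (\<lambda>_::unit. dird b h)" unfolding rapid_in_def
    proof
      fix N
      obtain C where C: "\<And>x \<omega>. bracket x ^ N * (bracket \<omega> ^ ?D * (bracket \<omega> * norm (W (x, \<omega>)))) \<le> C" using Wb[of N] by metis
      have "bracket x ^ N * norm (dird b h x) \<le> (2 * pi * norm b) * C * ?J" for x
        using key(2)[OF C, of "\<lambda>\<omega>. 2 * pi * \<i> * of_real (b \<bullet> \<omega>) * chr (x \<bullet> \<omega>)" "2 * pi * norm b" x] nb
        unfolding hb h'x k'_def by (simp add: mult.commute[of "W _"])
      thus "\<exists>C. \<forall>(i::unit) x. bracket x ^ N * norm (dird b h x) \<le> C" by blast
    qed
  qed
qed

lemma square_integrable_rapid: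
  fixes f :: "'a::euclidean_space \<Rightarrow> complex"
  assumes "continuous_on UNIV f" "rapid (\<lambda>_::unit. f)"
  shows "square_integrable f"
proof -
  obtain C where "\<And>x. bracket x ^ DIM('a) * norm (f x) \<le> C" using rapid_inE[OF assms(2), of "DIM('a)"] by metis
  thus ?thesis by (rule square_integrable_bracket_bound[OF borel_measurable_continuous_onI[OF assms(1)]])
qed

text \<open>Integration by parts moves the derivative onto the window and the character. This gives
  the transform for the differentiated window and a linear factor in frequency times the transform
  for the old one, both rapidly decaying.\<close>

lemma stft_rapid_decay_dird:
  fixes h :: "'a::euclidean_space \<Rightarrow> complex"
  assumes R: "\<And>\<psi>. \<psi> \<in> schwartz \<Longrightarrow> rapid (\<lambda>_::unit. stft \<psi> h)"
    and d: "\<And>x. h differentiable (at x)" and hr: "rapid (\<lambda>_::unit. h)"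
    and dc: "\<And>b. b \<in> Basis \<Longrightarrow> continuous_on UNIV (dird b h)" and dr: "\<And>b. b \<in> Basis \<Longrightarrow> rapid (\<lambda>_::unit. dird b h)"
    and b: "b \<in> Basis"
  shows "stft_rapid_decay (dird b h)"
  unfolding stft_rapid_decay_def
proof (intro conjI ballI)
  show dsq: "square_integrable (dird b h)" by (rule square_integrable_rapid[OF dc[OF b] dr[OF b]])
  have hc: "continuous_on UNIV h" using d by (simp add: continuous_at_imp_continuous_on differentiable_imp_continuous_within)
  have hsq: "square_integrable h" by (rule square_integrable_rapid[OF hc hr])
  fix \<psi> :: "'a \<Rightarrow> complex" assume \<psi>: "\<psi> \<in> schwartz"
  let ?D = "DIM('a)"
  have parts: "stft \<psi> (dird b h) z = -1 * stft (dird b \<psi>) h z + (2 * pi * \<i>) * (of_real (b \<bullet> snd z) * stft \<psi> h z)" for z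
  proof -
    let ?\<psi> = "\<lambda>y. cnj (\<psi> (y - fst z))"
    define g where "g = (\<lambda>y. chr (y \<bullet> - snd z) * ?\<psi> y)"
    have \<psi>S: "?\<psi> \<in> schwartz" by (rule schwartz_conj_shift[OF \<psi>])
    have gS: "g \<in> schwartz" unfolding g_def by (rule schwartz_chr_mult[OF \<psi>S])
    have d\<psi>: "dird b ?\<psi> = (\<lambda>y. cnj (dird b \<psi> (y - fst z)))"
    proof -
      have 1: "((\<lambda>y. y - fst z) has_derivative (\<lambda>v. v)) (at y)" for y by (auto intro!: derivative_eq_intros)
      have 2: "(\<psi> has_derivative frechet_derivative \<psi> (at (y - fst z))) (at (y - fst z))" for y
        using schwartz_differentiable[OF \<psi>] frechet_derivative_works by blast
      show ?thesis
        using dird_eq[OF bounded_linear.has_derivative[OF bounded_linear_cnj has_derivative_compose[OF 1 2]], of b] by (simp add: dird_def)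
    qed
    have dg: "dird b g = (\<lambda>y. chr (y \<bullet> - snd z) * cnj (dird b \<psi> (y - fst z)) + 2 * pi * \<i> * of_real (b \<bullet> - snd z) * g y)"
      unfolding g_def dird_chr_mult[OF schwartz_differentiable[OF \<psi>S]] d\<psi> ..
    let ?u' = "\<lambda>y v. h y * (\<Sum>c\<in>Basis. of_real (v \<bullet> c) * dird c g y) + (\<Sum>c\<in>Basis. of_real (v \<bullet> c) * dird c h y) * g y"
    obtain Ch where Ch: "Ch \<ge> 0" "\<And>x. bracket x ^ ?D * norm (h x) \<le> Ch" using rapid_inE[OF hr, of ?D] by metis
    obtain Cg where Cg: "Cg \<ge> 0" "\<And>x. norm (g x) \<le> Cg" using schwartzE[OF gS, of 0] by (metis mult_1 power_0)
    have "\<forall>c\<in>Basis. \<exists>C. 0 \<le> C \<and> (\<forall>x. norm (dird c g x) \<le> C)"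
      using schwartzE[OF schwartz_dird[OF gS], of _ 0] by (metis mult_1 power_0)
    from bchoice[OF this] obtain Cd where Cd: "\<forall>c\<in>Basis. 0 \<le> Cd c \<and> (\<forall>x. norm (dird c g x) \<le> Cd c)" ..
    have "\<forall>c\<in>Basis. \<exists>C. 0 \<le> C \<and> (\<forall>x. bracket x ^ ?D * norm (dird c h x) \<le> C)"
      using rapid_inE[OF dr, of _ ?D] by metis
    from bchoice[OF this] obtain Ce where Ce: "\<forall>c\<in>Basis. 0 \<le> Ce c \<and> (\<forall>x. bracket x ^ ?D * norm (dird c h x) \<le> Ce c)" ..
    define Sd where "Sd = (\<Sum>c\<in>Basis. Cd c)"
    define Se where "Se = (\<Sum>c\<in>Basis. Ce c)"
    have Sd: "norm (dird c g x) \<le> Sd" if c: "c \<in> Basis" for c x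
    proof -
      have "Cd c \<le> Sd" unfolding Sd_def by (rule member_le_sum[OF c]) (use Cd in auto)
      thus ?thesis using bspec[OF Cd c] by (meson order_trans)
    qed
    have Se: "norm (dird c h x) \<le> Se / bracket x ^ ?D" if c: "c \<in> Basis" for c x
    proof -
      have "Ce c \<le> Se" unfolding Se_def by (rule member_le_sum[OF c]) (use Ce in auto)
      hence "bracket x ^ ?D * norm (dird c h x) \<le> Se" using bspec[OF Ce c] by (meson order_trans)
      thus ?thesis using bracket_power_pos[of x ?D] by (simp add: pos_le_divide_eq mult.commute)
    qed
    have Sd0: "Sd \<ge> 0" and Se0: "Se \<ge> 0" unfolding Sd_def Se_def using Cd Ce by (auto intro!: sum_nonneg)
    \<comment> \<open>Here \<open>h\<close> is only once differentiable, so the formula for Schwartz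
      functions does not apply. The general one does, because the decay of \<open>h\<close> and
      \<open>dird c h\<close> times the boundedness of \<open>g\<close> and \<open>dird c g\<close>
      dominates \<open>?u'\<close>.\<close>
    have "(LINT y|lborel. ?u' y b) = 0"
    proof (rule integral_derivative_eq_0)
      show "((\<lambda>y. h y * g y) has_derivative ?u' y) (at y)" for y
        by (intro has_derivative_mult has_derivative_dird_sum d schwartz_differentiable[OF gS])
      show "integrable lborel (\<lambda>y. h y * g y)" by (rule square_integrable_mult(1)[OF hsq schwartz_square_integrable[OF gS]])
      show "bracket y ^ ?D * norm (?u' y v) \<le> (Ch * (real ?D * Sd) + real ?D * Se * Cg) * norm v" for y v
      proof -
        let ?w = "bracket y ^ ?D"
        have "norm (?u' y v) \<le> norm (h y) * (real ?D * Sd * norm v) + (real ?D * (Se / ?w) * norm v) * Cg"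
          by (rule order_trans[OF norm_triangle_ineq], unfold norm_mult)
             (intro add_mono mult_mono norm_dird_sum_le Sd Se Cg order_refl, auto intro!: mult_nonneg_nonneg divide_nonneg_nonneg Se0)
        hence "?w * norm (?u' y v) \<le> ?w * (norm (h y) * (real ?D * Sd * norm v) + (real ?D * (Se / ?w) * norm v) * Cg)"
          by (intro mult_left_mono) auto
        also have "\<dots> = (?w * norm (h y)) * (real ?D * Sd * norm v) + real ?D * Se * norm v * Cg"
          using bracket_pos[of y] by (simp add: field_simps)
        also have "\<dots> \<le> Ch * (real ?D * Sd * norm v) + real ?D * Se * norm v * Cg"
          by (intro add_right_mono mult_right_mono Ch) (auto intro!: mult_nonneg_nonneg Sd0)
        finally show ?thesis by (simp add: algebra_simps)
      qed
      have "dird c g \<in> borel_measurable borel" "dird c h \<in> borel_measurable borel" if "c \<in> Basis" for c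
        using schwartz_measurable[OF schwartz_dird[OF gS that]] borel_measurable_continuous_onI[OF dc[OF that]] by auto
      moreover note [measurable] = square_integrableD(1)[OF hsq] schwartz_measurable[OF gS]
      ultimately show "(\<lambda>y. ?u' y v) \<in> borel_measurable lborel" for v by measurable
    qed
    hence "0 = (LINT y|lborel. h y * dird b g y + dird b h y * g y)" unfolding sum_inner_Basis[OF b] by simp
    also have "\<dots> = (LINT y|lborel. (h y * cnj (dird b \<psi> (y - fst z)) * chr (- (y \<bullet> snd z)) - 2 * pi * \<i> * of_real (b \<bullet> snd z) * (h y * cnj (\<psi> (y - fst z)) * chr (- (y \<bullet> snd z))))
        + dird b h y * cnj (\<psi> (y - fst z)) * chr (- (y \<bullet> snd z)))"
      by (rule Bochner_Integration.integral_cong) (simp_all add: dg, simp_all add: g_def algebra_simps)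
    also have "\<dots> = (stft (dird b \<psi>) h z - 2 * pi * \<i> * of_real (b \<bullet> snd z) * stft \<psi> h z) + stft \<psi> (dird b h) z"
      unfolding stft_eq integral_mult_right_zero[symmetric]
      by (subst Bochner_Integration.integral_add Bochner_Integration.integral_diff,
          intro Bochner_Integration.integrable_diff integrable_mult_right integrable_stft hsq dsq \<psi> schwartz_dird b,
          intro integrable_stft dsq \<psi>,
          subst Bochner_Integration.integral_diff,
          intro integrable_stft hsq schwartz_dird \<psi> b,
          intro integrable_mult_right integrable_stft hsq \<psi>, rule refl)
    finally show ?thesis by (simp add: algebra_simps eq_neg_iff_add_eq_0)
  qed
  have lin: "bounded_linear (\<lambda>z::'a \<times> 'a. b \<bullet> snd z)"
    using bounded_linear_compose[OF bounded_linear_inner_right bounded_linear_snd] .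
  have add: "rapid F \<Longrightarrow> rapid G \<Longrightarrow> rapid (\<lambda>i x. F i x + G i x)" and mul: "rapid F \<Longrightarrow> rapid (\<lambda>i x. c * F i x)"
    for F G :: "unit \<Rightarrow> 'a \<times> 'a \<Rightarrow> complex" and c
    using additive_growth_rapid_in[of "\<lambda>x::'a \<times> 'a. x", where 'c=unit] unfolding additive_growth_def by blast+
  have "rapid (\<lambda>(_::unit) z. -1 * stft (dird b \<psi>) h z + (2 * pi * \<i>) * (of_real (b \<bullet> snd z) * stft \<psi> h z))"
    by (intro add mul R schwartz_dird \<psi> b rapid_poly_mult[OF poly_growth_linear[OF lin]])
  thus "rapid (\<lambda>_::unit. stft \<psi> (dird b h))" unfolding parts[abs_def, symmetric] by (simp add: parts)
qed

text \<open>Each round yields just one derivative, but that derivative is continuous and again has a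
  rapidly decaying transform, so the argument repeats. Continuity turns equality almost everywhere
  with the representative into equality.\<close>

theorem stft_rapid_decay_schwartz:
  fixes f :: "'a::euclidean_space \<Rightarrow> complex"
  assumes "stft_rapid_decay f"
  shows "\<exists>h\<in>schwartz. AE x in lborel. f x = h x"
proof -
  have reg: "regular rapid n (\<lambda>_::unit. f)" if "stft_rapid_decay f" "continuous_on UNIV f" for n and f :: "'a \<Rightarrow> complex"
    using that
  proof (induction n arbitrary: f)
    case (0 f)
    obtain h where h: "AE x in lborel. f x = h x" "\<forall>x. h differentiable (at x)" "rapid (\<lambda>_::unit. h)"
      using stft_rapid_decay_representative[OF 0(1)] by blast
    have "continuous_on UNIV h" using h(2) by (simp add: continuous_at_imp_continuous_on differentiable_imp_continuous_within)
    hence "f = h" using AE_continuous_eq[OF 0(2) _ h(1)] by blast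
    thus ?case using h(3) by simp
  next
    case (Suc n f)
    obtain h where h: "AE x in lborel. f x = h x" "\<forall>x. h differentiable (at x)" "rapid (\<lambda>_::unit. h)"
      "\<forall>b\<in>Basis. continuous_on UNIV (dird b h)" "\<forall>b\<in>Basis. rapid (\<lambda>_::unit. dird b h)"
      using stft_rapid_decay_representative[OF Suc.prems(1)] by blast
    have "continuous_on UNIV h" using h(2) by (simp add: continuous_at_imp_continuous_on differentiable_imp_continuous_within)
    hence fh: "f = h" using AE_continuous_eq[OF Suc.prems(2) _ h(1)] by blast
    have "stft_rapid_decay (dird b f)" if "b \<in> Basis" for b
    proof (rule stft_rapid_decay_dird[OF _ _ _ _ _ that])
      show "rapid (\<lambda>_::unit. stft \<psi> f)" if "\<psi> \<in> schwartz" for \<psi>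
        using Suc.prems(1) that unfolding stft_rapid_decay_def by blast
    qed (use h in \<open>simp_all add: fh\<close>)
    thus ?case using h Suc.IH unfolding fh by simp
  qed
  obtain h where h: "AE x in lborel. f x = h x" "\<forall>x. h differentiable (at x)" "rapid (\<lambda>_::unit. h)"
    using stft_rapid_decay_representative[OF assms] by blast
  have hc: "continuous_on UNIV h" using h(2) by (simp add: continuous_at_imp_continuous_on differentiable_imp_continuous_within)
  have hsq: "square_integrable h" by (rule square_integrable_rapid[OF hc h(3)])
  have fsq: "square_integrable f" using assms unfolding stft_rapid_decay_def by blast
  have "stft \<psi> f = stft \<psi> h" if "\<psi> \<in> schwartz" for \<psi>
    using stft_cong_AE[OF square_integrableD(1)[OF fsq] square_integrableD(1)[OF hsq] h(1) that] by blast
  hence "stft_rapid_decay h" using assms hsq unfolding stft_rapid_decay_def by simp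
  hence "h \<in> schwartz" unfolding schwartz_iff_smooth smooth_def using reg[OF _ hc] by blast
  thus ?thesis using h(1) by blast
qed

theorem theorem3p12:
  fixes a :: "((real^'d::finite) \<times> (real^'d) \<Rightarrow> complex) \<Rightarrow> complex"
    and \<phi>1 \<phi>2 :: "(real^'d) \<Rightarrow> complex"
    and T :: "((real^'d) \<Rightarrow> complex) \<Rightarrow> ((real^'d) \<Rightarrow> complex)"
    and s :: real and lam :: complex and f :: "(real^'d) \<Rightarrow> complex"
  assumes "s > 0" and "a \<in> Minf_vs s"
    and "\<phi>1 \<in> schwartz" and "\<phi>2 \<in> schwartz"
    and "\<exists>x. \<phi>1 x \<noteq> 0" and "\<exists>x. \<phi>2 x \<noteq> 0"
    and "is_loc_op a \<phi>1 \<phi>2 T"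
    and "lam \<noteq> 0"
    and "square_integrable f" and "\<not> (AE x in lborel. f x = 0)"
    and "AE x in lborel. T f x = lam * f x"
  shows "\<exists>h\<in>schwartz. AE x in lborel. f x = h x"
proof (rule stft_rapid_decay_schwartz)
  \<comment> \<open>Starts from weight 0, where square integrability alone bounds the
    transform.\<close>
  have dec: "stft_decay (real n * s) f" for n
  proof (induction n)
    case 0 show ?case using stft_decay_0[OF assms(9)] by simp
  next
    case (Suc n)
    have "stft_decay (real n * s + s) f"
      using assms(1) by (intro eigenfunction_decay_step[OF assms(1,2,3,4,7,9,8,11) _ Suc]) simp
    thus ?case by (simp add: distrib_right add.commute)
  qed
  have "rapid (\<lambda>_::unit. stft \<psi> f)" if psi: "\<psi> \<in> schwartz" for \<psi>
    unfolding rapid_in_def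
  proof
    fix N
    \<comment> \<open>\<open>v_weight\<close> raises the bracket to half its parameter, so
      \<open>N\<close> powers need the parameter 2 N.\<close>
    obtain n :: nat where n: "2 * real N \<le> real n * s"
      using reals_Archimedean3[OF assms(1)] less_imp_le by blast
    obtain C where C: "\<And>w. norm (stft \<psi> f w) * v_weight (real n * s) w \<le> C"
      using dec psi unfolding stft_decay_def by blast
    have "bracket w ^ N * norm (stft \<psi> f w) \<le> C" for w
    proof -
      have "bracket w ^ N = bracket w powr real N" using bracket_pos[of w] by (simp add: powr_realpow)
      also have "\<dots> \<le> v_weight (real n * s) w"
        unfolding v_weight_def using n by (intro powr_mono) auto
      finally have "bracket w ^ N * norm (stft \<psi> f w) \<le> v_weight (real n * s) w * norm (stft \<psi> f w)"
        by (rule mult_right_mono) simp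
      thus ?thesis using C[of w] by (simp add: mult.commute)
    qed
    thus "\<exists>C. \<forall>(i::unit) w. bracket w ^ N * norm (stft \<psi> f w) \<le> C" by blast
  qed
  thus "stft_rapid_decay f" using assms(9) unfolding stft_rapid_decay_def by blast
qed

end
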